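(* Assume that the complex numbers $z_1,\dots,z_n$ satisfy the conditions $z_i^2\ne z_j^2$ for $i\ne j$. Then the graded tensor product $V^\sigma(z_1)*\dots*V^\sigma(z_n)$ is well defined and is isomorphic to the twisted Weyl module $W^\sigma_{-n}$ as an $\mathfrak{osp}(1,2)[t]^\sigma$-module.
   Context: Everything is over $\mathbb{C}$. $\mathfrak{osp}(1,2)$ is the Lie superalgebra with even part $\mathfrak{sl}_2$ (standard basis $e,h,f$) and odd part $\pi_1$ with basis $g^+,g^-$; the nontrivial brackets are $[e,f]=h$, $[h,e]=2e$, $[h,f]=-2f$, $[h,g^\pm]=\pm g^\pm$, $[g^+,g^-]_+=h$, $[g^+,g^+]_+=2e$, $[g^-,g^-]_+=-2f$, $[f,g^+]=-g^-$, $[e,g^-]=-g^+$. Write $y_i=y\otimes t^i$. The twisted current algebra is $\mathfrak{osp}(1,2)[t]^\sigma=\bigoplus_{i\ge0}\mathfrak{sl}_2\otimes t^{2i}\oplus\bigoplus_{i\ge0}\pi_1\otimes t^{2i+1}$. $W^\sigma_{-n}$ is the cyclic, $\mathfrak{sl}_2$-integrable $\mathfrak{osp}(1,2)[t]^\sigma$-module with generator $w_{-n}^\sigma$ and defining relations $f_{2i}w^\sigma_{-n}=0$, $g^-_{2i+1}w^\sigma_{-n}=0$, $h_{2i+2}w^\sigma_{-n}=0$ ($i\ge0$), $h_0w^\sigma_{-n}=-nw^\sigma_{-n}$, $e_0^{n+1}w^\sigma_{-n}=0$. $V$ is the $3$-dimensional irreducible $\mathfrak{osp}(1,2)$-module ($h$-weights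 $-1,0,1$), with cyclic vector its lowest weight vector $\mathsf v$, taken to be even. For $z\in\mathbb{C}$, $V^\sigma(z)$ is $V$ with $y\otimes t^k\in\mathfrak{osp}(1,2)[t]^\sigma$ acting as $z^ky$. Tensor products use the sign rule $y(a\otimes b)=ya\otimes b+(-1)^{|y||a|}a\otimes yb$. Let $U=U(\mathfrak{osp}(1,2)[t]^\sigma)=\bigoplus_{s\ge0}U_s$ be graded by $t$-degree, and let $F_s=\sum_{r\le s}U_r(\mathsf v\otimes\dots\otimes \mathsf v)\subset V^\sigma(z_1)\otimes\dots\otimes V^\sigma(z_n)$. The graded tensor product $V^\sigma(z_1)*\dots*V^\sigma(z_n)$ is the associated graded module of $F_\bullet$; it is well defined when the tensor product of the evaluation modules is cyclic, generated by $\mathsf v\otimes\dots\otimes\mathsf v$.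
   Formalization: All z_i are assumed nonzero in addition; if some z_i = 0, the odd part acts by zero on V^σ(0), so v⊗…⊗v does not generate the tensor product (already for n = 1, z_1 = 0) and the claim fails. *)

theory Defs
  imports Complex_Main "HOL-Library.Poly_Mapping" "HOL-Algebra.Module" "HOL-Algebra.AbelCoset"
begin

section \<open>Free complex vector spaces\<close>

text \<open>
  The complex vector space with basis \<^typ>\<open>'b\<close> is \<^typ>\<open>'b \<Rightarrow>\<^sub>0 complex\<close>.
\<close>

abbreviation bas :: "'b \<Rightarrow> ('b \<Rightarrow>\<^sub>0 complex)" where
  "bas b \<equiv> Poly_Mapping.single b 1"

definition cscale :: "complex \<Rightarrow> ('b \<Rightarrow>\<^sub>0 complex) \<Rightarrow> ('b \<Rightarrow>\<^sub>0 complex)" where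
  "cscale c p = Poly_Mapping.map ((*) c) p"

lemma lookup_cscale [simp]: "Poly_Mapping.lookup (cscale c p) b = c * Poly_Mapping.lookup p b"
  by (simp add: cscale_def Poly_Mapping.map.rep_eq when_def)

lemma cscale_single [simp]: "cscale c (Poly_Mapping.single b d) = Poly_Mapping.single b (c * d)"
  by (simp add: cscale_def)

global_interpretation cvec: vector_space "cscale :: complex \<Rightarrow> ('b \<Rightarrow>\<^sub>0 complex) \<Rightarrow> _"
  by standard (simp_all add: poly_mapping_eq_iff fun_eq_iff lookup_add algebra_simps)

definition lin_ext :: "('a \<Rightarrow> ('b \<Rightarrow>\<^sub>0 complex)) \<Rightarrow> ('a \<Rightarrow>\<^sub>0 complex) \<Rightarrow> ('b \<Rightarrow>\<^sub>0 complex)" where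
  "lin_ext \<phi> p = (\<Sum>a\<in>Poly_Mapping.keys p. cscale (Poly_Mapping.lookup p a) (\<phi> a))"

definition bilin_ext ::
  "('a \<Rightarrow> 'b \<Rightarrow> ('c \<Rightarrow>\<^sub>0 complex)) \<Rightarrow> ('a \<Rightarrow>\<^sub>0 complex) \<Rightarrow> ('b \<Rightarrow>\<^sub>0 complex) \<Rightarrow> ('c \<Rightarrow>\<^sub>0 complex)" where
  "bilin_ext \<phi> p q = lin_ext (\<lambda>a. lin_ext (\<phi> a) q) p"

lemma lin_ext_superset:
  assumes "finite A" "Poly_Mapping.keys p \<subseteq> A"
  shows "lin_ext \<phi> p = (\<Sum>a\<in>A. cscale (Poly_Mapping.lookup p a) (\<phi> a))"
  unfolding lin_ext_def
  by (rule sum.mono_neutral_left) (use assms in \<open>auto simp: in_keys_iff\<close>)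

lemma lin_ext_zero [simp]: "lin_ext \<phi> 0 = 0"
  by (simp add: lin_ext_def)

lemma lin_ext_single [simp]: "lin_ext \<phi> (Poly_Mapping.single a c) = cscale c (\<phi> a)"
  by (cases "c = 0") (simp_all add: lin_ext_def)

lemma lin_ext_add: "lin_ext \<phi> (p + q) = lin_ext \<phi> p + lin_ext \<phi> q"
proof -
  let ?A = "Poly_Mapping.keys p \<union> Poly_Mapping.keys q"
  have "lin_ext \<phi> (p + q) = (\<Sum>a\<in>?A. cscale (Poly_Mapping.lookup (p + q) a) (\<phi> a))"
    by (rule lin_ext_superset) (simp_all add: keys_add)
  also have "\<dots> = (\<Sum>a\<in>?A. cscale (Poly_Mapping.lookup p a) (\<phi> a)) + (\<Sum>a\<in>?A. cscale (Poly_Mapping.lookup q a) (\<phi> a))"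
    by (simp add: lookup_add cvec.scale_left_distrib sum.distrib)
  also have "\<dots> = lin_ext \<phi> p + lin_ext \<phi> q"
    by (simp add: lin_ext_superset[of ?A p] lin_ext_superset[of ?A q])
  finally show ?thesis .
qed

lemma lin_ext_cscale: "lin_ext \<phi> (cscale c p) = cscale c (lin_ext \<phi> p)"
proof -
  have "lin_ext \<phi> (cscale c p)
      = (\<Sum>a\<in>Poly_Mapping.keys p. cscale (Poly_Mapping.lookup (cscale c p) a) (\<phi> a))"
    by (rule lin_ext_superset) (auto simp: in_keys_iff)
  then show ?thesis
    by (simp add: lin_ext_def cvec.scale_sum_right)
qed

lemma lin_ext_uminus: "lin_ext \<phi> (- p) = - lin_ext \<phi> p"
  using lin_ext_cscale[of \<phi> "-1" p] by simp


section \<open>The Lie superalgebra osp(1,2) and its twisted current algebra\<close>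

datatype osp_basis = osp_e | osp_h | osp_f | osp_gp | osp_gm

fun osp_odd :: "osp_basis \<Rightarrow> bool" where
  "osp_odd osp_gp = True"
| "osp_odd osp_gm = True"
| "osp_odd _ = False"

fun osp_bracket :: "osp_basis \<Rightarrow> osp_basis \<Rightarrow> (osp_basis \<Rightarrow>\<^sub>0 complex)" where
  "osp_bracket osp_e osp_f = bas osp_h"
| "osp_bracket osp_f osp_e = - bas osp_h"
| "osp_bracket osp_h osp_e = cscale 2 (bas osp_e)"
| "osp_bracket osp_e osp_h = - cscale 2 (bas osp_e)"
| "osp_bracket osp_h osp_f = - cscale 2 (bas osp_f)"
| "osp_bracket osp_f osp_h = cscale 2 (bas osp_f)"
| "osp_bracket osp_h osp_gp = bas osp_gp"
| "osp_bracket osp_gp osp_h = - bas osp_gp"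
| "osp_bracket osp_h osp_gm = - bas osp_gm"
| "osp_bracket osp_gm osp_h = bas osp_gm"
| "osp_bracket osp_gp osp_gm = bas osp_h"
| "osp_bracket osp_gm osp_gp = bas osp_h"
| "osp_bracket osp_gp osp_gp = cscale 2 (bas osp_e)"
| "osp_bracket osp_gm osp_gm = - cscale 2 (bas osp_f)"
| "osp_bracket osp_f osp_gp = - bas osp_gm"
| "osp_bracket osp_gp osp_f = bas osp_gm"
| "osp_bracket osp_e osp_gm = - bas osp_gp"
| "osp_bracket osp_gm osp_e = bas osp_gp"
| "osp_bracket _ _ = 0"

definition koszul :: "bool \<Rightarrow> bool \<Rightarrow> complex" where
  "koszul p q = (if p \<and> q then -1 else 1)"

lemma osp_bracket_antisym:
  "osp_bracket x y = - cscale (koszul (osp_odd x) (osp_odd y)) (osp_bracket y x)"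
  by (cases x; cases y) (simp_all add: koszul_def flip: single_uminus)

lemma osp_bracket_jacobi:
  "lin_ext (osp_bracket x) (osp_bracket y z)
     = lin_ext (\<lambda>u. osp_bracket u z) (osp_bracket x y)
     + cscale (koszul (osp_odd x) (osp_odd y)) (lin_ext (osp_bracket y) (osp_bracket x z))"
  by (cases x; cases y; cases z)
     (simp_all add: koszul_def lin_ext_uminus flip: single_add single_diff single_uminus)

text \<open>The basis vector \<open>(y, k)\<close> is \<open>y \<otimes> t\<^sup>k\<close>.\<close>

type_synonym current = "osp_basis \<times> nat \<Rightarrow>\<^sub>0 complex"

abbreviation cur :: "osp_basis \<Rightarrow> nat \<Rightarrow> current" where
  "cur y k \<equiv> bas (y, k)"

definition cur_bracket :: "current \<Rightarrow> current \<Rightarrow> current" where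
  "cur_bracket = bilin_ext (\<lambda>(x, i) (y, j). lin_ext (\<lambda>u. cur u (i + j)) (osp_bracket x y))"

definition twisted_basis :: "(osp_basis \<times> nat) set" where
  "twisted_basis = {(y, k). osp_odd y \<longleftrightarrow> odd k}"

definition twisted_current :: "current set" where
  "twisted_current = {x. Poly_Mapping.keys x \<subseteq> twisted_basis}"

definition twisted_part :: "bool \<Rightarrow> current set" where
  "twisted_part p = {x \<in> twisted_current. \<forall>(y, k)\<in>Poly_Mapping.keys x. osp_odd y = p}"

definition t_component :: "nat \<Rightarrow> current \<Rightarrow> current" where
  "t_component k x = lin_ext (\<lambda>(y, j). if j = k then cur y j else 0) x"


section \<open>Supermodules over the twisted current algebra\<close>

definition cplx :: "complex ring" where
  "cplx = \<lparr>carrier = UNIV, mult = (*), one = 1, zero = 0, add = (+)\<rparr>"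

text \<open>
  A record of type \<open>supermodule\<close> extends the library's module record, whose ring fields
  \<open>mult\<close> and \<open>one\<close> carry no information for a module. The argument of \<open>sm_part\<close> is \<open>False\<close> for
  the even and \<open>True\<close> for the odd part. Only the action of elements of
  \<^const>\<open>twisted_current\<close> is relevant.
\<close>

record 'v supermodule = "(complex, 'v) module" +
  sm_act :: "current \<Rightarrow> 'v \<Rightarrow> 'v"
  sm_part :: "bool \<Rightarrow> 'v set"

locale twisted_supermodule = Module.module cplx M for M :: "'v supermodule" (structure) +
  assumes part_submodule: "submodule (sm_part M p) cplx M"
    and part_unique: "v \<in> carrier M \<Longrightarrow>
      \<exists>!(a, b). a \<in> sm_part M False \<and> b \<in> sm_part M True \<and> v = a \<oplus> b"
    and act_closed: "\<lbrakk>x \<in> twisted_current; v \<in> carrier M\<rbrakk> \<Longrightarrow> sm_act M x v \<in> carrier M"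
    and act_add_left: "\<lbrakk>x \<in> twisted_current; y \<in> twisted_current; v \<in> carrier M\<rbrakk> \<Longrightarrow>
      sm_act M (x + y) v = sm_act M x v \<oplus> sm_act M y v"
    and act_scale_left: "\<lbrakk>x \<in> twisted_current; v \<in> carrier M\<rbrakk> \<Longrightarrow>
      sm_act M (cscale c x) v = c \<odot> sm_act M x v"
    and act_add_right: "\<lbrakk>x \<in> twisted_current; u \<in> carrier M; v \<in> carrier M\<rbrakk> \<Longrightarrow>
      sm_act M x (u \<oplus> v) = sm_act M x u \<oplus> sm_act M x v"
    and act_scale_right: "\<lbrakk>x \<in> twisted_current; v \<in> carrier M\<rbrakk> \<Longrightarrow>
      sm_act M x (c \<odot> v) = c \<odot> sm_act M x v"
    and act_part: "\<lbrakk>x \<in> twisted_part p; v \<in> sm_part M q\<rbrakk> \<Longrightarrow> sm_act M x v \<in> sm_part M (p \<noteq> q)"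
    and act_bracket: "\<lbrakk>x \<in> twisted_part p; y \<in> twisted_part q; v \<in> carrier M\<rbrakk> \<Longrightarrow>
      sm_act M (cur_bracket x y) v
        = sm_act M x (sm_act M y v) \<ominus> koszul p q \<odot> sm_act M y (sm_act M x v)"

definition supermodule_iso :: "'v supermodule \<Rightarrow> 'w supermodule \<Rightarrow> ('v \<Rightarrow> 'w) \<Rightarrow> bool" where
  "supermodule_iso M N \<theta> \<longleftrightarrow>
     bij_betw \<theta> (carrier M) (carrier N) \<and>
     (\<forall>u\<in>carrier M. \<forall>v\<in>carrier M. \<theta> (u \<oplus>\<^bsub>M\<^esub> v) = \<theta> u \<oplus>\<^bsub>N\<^esub> \<theta> v) \<and>
     (\<forall>c. \<forall>v\<in>carrier M. \<theta> (c \<odot>\<^bsub>M\<^esub> v) = c \<odot>\<^bsub>N\<^esub> \<theta> v) \<and>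
     (\<forall>x\<in>twisted_current. \<forall>v\<in>carrier M. \<theta> (sm_act M x v) = sm_act N x (\<theta> v)) \<and>
     (\<forall>p. \<theta> ` sm_part M p = sm_part N p)"

definition isomorphic_supermodules :: "'v supermodule \<Rightarrow> 'w supermodule \<Rightarrow> bool" where
  "isomorphic_supermodules M N \<longleftrightarrow>
     twisted_supermodule M \<and> twisted_supermodule N \<and> (\<exists>\<theta>. supermodule_iso M N \<theta>)"

definition stable_submodule :: "'v set \<Rightarrow> 'v supermodule \<Rightarrow> bool" where
  "stable_submodule J M \<longleftrightarrow>
     submodule J cplx M \<and> (\<forall>x\<in>twisted_current. \<forall>v\<in>J. sm_act M x v \<in> J)"

text \<open>
  The quotient \<open>M / J\<close> on cosets. The image of a coset under a linear map preserving \<open>J\<close> is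
  enlarged by \<open>J\<close>, so that it is again a coset of \<open>J\<close>.
\<close>

definition quot_module :: "'v supermodule \<Rightarrow> 'v set \<Rightarrow> 'v set supermodule" where
  "quot_module M J =
     \<lparr>carrier = a_rcosets\<^bsub>M\<^esub> J, mult = undefined, one = undefined,
      zero = J, add = set_add M,
      smult = (\<lambda>c A. J <+>\<^bsub>M\<^esub> (\<lambda>v. c \<odot>\<^bsub>M\<^esub> v) ` A),
      sm_act = (\<lambda>x A. J <+>\<^bsub>M\<^esub> sm_act M x ` A),
      sm_part = (\<lambda>p. (\<lambda>v. J +>\<^bsub>M\<^esub> v) ` sm_part M p)\<rparr>"


section \<open>The twisted Weyl module\<close>

definition sl2_integrable :: "'v supermodule \<Rightarrow> bool" where
  "sl2_integrable M \<longleftrightarrow>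
     (\<forall>v\<in>carrier M. \<forall>y\<in>{osp_e, osp_f}. \<exists>m. (sm_act M (cur y 0) ^^ m) v = \<zero>\<^bsub>M\<^esub>)"

definition weyl_relations :: "nat \<Rightarrow> 'v supermodule \<Rightarrow> 'v \<Rightarrow> bool" where
  "weyl_relations n M w \<longleftrightarrow>
     (\<forall>i. sm_act M (cur osp_f (2 * i)) w = \<zero>\<^bsub>M\<^esub>) \<and>
     (\<forall>i. sm_act M (cur osp_gm (2 * i + 1)) w = \<zero>\<^bsub>M\<^esub>) \<and>
     (\<forall>i. sm_act M (cur osp_h (2 * i + 2)) w = \<zero>\<^bsub>M\<^esub>) \<and>
     sm_act M (cur osp_h 0) w = (- of_nat n) \<odot>\<^bsub>M\<^esub> w \<and>
     (sm_act M (cur osp_e 0) ^^ (n + 1)) w = \<zero>\<^bsub>M\<^esub>"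

text \<open>
  The tensor algebra of the twisted current algebra as a left module over itself: the word
  \<open>[x\<^sub>1, \<dots>, x\<^sub>m]\<close> is \<open>x\<^sub>1 \<otimes> \<dots> \<otimes> x\<^sub>m\<close>. It satisfies the axioms of
  \<open>twisted_supermodule\<close> except for \<open>act_bracket\<close>.
\<close>

definition word_odd :: "(osp_basis \<times> nat) list \<Rightarrow> bool" where
  "word_odd u = odd (length (filter (osp_odd \<circ> fst) u))"

definition tensor_algebra :: "((osp_basis \<times> nat) list \<Rightarrow>\<^sub>0 complex) supermodule" where
  "tensor_algebra =
     \<lparr>carrier = {a. Poly_Mapping.keys a \<subseteq> lists twisted_basis}, mult = undefined, one = undefined,
      zero = 0, add = (+), smult = cscale,
      sm_act = bilin_ext (\<lambda>g u. bas (g # u)),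
      sm_part = (\<lambda>p. {a. Poly_Mapping.keys a \<subseteq> {u \<in> lists twisted_basis. word_odd u = p}})\<rparr>"

text \<open>
  Every cyclic module with an even generator \<open>w\<close> is \<open>T / J\<close> for a left ideal \<open>J\<close> of the tensor
  algebra \<open>T\<close>, with \<open>w\<close> the class of the empty word. The module with given defining relations
  is the one for the smallest admissible \<open>J\<close>. That \<open>T / J\<close> satisfies \<open>act_bracket\<close> says that
  \<open>J\<close> contains the kernel of the map from \<open>T\<close> to the universal enveloping algebra.
\<close>

definition weyl_kernel :: "nat \<Rightarrow> ((osp_basis \<times> nat) list \<Rightarrow>\<^sub>0 complex) set" where
  "weyl_kernel n = \<Inter>{J. stable_submodule J tensor_algebra \<and>
     twisted_supermodule (quot_module tensor_algebra J) \<and>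
     sl2_integrable (quot_module tensor_algebra J) \<and>
     weyl_relations n (quot_module tensor_algebra J) (J +>\<^bsub>tensor_algebra\<^esub> bas [])}"

definition twisted_weyl_module :: "nat \<Rightarrow> ((osp_basis \<times> nat) list \<Rightarrow>\<^sub>0 complex) set supermodule" where
  "twisted_weyl_module n = quot_module tensor_algebra (weyl_kernel n)"


section \<open>Tensor products of evaluation modules\<close>

text \<open>
  The module \<open>V\<close>: \<open>V_m\<close> is the lowest weight vector, \<open>V_0 = g\<^sup>+ V_m\<close> and \<open>V_p = e V_m\<close>,
  of weights -1, 0 and 1.
\<close>

datatype V_basis = V_m | V_0 | V_p

fun V_odd :: "V_basis \<Rightarrow> bool" where
  "V_odd V_0 = True"
| "V_odd _ = False"

fun V_act :: "osp_basis \<Rightarrow> V_basis \<Rightarrow> (V_basis \<Rightarrow>\<^sub>0 complex)" where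
  "V_act osp_h V_m = - bas V_m"
| "V_act osp_h V_p = bas V_p"
| "V_act osp_e V_m = bas V_p"
| "V_act osp_f V_p = bas V_m"
| "V_act osp_gp V_m = bas V_0"
| "V_act osp_gp V_0 = bas V_p"
| "V_act osp_gm V_0 = - bas V_m"
| "V_act osp_gm V_p = bas V_0"
| "V_act _ _ = 0"

lemma V_act_bracket:
  "lin_ext (\<lambda>u. V_act u b) (osp_bracket x y)
     = lin_ext (V_act x) (V_act y b)
     - cscale (koszul (osp_odd x) (osp_odd y)) (lin_ext (V_act y) (V_act x b))"
  by (cases x; cases y; cases b)
     (simp_all add: koszul_def lin_ext_uminus flip: single_add single_diff single_uminus)

lemma V_expand:
  "p = cscale (Poly_Mapping.lookup p V_m) (bas V_m) + cscale (Poly_Mapping.lookup p V_0) (bas V_0)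
     + cscale (Poly_Mapping.lookup p V_p) (bas V_p)"
proof (rule poly_mapping_eqI)
  fix b show "Poly_Mapping.lookup p b = Poly_Mapping.lookup (cscale (Poly_Mapping.lookup p V_m) (bas V_m)
      + cscale (Poly_Mapping.lookup p V_0) (bas V_0) + cscale (Poly_Mapping.lookup p V_p) (bas V_p)) b"
    by (cases b) (simp_all add: lookup_add lookup_single)
qed

lemma V_irreducible:
  assumes S: "cvec.subspace S" and inv: "\<And>y p. p \<in> S \<Longrightarrow> lin_ext (V_act y) p \<in> S"
    and nz: "p \<in> S" "p \<noteq> 0"
  shows "S = UNIV"
proof -
  have act: "lin_ext (V_act y) q = cscale (Poly_Mapping.lookup q V_m) (V_act y V_m)
      + cscale (Poly_Mapping.lookup q V_0) (V_act y V_0) + cscale (Poly_Mapping.lookup q V_p) (V_act y V_p)" for y q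
    by (subst V_expand[of q]) (simp add: lin_ext_add lin_ext_cscale del: cvec.scale_left_imp_eq)
  have unscale: "q \<in> S" if "cscale c q \<in> S" "c \<noteq> 0" for c q
    using cvec.subspace_scale[OF S that(1), of "inverse c"] that(2) by simp
  have m: "bas V_m \<in> S"
  proof (cases "Poly_Mapping.lookup p V_p = 0")
    case False
    then show ?thesis using inv[OF nz(1), of osp_f] by (auto simp: act intro: unscale)
  next
    case p: True
    show ?thesis
    proof (cases "Poly_Mapping.lookup p V_0 = 0")
      case False
      then have "cscale (- Poly_Mapping.lookup p V_0) (bas V_m) \<in> S"
        using inv[OF nz(1), of osp_gm] p by (simp add: act single_uminus)
      then show ?thesis using False by (auto intro: unscale)
    next
      case 0: True
      have "p = cscale (Poly_Mapping.lookup p V_m) (bas V_m)" using V_expand[of p] p 0 by simp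
      then show ?thesis using nz by (metis unscale cvec.scale_zero_left)
    qed
  qed
  have 0: "bas V_0 \<in> S" using inv[OF m, of osp_gp] by simp
  have p: "bas V_p \<in> S" using inv[OF m, of osp_e] by simp
  show ?thesis
  proof (intro equalityI subsetI UNIV_I)
    fix q show "q \<in> S"
      by (subst V_expand) (intro cvec.subspace_add[OF S] cvec.subspace_scale[OF S] m 0 p)
  qed
qed

text \<open>
  The basis of the \<open>n\<close>-fold tensor product consists of the words of length \<open>n\<close> in \<open>V_basis\<close>.
\<close>

fun eval_tensor_act ::
  "complex list \<Rightarrow> osp_basis \<times> nat \<Rightarrow> V_basis list \<Rightarrow> (V_basis list \<Rightarrow>\<^sub>0 complex)" where
  "eval_tensor_act (z # zs) (y, k) (b # bs) =
     lin_ext (\<lambda>c. bas (c # bs)) (cscale (z ^ k) (V_act y b)) +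
     cscale (koszul (osp_odd y) (V_odd b)) (lin_ext (\<lambda>cs. bas (b # cs)) (eval_tensor_act zs (y, k) bs))"
| "eval_tensor_act _ _ _ = 0"

definition eval_tensor :: "complex list \<Rightarrow> (V_basis list \<Rightarrow>\<^sub>0 complex) supermodule" where
  "eval_tensor zs =
     \<lparr>carrier = {p. Poly_Mapping.keys p \<subseteq> {bs. length bs = length zs}},
      mult = undefined, one = undefined, zero = 0, add = (+), smult = cscale,
      sm_act = bilin_ext (eval_tensor_act zs),
      sm_part = (\<lambda>q. {p. Poly_Mapping.keys p \<subseteq>
        {bs. length bs = length zs \<and> odd (length (filter V_odd bs)) = q}})\<rparr>"

definition lowest_tensor :: "nat \<Rightarrow> (V_basis list \<Rightarrow>\<^sub>0 complex)" where
  "lowest_tensor n = bas (replicate n V_m)"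


section \<open>Graded tensor products\<close>

definition word_act :: "'v supermodule \<Rightarrow> (osp_basis \<times> nat) list \<Rightarrow> 'v \<Rightarrow> 'v" where
  "word_act M u v = foldr (\<lambda>(y, k). sm_act M (cur y k)) u v"

text \<open>
  \<open>U_act M v r\<close> is \<open>U\<^sub>r v\<close>: the degree \<open>r\<close> part of the enveloping algebra is spanned by the
  products of basis vectors of total \<open>t\<close>-degree \<open>r\<close>.
\<close>

definition U_act ::
  "('b \<Rightarrow>\<^sub>0 complex) supermodule \<Rightarrow> ('b \<Rightarrow>\<^sub>0 complex) \<Rightarrow> nat \<Rightarrow> ('b \<Rightarrow>\<^sub>0 complex) set" where
  "U_act M v r = cvec.span {word_act M u v | u. u \<in> lists twisted_basis \<and> sum_list (map snd u) = r}"

definition cyclic_generator :: "('b \<Rightarrow>\<^sub>0 complex) supermodule \<Rightarrow> ('b \<Rightarrow>\<^sub>0 complex) \<Rightarrow> bool" where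
  "cyclic_generator M v \<longleftrightarrow> v \<in> carrier M \<and> cvec.span (\<Union>r. U_act M v r) = carrier M"

definition filt ::
  "('b \<Rightarrow>\<^sub>0 complex) supermodule \<Rightarrow> ('b \<Rightarrow>\<^sub>0 complex) \<Rightarrow> nat \<Rightarrow> ('b \<Rightarrow>\<^sub>0 complex) set" where
  "filt M v s = cvec.span (\<Union>r\<le>s. U_act M v r)"

definition filt_below ::
  "('b \<Rightarrow>\<^sub>0 complex) supermodule \<Rightarrow> ('b \<Rightarrow>\<^sub>0 complex) \<Rightarrow> nat \<Rightarrow> ('b \<Rightarrow>\<^sub>0 complex) set" where
  "filt_below M v s = (case s of 0 \<Rightarrow> {0} | Suc r \<Rightarrow> filt M v r)"

text \<open>
  The piece \<open>F\<^sub>s / F\<^sub>s\<^sub>-\<^sub>1\<close>; it is only used as a super vector space, as \<open>F\<^sub>s\<close> is not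
  stable under the action.
\<close>

definition gr_piece ::
  "('b \<Rightarrow>\<^sub>0 complex) supermodule \<Rightarrow> ('b \<Rightarrow>\<^sub>0 complex) \<Rightarrow> nat \<Rightarrow> ('b \<Rightarrow>\<^sub>0 complex) set supermodule" where
  "gr_piece M v s = quot_module
     (M\<lparr>carrier := filt M v s, sm_part := (\<lambda>p. sm_part M p \<inter> filt M v s)\<rparr>) (filt_below M v s)"

text \<open>
  The associated graded module: the direct sum of the pieces, where \<open>x = \<Sum>\<^sub>k x\<^sub>k\<close>
  with \<open>x\<^sub>k\<close> of \<open>t\<close>-degree \<open>k\<close> acts through the maps from \<open>F\<^sub>j / F\<^sub>j\<^sub>-\<^sub>1\<close> to
  \<open>F\<^sub>j\<^sub>+\<^sub>k / F\<^sub>j\<^sub>+\<^sub>k\<^sub>-\<^sub>1\<close> induced by \<open>x\<^sub>k\<close>.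
\<close>

definition assoc_graded ::
  "('b \<Rightarrow>\<^sub>0 complex) supermodule \<Rightarrow> ('b \<Rightarrow>\<^sub>0 complex) \<Rightarrow> (nat \<Rightarrow> ('b \<Rightarrow>\<^sub>0 complex) set) supermodule" where
  "assoc_graded M v =
     \<lparr>carrier = {\<phi>. (\<forall>s. \<phi> s \<in> carrier (gr_piece M v s)) \<and> finite {s. \<phi> s \<noteq> \<zero>\<^bsub>gr_piece M v s\<^esub>}},
      mult = undefined, one = undefined,
      zero = (\<lambda>s. \<zero>\<^bsub>gr_piece M v s\<^esub>),
      add = (\<lambda>\<phi> \<psi> s. \<phi> s \<oplus>\<^bsub>gr_piece M v s\<^esub> \<psi> s),
      smult = (\<lambda>c \<phi> s. c \<odot>\<^bsub>gr_piece M v s\<^esub> \<phi> s),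
      sm_act = (\<lambda>x \<phi> m. {(\<Sum>j\<le>m. sm_act M (t_component (m - j) x) (a j)) + b | a b.
        (\<forall>j\<le>m. a j \<in> \<phi> j) \<and> b \<in> filt_below M v m}),
      sm_part = (\<lambda>p. {\<phi>. (\<forall>s. \<phi> s \<in> sm_part (gr_piece M v s) p) \<and>
        finite {s. \<phi> s \<noteq> \<zero>\<^bsub>gr_piece M v s\<^esub>}})\<rparr>"

definition graded_tensor :: "complex list \<Rightarrow> (nat \<Rightarrow> (V_basis list \<Rightarrow>\<^sub>0 complex) set) supermodule" where
  "graded_tensor zs = assoc_graded (eval_tensor zs) (lowest_tensor (length zs))"

text \<open>
  The lowest weight vector does not generate \<open>V\<^sup>\<sigma>(0)\<close>, on which all elements of positive
  \<open>t\<close>-degree act by zero. Conditions on the squares of the evaluation points must therefore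
  be supplemented by the requirement that no evaluation point is zero.
\<close>

lemma not_cyclic_eval_zero: "\<not> cyclic_generator (eval_tensor [0]) (lowest_tensor 1)"
proof
  let ?M = "eval_tensor [0]" and ?v = "lowest_tensor 1"
  let ?S = "{p :: V_basis list \<Rightarrow>\<^sub>0 complex. Poly_Mapping.lookup p [V_0] = 0}"
  assume cyc: "cyclic_generator ?M ?v"
  have S: "cvec.subspace ?S"
    by (rule cvec.subspaceI) (simp_all add: lookup_add)
  have basis: "Poly_Mapping.lookup (eval_tensor_act [0] (y, k) bs) [V_0] = 0"
    if "(y, k) \<in> twisted_basis" "bs \<noteq> [V_0]" for y k bs
    using that
    by (cases bs; cases k; cases y; cases "hd bs")
       (auto simp: twisted_basis_def lin_ext_uminus lookup_single when_def)
  have act: "sm_act ?M (cur y k) p \<in> ?S" if "(y, k) \<in> twisted_basis" "p \<in> ?S" for y k p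
  proof -
    have "sm_act ?M (cur y k) p = lin_ext (eval_tensor_act [0] (y, k)) p"
      by (simp add: eval_tensor_def bilin_ext_def)
    moreover have "Poly_Mapping.lookup (lin_ext (eval_tensor_act [0] (y, k)) p) [V_0] = 0"
      unfolding lin_ext_def lookup_sum lookup_cscale
    proof (rule sum.neutral, rule ballI)
      fix bs assume "bs \<in> Poly_Mapping.keys p"
      then have "bs \<noteq> [V_0]" using that(2) by (auto simp: in_keys_iff)
      then show "Poly_Mapping.lookup p bs
          * Poly_Mapping.lookup (eval_tensor_act [0] (y, k) bs) [V_0] = 0"
        using basis[OF that(1)] by simp
    qed
    ultimately show ?thesis by simp
  qed
  have word: "word_act ?M u ?v \<in> ?S" if "u \<in> lists twisted_basis" for u
    using that
  proof (induction u)
    case Nil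
    show ?case by (simp add: word_act_def lowest_tensor_def lookup_single when_def)
  next
    case (Cons g u)
    obtain y k where g: "g = (y, k)" by (cases g)
    have "word_act ?M (g # u) ?v = sm_act ?M (cur y k) (word_act ?M u ?v)"
      by (simp add: word_act_def g)
    then show ?case using act Cons g by metis
  qed
  have U: "U_act ?M ?v r \<subseteq> ?S" for r
    unfolding U_act_def by (rule cvec.span_minimal[OF _ S]) (use word in blast)
  have "cvec.span (\<Union>r. U_act ?M ?v r) \<subseteq> ?S"
    by (rule cvec.span_minimal[OF _ S]) (use U in blast)
  moreover have "bas [V_0] \<in> carrier ?M"
    by (simp add: eval_tensor_def)
  ultimately have "bas [V_0] \<in> ?S"
    using cyc unfolding cyclic_generator_def by blast
  then show False by simp
qed

end

theory Submission
  imports Defs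
begin

text \<open>
  In the associated graded module the lowest weight vector satisfies the relations of the Weyl
  module, and the dimension is \<open>3\<^sup>n\<close>, because a Vandermonde argument gives the action of
  \<open>osp(1,2)\<close> on each single tensor factor. So it remains to bound the dimension of the Weyl module
  by \<open>3\<^sup>n\<close>. It is spanned by the vectors \<open>e\<^sub>J g\<^sub>I w\<close>, where \<open>e\<^sub>J\<close> is a product of elements
  \<open>e \<otimes> t\<^sup>2\<^sup>j\<close> and \<open>g\<^sub>I\<close> is the product of \<open>g\<^sup>+ \<otimes> t\<^sup>2\<^sup>i\<^sup>+\<^sup>1\<close> over a subset \<open>I\<close> of
  \<open>{0, \<dots>, n - 1}\<close>. If the subsets are taken in a suitable order, each \<open>g\<^sub>I w\<close> generates,
  modulo the previous ones, a quotient of the local Weyl module of \<open>sl\<^sub>2[t\<^sup>2]\<close> of lowest weight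
  \<open>card I - n\<close>, and \<open>\<Sum>\<^sub>I 2\<^bsup>n - card I\<^esup> = 3\<^sup>n\<close>.

  For the bound \<open>2\<^sup>m\<close> on the local Weyl module of \<open>sl\<^sub>2[t]\<close>, the part spanned by products of \<open>r\<close>
  elements \<open>e \<otimes> t\<^sup>j\<close> is a cyclic module over the symmetric polynomials in \<open>r\<close> variables, where
  power sums act through \<open>h \<otimes> t\<^sup>k\<close>. By the Garland relations it is annihilated by the complete
  symmetric polynomials of degree above \<open>m - r\<close>, so its dimension is at most \<open>m choose r\<close>.
\<close>

section \<open>Linear maps and symmetric functions of commuting operators\<close>

text \<open>Both modules are presented as quotients of the tensors \<open>TC\<close> on twisted
  words, so the isomorphism becomes an equality of two kernels. One inclusion only asks that the
  graded kernel be admissible. Here the relation for h at \<open>t^(2i+2)\<close> generally fails in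
  the tensor product itself, where h multiplies the lowest tensor by minus a power sum of the
  points; it holds after grading because a scalar does not raise the degree. The other inclusion is
  the dimension count. The Weyl kernel is an intersection of ideals, and integrability does not
  obviously survive intersection, as its exponents depend on the ideal. The bound therefore rests on
  conditions that do survive: stability, bracket relations and defining relations. Nonzero points
  enter through the odd part: odd elements carry odd exponents, so the Vandermonde system in the
  squares of the points yields \<open>z_j\<close> times the action on factor \<open>j\<close>, and
  \<open>z_j\<close> has to be divided out. Among subsets of equal size, larger sums come first
  because h at positive degree raises one index of the product of the g's.\<close>

abbreviation clin :: "(('a \<Rightarrow>\<^sub>0 complex) \<Rightarrow> ('b \<Rightarrow>\<^sub>0 complex)) \<Rightarrow> bool" where
  "clin \<equiv> Vector_Spaces.linear cscale cscale"

lemma clinI: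
  assumes "\<And>p q. f (p + q) = f p + f q" "\<And>c p. f (cscale c p) = cscale c (f p)"
  shows "clin f"
  by unfold_locales (use assms in auto)

lemma clin_hom: "clin f \<Longrightarrow> module_hom cscale cscale f"
  by (simp add: linear_iff_module_hom)

lemmas clin_add = module_hom.add[OF clin_hom]
  and clin_scale = module_hom.scale[OF clin_hom]
  and clin_zero = module_hom.zero[OF clin_hom]
  and clin_neg = module_hom.neg[OF clin_hom]
  and clin_diff = module_hom.diff[OF clin_hom]
  and clin_sum = module_hom.sum[OF clin_hom]

lemma clin_lin_ext: "clin (lin_ext \<phi>)"
  by (rule clinI) (simp_all add: lin_ext_add lin_ext_cscale)

lemma clin_cscale: "clin (cscale c)"
  by (rule clinI) (simp_all add: cvec.scale_right_distrib mult.commute)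

lemma clin_compose: "clin f \<Longrightarrow> clin g \<Longrightarrow> clin (\<lambda>v. f (g v))"
  by (rule clinI) (simp_all add: clin_add clin_scale)

lemma clin_sumI: "(\<And>i. i \<in> A \<Longrightarrow> clin (f i)) \<Longrightarrow> clin (\<lambda>v. \<Sum>i\<in>A. f i v)"
  by (rule clinI)
    (simp_all add: clin_add clin_scale sum.distrib cvec.scale_sum_right cong: sum.cong)

lemma clin_span_image:
  assumes "clin f" "v \<in> cvec.span S" "\<And>s. s \<in> S \<Longrightarrow> f s \<in> Y" "cvec.subspace Y"
  shows "f v \<in> Y"
  using assms(2)
proof (induction rule: cvec.span_induct_alt)
  case base
  then show ?case by (simp add: clin_zero[OF assms(1)] cvec.subspace_0 assms)
next
  case (step c x y)
  then show ?case
    by (simp add: clin_add[OF assms(1)] clin_scale[OF assms(1)] cvec.subspace_add cvec.subspace_scale assms)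
qed

lemma subspace_unscale:
  assumes "cvec.subspace Y" "cscale c v \<in> Y" "c \<noteq> 0"
  shows "v \<in> Y"
  using cvec.subspace_scale[OF assms(1,2), of "inverse c"] assms(3) by simp

text \<open>The coefficient of x^s when the operator series with coefficients \<open>a i\<close> is
  applied to the vector series with coefficients \<open>\<phi> j\<close>.\<close>

definition conv :: "(nat \<Rightarrow> 'v \<Rightarrow> 'v) \<Rightarrow> (nat \<Rightarrow> 'v) \<Rightarrow> nat \<Rightarrow> 'v::ab_group_add" where
  "conv a \<phi> s = (\<Sum>i\<le>s. a i (\<phi> (s - i)))"

lemma sum_triangle_swap:
  fixes G :: "nat \<Rightarrow> nat \<Rightarrow> 'v::comm_monoid_add"
  shows "(\<Sum>i\<le>s. \<Sum>j\<le>s - i. G i j) = (\<Sum>j\<le>s. \<Sum>i\<le>s - j. G i j)"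
proof -
  have "(\<Sum>i\<le>s. \<Sum>j\<le>s - i. G i j) = (\<Sum>(i, j)\<in>Sigma {..s} (\<lambda>i. {..s - i}). G i j)"
    by (simp add: sum.Sigma)
  also have "\<dots> = (\<Sum>(j, i)\<in>Sigma {..s} (\<lambda>j. {..s - j}). G i j)"
    by (rule sum.reindex_bij_witness[where i = "\<lambda>(a, b). (b, a)" and j = "\<lambda>(a, b). (b, a)"]) auto
  finally show ?thesis by (simp add: sum.Sigma)
qed

lemma sum_triangle_diagonal:
  fixes G :: "nat \<Rightarrow> nat \<Rightarrow> 'v::comm_monoid_add"
  shows "(\<Sum>i\<le>s. \<Sum>j\<le>s - i. G i j) = (\<Sum>k\<le>s. \<Sum>i\<le>k. G i (k - i))"
proof -
  have "(\<Sum>i\<le>s. \<Sum>j\<le>s - i. G i j) = (\<Sum>(i, j)\<in>Sigma {..s} (\<lambda>i. {..s - i}). G i j)"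
    by (simp add: sum.Sigma)
  also have "\<dots> = (\<Sum>(k, i)\<in>Sigma {..s} (\<lambda>k. {..k}). G i (k - i))"
    by (rule sum.reindex_bij_witness[where i = "\<lambda>(k, i). (i, k - i)" and j = "\<lambda>(i, j). (i + j, i)"]) auto
  finally show ?thesis by (simp add: sum.Sigma)
qed

lemma conv_commute:
  fixes \<phi> :: "nat \<Rightarrow> ('b \<Rightarrow>\<^sub>0 complex)"
  assumes "\<And>i. clin (a i)" "\<And>i. clin (b i)" "\<And>i j v. a i (b j v) = b j (a i v)"
  shows "conv a (conv b \<phi>) = conv b (conv a \<phi>)"
proof (rule ext)
  fix s
  have "conv a (conv b \<phi>) s = (\<Sum>i\<le>s. \<Sum>j\<le>s - i. b j (a i (\<phi> (s - i - j))))"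
    by (simp add: conv_def clin_sum[OF assms(1)] assms(3))
  also have "\<dots> = (\<Sum>j\<le>s. \<Sum>i\<le>s - j. b j (a i (\<phi> (s - i - j))))"
    by (rule sum_triangle_swap)
  also have "\<dots> = conv b (conv a \<phi>) s"
    by (simp add: conv_def clin_sum[OF assms(2)] add.commute)
  finally show "conv a (conv b \<phi>) s = conv b (conv a \<phi>) s" .
qed

locale commuting_ops =
  fixes P :: "nat \<Rightarrow> ('b \<Rightarrow>\<^sub>0 complex) \<Rightarrow> ('b \<Rightarrow>\<^sub>0 complex)"
  assumes clin_P: "clin (P a)" and P_commute: "P a (P b v) = P b (P a v)"
begin

text \<open>
  If \<open>P a\<close> is multiplication by the power sum of degree \<open>a + 1\<close>, then \<open>E j\<close> and \<open>H s\<close> are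
  the elementary and the complete symmetric polynomials: Newton's identities and
  \<open>\<Sum>\<^sub>i (-1)\<^sup>i E\<^sub>i H\<^sub>s\<^sub>-\<^sub>i = 0\<close>.
\<close>

fun E :: "nat \<Rightarrow> ('b \<Rightarrow>\<^sub>0 complex) \<Rightarrow> ('b \<Rightarrow>\<^sub>0 complex)" where
  "E 0 v = v"
| "E (Suc j) v = cscale (1 / of_nat (Suc j)) (\<Sum>a\<le>j. cscale ((-1) ^ a) (P a (E (j - a) v)))"

fun H :: "nat \<Rightarrow> ('b \<Rightarrow>\<^sub>0 complex) \<Rightarrow> ('b \<Rightarrow>\<^sub>0 complex)" where
  "H 0 v = v"
| "H (Suc s) v = (\<Sum>i\<le>s. cscale ((-1) ^ i) (E (Suc i) (H (s - i) v)))"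

declare E.simps(2) [simp del] H.simps(2) [simp del]

lemma clin_E: "clin (E j)"
proof (induction j rule: less_induct)
  case (less j)
  show ?case
  proof (cases j)
    case 0
    then show ?thesis by (auto intro: clinI)
  next
    case (Suc k)
    have "clin (E (Suc k))"
      unfolding E.simps(2)[abs_def]
      by (intro clin_compose[OF clin_cscale] clin_sumI clin_compose[OF clin_P] less) (auto simp: Suc)
    then show ?thesis by (simp add: Suc)
  qed
qed

lemma clin_H: "clin (H j)"
proof (induction j rule: less_induct)
  case (less j)
  show ?case
  proof (cases j)
    case 0
    then show ?thesis by (auto intro: clinI)
  next
    case (Suc k)
    have "clin (H (Suc k))"
      unfolding H.simps(2)[abs_def]
      by (intro clin_compose[OF clin_cscale] clin_sumI clin_compose[OF clin_E] less) (auto simp: Suc)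
    then show ?thesis by (simp add: Suc)
  qed
qed

lemma E_commute:
  assumes T: "clin T" and "\<And>a v. T (P a v) = P a (T v)"
  shows "T (E j v) = E j (T v)"
proof (induction j rule: less_induct)
  case (less j)
  then show ?case
    by (cases j) (simp_all add: E.simps(2) clin_scale[OF T] clin_sum[OF T] assms)
qed

lemma H_commute:
  assumes T: "clin T" and "\<And>a v. T (P a v) = P a (T v)"
  shows "T (H j v) = H j (T v)"
proof (induction j rule: less_induct)
  case (less j)
  then show ?case
    by (cases j) (simp_all add: H.simps(2) clin_scale[OF T] clin_sum[OF T] E_commute[OF assms])
qed

lemma P_H: "P a (H j v) = H j (P a v)"
  by (rule H_commute) (simp_all add: clin_P P_commute)

lemma H_E: "H i (E j v) = E j (H i v)"
  by (rule E_commute) (simp_all add: clin_H P_H)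

lemma H_H: "H i (H j v) = H j (H i v)"
  by (rule H_commute) (simp_all add: clin_H P_H)

lemma E_H_sum:
  assumes "s > 0"
  shows "(\<Sum>i\<le>s. cscale ((-1) ^ i) (E i (H (s - i) v))) = 0"
proof -
  obtain r where s: "s = Suc r" using assms by (cases s) auto
  have "(\<Sum>i\<le>s. cscale ((-1) ^ i) (E i (H (s - i) v)))
    = H s v + (\<Sum>i\<le>r. cscale ((-1) ^ Suc i) (E (Suc i) (H (r - i) v)))"
    unfolding s by (subst sum.atMost_Suc_shift) simp
  also have "\<dots> = 0"
    unfolding s H.simps(2) by (simp add: sum_negf)
  finally show ?thesis .
qed

section \<open>Cyclic modules over the algebra generated by the power sums\<close>

definition orbit :: "('b \<Rightarrow>\<^sub>0 complex) \<Rightarrow> ('b \<Rightarrow>\<^sub>0 complex) set" where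
  "orbit u = range (\<lambda>cs. foldr P cs u)"

definition stable :: "('b \<Rightarrow>\<^sub>0 complex) set \<Rightarrow> bool" where
  "stable Y \<longleftrightarrow> cvec.subspace Y \<and> (\<forall>a. P a ` Y \<subseteq> Y)"

lemma stableD: "stable Y \<Longrightarrow> cvec.subspace Y" "stable Y \<Longrightarrow> v \<in> Y \<Longrightarrow> P a v \<in> Y"
  by (auto simp: stable_def)

lemma orbit_base: "u \<in> orbit u"
  unfolding orbit_def by (rule range_eqI[of _ _ "[]"]) simp

lemma orbit_P: "x \<in> orbit u \<Longrightarrow> P a x \<in> orbit u"
  unfolding orbit_def by (auto intro: range_eqI[of _ _ "a # _"])

lemma orbit_subset:
  assumes "u \<in> Z" "\<And>a v. v \<in> Z \<Longrightarrow> P a v \<in> Z"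
  shows "orbit u \<subseteq> Z"
proof -
  have "foldr P cs u \<in> Z" for cs by (induction cs) (simp_all add: assms)
  then show ?thesis by (auto simp: orbit_def)
qed

lemma stable_span: 
  assumes "\<And>a v. v \<in> S \<Longrightarrow> P a v \<in> cvec.span S"
  shows "stable (cvec.span S)"
  unfolding stable_def
  by (auto intro: clin_span_image[OF clin_P _ assms])

lemma stable_E: "stable Y \<Longrightarrow> v \<in> Y \<Longrightarrow> E j v \<in> Y"
proof (induction j rule: less_induct)
  case (less j)
  note Y = stableD[OF less.prems(1)]
  show ?case
  proof (cases j)
    case (Suc k)
    show ?thesis
      unfolding Suc E.simps(2)
      by (intro cvec.subspace_scale cvec.subspace_sum Y less) (auto simp: Suc)
  qed (use less in simp)
qed

lemma stable_H: "stable Y \<Longrightarrow> v \<in> Y \<Longrightarrow> H j v \<in> Y"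
proof (induction j rule: less_induct)
  case (less j)
  note Y = stableD[OF less.prems(1)]
  show ?case
  proof (cases j)
    case (Suc k)
    show ?thesis
      unfolding Suc H.simps(2)
      by (intro cvec.subspace_scale cvec.subspace_sum Y stable_E less) (auto simp: Suc)
  qed (use less in simp)
qed

text \<open>Newton's identity for \<open>E (Suc a)\<close> contains \<open>P a u\<close> as its one
  term with \<open>E 0\<close>. Every other term applies some \<open>P b\<close> to an
  \<open>E\<close> of positive index and stays in the stable subspace.\<close>

lemma P_mem_if_E_mem:
  assumes Y: "stable Y" and E: "\<And>j. j > 0 \<Longrightarrow> E j u \<in> Y"
  shows "P a u \<in> Y"
proof -
  note sub = stableD(1)[OF Y]
  have "cscale (of_nat (Suc a)) (E (Suc a) u) = (\<Sum>b\<le>a. cscale ((-1) ^ b) (P b (E (a - b) u)))"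
    by (simp add: E.simps(2) del: of_nat_Suc)
  also have "\<dots> = (\<Sum>b<a. cscale ((-1) ^ b) (P b (E (a - b) u))) + cscale ((-1) ^ a) (P a u)"
    by (simp flip: lessThan_Suc_atMost)
  finally have "cscale ((-1) ^ a) (P a u)
    = cscale (of_nat (Suc a)) (E (Suc a) u) - (\<Sum>b<a. cscale ((-1) ^ b) (P b (E (a - b) u)))"
    by simp
  also have "\<dots> \<in> Y"
    by (intro cvec.subspace_diff[OF sub] cvec.subspace_scale[OF sub] cvec.subspace_sum[OF sub]
      stableD(2)[OF Y] E) auto
  finally show ?thesis by (rule subspace_unscale[OF sub]) simp
qed

text \<open>In the relation \<open>E_H_sum\<close> of degree \<open>j\<close>, the term
  \<open>E j u\<close> is the only one with \<open>H 0\<close>.\<close>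

lemma E_mem_if_H_mem:
  assumes Y: "stable Y" and H: "\<And>s. s > 0 \<Longrightarrow> H s u \<in> Y"
  shows "j > 0 \<Longrightarrow> E j u \<in> Y"
proof -
  note sub = stableD(1)[OF Y]
  assume "j > 0"
  then have "(\<Sum>i<j. cscale ((-1) ^ i) (E i (H (j - i) u))) + cscale ((-1) ^ j) (E j u) = 0"
    using E_H_sum[of j u] by (simp flip: lessThan_Suc_atMost)
  then have "cscale ((-1) ^ j) (E j u) = - (\<Sum>i<j. cscale ((-1) ^ i) (E i (H (j - i) u)))"
    by (simp add: eq_neg_iff_add_eq_0 add.commute)
  also have "\<dots> \<in> Y"
    by (intro cvec.subspace_neg[OF sub] cvec.subspace_scale[OF sub] cvec.subspace_sum[OF sub]
      stable_E[OF Y] H) auto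
  finally show ?thesis by (rule subspace_unscale[OF sub]) simp
qed

text \<open>
  The orbit of \<open>u\<close> is a quotient of the ring of symmetric polynomials in \<open>r\<close> variables modulo the
  complete ones of degree above \<open>N\<close>. The ideal generated by \<open>H\<^sub>N\<close> is annihilated by \<open>E\<^sub>r\<close>, hence is
  covered by the case of \<open>r - 1\<close> variables.
\<close>

lemma orbit_dim_bound:
  assumes "stable Y" "\<And>j. j > r \<Longrightarrow> E j u \<in> Y" "\<And>s. s > N \<Longrightarrow> H s u \<in> Y"
  shows "\<exists>B. finite B \<and> card B \<le> (N + r) choose r \<and> orbit u \<subseteq> cvec.span (B \<union> Y)"
  using assms
proof (induction "N + r" arbitrary: N r u Y rule: less_induct)
  case less
  note Y = less.prems(1) and sub = stableD(1)[OF less.prems(1)]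
  show ?case
  proof (cases "N = 0 \<or> r = 0")
    case True
    \<comment> \<open>The binomial coefficient is 1 here: every \<open>P a u\<close> lies in
      \<open>Y\<close>, so \<open>u\<close> alone spans the orbit modulo \<open>Y\<close>.\<close>
    then have "P a u \<in> Y" for a
      using P_mem_if_E_mem[OF Y] E_mem_if_H_mem[OF Y] less.prems by auto
    then have "orbit u \<subseteq> insert u Y"
      using stableD(2)[OF Y] by (intro orbit_subset) auto
    then show ?thesis
      using cvec.span_superset[of "{u} \<union> Y"] True by (intro exI[of _ "{u}"]) auto
  next
    case False
    then obtain M q where N: "N = Suc M" and r: "r = Suc q" by (metis not0_implies_Suc)
    let ?v = "H N u"
    let ?Y = "cvec.span (orbit ?v \<union> Y)"
    \<comment> \<open>In the relation \<open>E_H_sum\<close> of degree \<open>N + r\<close>, an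
      index below \<open>r\<close> leaves an \<open>H\<close> of degree above \<open>N\<close>, and
      an index above \<open>r\<close> gives an \<open>E\<close> of degree above \<open>r\<close>.
      All terms except the one at \<open>r\<close> are thus in \<open>Y\<close>.\<close>
    have Er: "E r ?v \<in> Y"
    proof -
      let ?t = "\<lambda>i. cscale ((-1) ^ i) (E i (H (N + r - i) u))"
      have "(\<Sum>i\<le>N + r. ?t i) = ?t r + (\<Sum>i\<in>{..N + r} - {r}. ?t i)"
        by (rule sum.remove) auto
      then have "?t r = - (\<Sum>i\<in>{..N + r} - {r}. ?t i)"
        using E_H_sum[of "N + r" u] r by (simp add: eq_neg_iff_add_eq_0)
      also have "\<dots> \<in> Y"
      proof (intro cvec.subspace_neg[OF sub] cvec.subspace_sum[OF sub] cvec.subspace_scale[OF sub])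
        fix i assume "i \<in> {..N + r} - {r}"
        then consider "i < r" | "i > r" by force
        then show "E i (H (N + r - i) u) \<in> Y"
        proof cases
          case 1
          then show ?thesis using less.prems(3) by (intro stable_E[OF Y]) auto
        next
          case 2
          then show ?thesis
            using less.prems(2) by (auto simp flip: H_E intro: stable_H[OF Y])
        qed
      qed
      finally show ?thesis using subspace_unscale[OF sub, of "(-1) ^ r"] by simp
    qed
    \<comment> \<open>The submodule generated by \<open>H N u\<close> has the same bound on
      \<open>H\<close> and one variable fewer.\<close>
    have "\<exists>B. finite B \<and> card B \<le> (N + q) choose q \<and> orbit ?v \<subseteq> cvec.span (B \<union> Y)"
    proof (rule less.hyps[OF _ Y])
      show "E j ?v \<in> Y" if "j > q" for j
        using that Er less.prems(2)[of j] stable_H[OF Y, of "E j u" N]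
        by (cases "j = r") (auto simp: r H_E)
      show "H s ?v \<in> Y" if "s > N" for s
        using stable_H[OF Y less.prems(3)[OF that], of N] by (simp add: H_H)
    qed (simp add: r)
    then obtain B2 where B2: "finite B2" "card B2 \<le> (N + q) choose q" "orbit ?v \<subseteq> cvec.span (B2 \<union> Y)"
      by blast
    have Y': "stable ?Y"
      by (rule stable_span) (auto intro!: cvec.span_base orbit_P stableD(2)[OF Y])
    \<comment> \<open>Modulo that submodule the bound on \<open>H\<close> drops to
      \<open>M = N - 1\<close> with \<open>r\<close> unchanged; Pascal's rule adds the two
      counts.\<close>
    have "\<exists>B. finite B \<and> card B \<le> (M + r) choose r \<and> orbit u \<subseteq> cvec.span (B \<union> ?Y)"
    proof (rule less.hyps[OF _ Y'])
      show "E j u \<in> ?Y" if "j > r" for j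
        using less.prems(2)[OF that] by (auto intro: cvec.span_base)
      show "H s u \<in> ?Y" if "s > M" for s
        using less.prems(3)[of s] orbit_base[of ?v] that N
        by (cases "s = N") (auto intro: cvec.span_base)
    qed (simp add: N)
    then obtain B1 where B1: "finite B1" "card B1 \<le> (M + r) choose r" "orbit u \<subseteq> cvec.span (B1 \<union> ?Y)"
      by blast
    have "?Y \<subseteq> cvec.span (B2 \<union> Y)"
      using B2(3) by (intro cvec.span_minimal) (auto intro: cvec.span_base)
    also have "\<dots> \<subseteq> cvec.span (B1 \<union> B2 \<union> Y)"
      by (rule cvec.span_mono) auto
    finally have "cvec.span (B1 \<union> ?Y) \<subseteq> cvec.span (B1 \<union> B2 \<union> Y)"
      by (intro cvec.span_minimal) (auto intro: cvec.span_base)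
    moreover have "card (B1 \<union> B2) \<le> (N + r) choose r"
      using card_Un_le[of B1 B2] B1(2) B2(2) by (simp add: N r)
    ultimately show ?thesis
      using B1 B2 by (intro exI[of _ "B1 \<union> B2"]) auto
  qed
qed

end

section \<open>The dimension of local Weyl modules for \<open>sl\<^sub>2[t]\<close>\<close>

locale sl2_current =
  fixes e f h :: "nat \<Rightarrow> ('b \<Rightarrow>\<^sub>0 complex) \<Rightarrow> ('b \<Rightarrow>\<^sub>0 complex)"
  assumes clin_e: "clin (e i)" and clin_f: "clin (f i)" and clin_h: "clin (h i)"
    and e_e: "e i (e j v) = e j (e i v)"
    and h_h: "h i (h j v) = h j (h i v)"
    and h_e: "h i (e j v) = e j (h i v) + cscale 2 (e (i + j) v)"
    and f_e: "f i (e j v) = e j (f i v) - h (i + j) v"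
begin

text \<open>The factor 1/2 cancels the 2 in [h, e] = 2e. Commuting \<open>P a\<close> past a product
  of \<open>e j\<close> then gives the sum over all ways to raise one index by \<open>a + 1\<close>,
  which is multiplication by a power sum.\<close>

definition P :: "nat \<Rightarrow> ('b \<Rightarrow>\<^sub>0 complex) \<Rightarrow> ('b \<Rightarrow>\<^sub>0 complex)" where
  "P a v = cscale (1 / 2) (h (Suc a) v)"

sublocale commuting_ops P
proof (rule commuting_ops.intro)
  show "clin (P a)" for a
    unfolding P_def[abs_def] by (intro clin_compose[OF clin_cscale] clin_h)
  show "P a (P b v) = P b (P a v)" for a b v
    by (simp add: P_def clin_scale[OF clin_h] h_h)
qed

lemma P_e: "P a (e j v) = e j (P a v) + e (Suc (a + j)) v"
  by (simp add: P_def h_e clin_scale[OF clin_e] cvec.scale_right_distrib)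

text \<open>On \<open>\<Sum>\<^sub>i e\<^sub>i x\<^sup>i\<close>, the power sum \<open>P a\<close> acts as \<open>x\<^sup>-\<^sup>a\<^sup>-\<^sup>1\<close>, so \<open>\<Sum>\<^sub>j E\<^sub>j t\<^sup>j\<close> acts as the factor \<open>1 + t/x\<close>.\<close>

lemma E_e: "E j (e i v) = e i (E j v) + (if j = 0 then 0 else e (Suc i) (E (j - 1) v))"
proof (induction j rule: less_induct)
  case (less j)
  show ?case
  proof (cases j)
    case (Suc k)
    \<comment> \<open>\<open>E\<close> shifted by one index, with value 0 at index 0, so that the
      induction hypothesis has one form for all indices.\<close>
    define E' where "E' j = (if j = 0 then 0 else E (j - 1) v)" for j
    have IH: "E l (e i v) = e i (E l v) + e (Suc i) (E' l)" if "l \<le> k" for l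
      using less.IH[of l] that by (auto simp: Suc E'_def clin_zero[OF clin_e])
    let ?s = "\<lambda>a. cscale ((-1) ^ a)"
    have newton: "(\<Sum>a\<le>k. ?s a (P a (E (k - a) v))) = cscale (of_nat (Suc k)) (E (Suc k) v)" for k
      by (simp add: E.simps(2) del: of_nat_Suc)
    have newton': "(\<Sum>a\<le>k. ?s a (P a (E' (k - a)))) = cscale (of_nat k) (E k v)"
    proof (cases k)
      case (Suc l)
      have "(\<Sum>a\<le>k. ?s a (P a (E' (k - a)))) = (\<Sum>a\<le>l. ?s a (P a (E (l - a) v)))"
        unfolding Suc by (simp add: E'_def clin_zero[OF clin_P] Suc_diff_le)
      then show ?thesis by (simp add: newton Suc del: of_nat_Suc)
    qed (simp add: E'_def clin_zero[OF clin_P])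
    \<comment> \<open>The second sum is the first one moved by one place with the opposite sign, so
      only its term \<open>a = 0\<close> survives.\<close>
    have tele: "(\<Sum>a\<le>k. ?s a (e (Suc (a + i)) (E (k - a) v))) + (\<Sum>a\<le>k. ?s a (e (Suc (a + Suc i)) (E' (k - a))))
      = e (Suc i) (E k v)"
    proof (cases k)
      case (Suc l)
      have "(\<Sum>a\<le>k. ?s a (e (Suc (a + Suc i)) (E' (k - a)))) = (\<Sum>a\<le>l. ?s a (e (Suc (a + Suc i)) (E (l - a) v)))"
        unfolding Suc by (simp add: E'_def clin_zero[OF clin_e] Suc_diff_le)
      moreover have "(\<Sum>a\<le>k. ?s a (e (Suc (a + i)) (E (k - a) v)))
        = e (Suc i) (E k v) - (\<Sum>a\<le>l. ?s a (e (Suc (a + Suc i)) (E (l - a) v)))"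
        unfolding Suc by (subst sum.atMost_Suc_shift) (simp add: sum_negf)
      ultimately show ?thesis by simp
    qed (simp add: E'_def clin_zero[OF clin_e])
    have "cscale (of_nat (Suc k)) (E (Suc k) (e i v))
      = (\<Sum>a\<le>k. ?s a (P a (e i (E (k - a) v) + e (Suc i) (E' (k - a)))))"
      by (simp add: E.simps(2) IH del: of_nat_Suc)
    also have "\<dots> = e i (\<Sum>a\<le>k. ?s a (P a (E (k - a) v))) + e (Suc i) (\<Sum>a\<le>k. ?s a (P a (E' (k - a))))
      + ((\<Sum>a\<le>k. ?s a (e (Suc (a + i)) (E (k - a) v))) + (\<Sum>a\<le>k. ?s a (e (Suc (a + Suc i)) (E' (k - a)))))"
      by (simp add: clin_add[OF clin_P] P_e clin_sum[OF clin_e] clin_scale[OF clin_e]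
          cvec.scale_right_distrib sum.distrib algebra_simps)
    \<comment> \<open>Of the \<open>k + 1\<close> copies of \<open>e (Suc i) (E k v)\<close>,
      \<open>newton'\<close> contributes \<open>k\<close> and \<open>tele\<close> contributes
      one.\<close>
    also have "\<dots> = cscale (of_nat (Suc k)) (e i (E (Suc k) v) + e (Suc i) (E k v))"
      unfolding newton newton' tele
      by (simp add: clin_scale[OF clin_e] cvec.scale_right_distrib add.assoc del: of_nat_Suc)
        (simp add: cvec.scale_left_distrib add.commute)
    finally have "E (Suc k) (e i v) = e i (E (Suc k) v) + e (Suc i) (E k v)"
      by (rule cvec.scale_left_imp_eq[rotated]) (simp del: of_nat_Suc)
    then show ?thesis by (simp add: Suc)
  qed simp
qed

lemma h_e0_power:
  assumes "h 0 u = cscale (- of_nat m) u"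
  shows "h 0 ((e 0 ^^ p) u) = cscale (of_nat (2 * p) - of_nat m) ((e 0 ^^ p) u)"
proof (induction p)
  case (Suc p)
  have "h 0 ((e 0 ^^ Suc p) u)
    = cscale (of_nat (2 * p) - of_nat m) ((e 0 ^^ Suc p) u) + cscale 2 ((e 0 ^^ Suc p) u)"
    by (simp add: h_e Suc clin_scale[OF clin_e] flip: of_nat_mult)
  then show ?case by (simp flip: cvec.scale_left_distrib)
qed (simp add: assms)

lemma f_e0_power:
  assumes "f 0 u = 0" "h 0 u = cscale (- of_nat m) u"
  shows "f 0 ((e 0 ^^ Suc p) u) = cscale (of_nat (Suc p) * (of_nat m - of_nat p)) ((e 0 ^^ p) u)"
proof (induction p)
  case 0
  then show ?case by (simp add: f_e assms clin_zero[OF clin_e])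
next
  case (Suc p)
  have "f 0 ((e 0 ^^ Suc (Suc p)) u) = e 0 (f 0 ((e 0 ^^ Suc p) u)) - h 0 ((e 0 ^^ Suc p) u)"
    by (subst funpow.simps, subst comp_apply, subst f_e) simp
  also have "\<dots> = cscale (of_nat (Suc p) * (of_nat m - of_nat p)
      - (of_nat (2 * Suc p) - of_nat m)) ((e 0 ^^ Suc p) u)"
    unfolding Suc h_e0_power[OF assms(2)] cvec.scale_left_diff_distrib by (simp add: clin_scale[OF clin_e])
  also have "of_nat (Suc p) * (of_nat m - of_nat p) - (of_nat (2 * Suc p) - of_nat m)
      = of_nat (Suc (Suc p)) * (of_nat m - of_nat (Suc p) :: complex)"
    by (simp add: algebra_simps)
  finally show ?case .
qed

text \<open>The coefficient in \<open>f_e0_power\<close> vanishes only at \<open>p = m\<close>, so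
  \<open>f 0\<close> lowers any vanishing exponent above \<open>m + 1\<close> by one. Every
  nilpotency bound thus improves to the one dictated by the weight.\<close>

lemma e0_power_eq_0:
  assumes "f 0 u = 0" "h 0 u = cscale (- of_nat m) u" "(e 0 ^^ N) u = 0"
  shows "(e 0 ^^ Suc m) u = 0"
proof (cases "N \<le> Suc m")
  case True
  have "(e 0 ^^ p) 0 = 0" for p by (induction p) (simp_all add: clin_zero[OF clin_e])
  then have "(e 0 ^^ (Suc m - N + N)) u = 0" by (simp only: funpow_add comp_apply assms(3))
  then show ?thesis using True by simp
next
  case False
  have "(e 0 ^^ (Suc m + d)) u = 0 \<Longrightarrow> (e 0 ^^ Suc m) u = 0" for d
  proof (induction d)
    case (Suc d)
    have "f 0 ((e 0 ^^ Suc (Suc m + d)) u) = 0" using Suc.prems by (simp add: clin_zero[OF clin_f])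
    then have "cscale (of_nat (Suc (Suc m + d)) * (of_nat m - of_nat (Suc m + d))) ((e 0 ^^ (Suc m + d)) u) = 0"
      by (simp only: f_e0_power[OF assms(1,2)])
    moreover have "of_nat m - of_nat (Suc m + d) = - (of_nat (Suc d) :: complex)" by simp
    ultimately have "(e 0 ^^ (Suc m + d)) u = 0"
      by (simp del: of_nat_Suc of_nat_add funpow.simps)
    then show ?case by (rule Suc.IH)
  qed simp
  then show ?thesis using assms(3) False by (metis le_add_diff_inverse nat_le_linear)
qed

end

text \<open>\<open>f 1\<close> is singled out because its brackets with the \<open>e i\<close> are
  the \<open>- h (Suc i)\<close>, all of which kill \<open>u\<close>; this drives the Garland
  relations.\<close>

locale sl2_lowest_weight = sl2_current e f h
  for e f h :: "nat \<Rightarrow> ('b \<Rightarrow>\<^sub>0 complex) \<Rightarrow> ('b \<Rightarrow>\<^sub>0 complex)" +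
  fixes m :: nat and u :: "'b \<Rightarrow>\<^sub>0 complex"
  assumes f_u: "f 1 u = 0" and h_u: "h (Suc i) u = 0" and e_u: "(e 0 ^^ Suc m) u = 0"
begin

text \<open>\<open>X p s\<close> is the coefficient of \<open>x\<^sup>s\<close> in \<open>(\<Sum>\<^sub>i e\<^sub>i x\<^sup>i)\<^sup>p u\<close>.\<close>

definition X :: "nat \<Rightarrow> nat \<Rightarrow> ('b \<Rightarrow>\<^sub>0 complex)" where
  "X p = (conv e ^^ p) (\<lambda>s. if s = 0 then u else 0)"

lemma X_0: "X 0 s = (if s = 0 then u else 0)"
  and X_Suc: "X (Suc p) = conv e (X p)"
  by (simp_all add: X_def)

lemma X_at_0: "X p 0 = (e 0 ^^ p) u"
  by (induction p) (simp_all add: X_0 X_Suc conv_def)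

text \<open>\<open>D\<close> is the derivative of a generating series in x, and \<open>de\<close>
  below lists the coefficients of the derivative of e(x), the series of the
  \<open>e i\<close>.\<close>

definition D :: "(nat \<Rightarrow> ('b \<Rightarrow>\<^sub>0 complex)) \<Rightarrow> nat \<Rightarrow> ('b \<Rightarrow>\<^sub>0 complex)" where
  "D \<phi> s = cscale (of_nat (Suc s)) (\<phi> (Suc s))"

definition de :: "nat \<Rightarrow> ('b \<Rightarrow>\<^sub>0 complex) \<Rightarrow> ('b \<Rightarrow>\<^sub>0 complex)" where
  "de k v = cscale (of_nat (Suc k)) (e (Suc k) v)"

lemma clin_de: "clin (de k)"
  unfolding de_def[abs_def] by (intro clin_compose[OF clin_cscale] clin_e)

lemma D_conv: "D (conv e \<phi>) s = conv e (D \<phi>) s + conv de \<phi> s"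
proof -
  have "D (conv e \<phi>) s = (\<Sum>c\<le>Suc s. cscale (of_nat (Suc s)) (e c (\<phi> (Suc s - c))))"
    unfolding D_def conv_def by (rule cvec.scale_sum_right)
  also have "\<dots> = (\<Sum>c\<le>Suc s. cscale (of_nat (Suc s - c)) (e c (\<phi> (Suc s - c)))
      + cscale (of_nat c) (e c (\<phi> (Suc s - c))))"
    by (rule sum.cong) (auto simp: of_nat_diff simp flip: cvec.scale_left_distrib of_nat_add)
  also have "\<dots> = (\<Sum>c\<le>Suc s. cscale (of_nat (Suc s - c)) (e c (\<phi> (Suc s - c))))
      + (\<Sum>c\<le>Suc s. cscale (of_nat c) (e c (\<phi> (Suc s - c))))"
    by (rule sum.distrib)
  also have "(\<Sum>c\<le>Suc s. cscale (of_nat (Suc s - c)) (e c (\<phi> (Suc s - c)))) = conv e (D \<phi>) s"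
    by (simp add: conv_def D_def clin_scale[OF clin_e] Suc_diff_le del: of_nat_Suc of_nat_diff)
  also have "(\<Sum>c\<le>Suc s. cscale (of_nat c) (e c (\<phi> (Suc s - c)))) = conv de \<phi> s"
    by (subst sum.atMost_Suc_shift) (simp add: conv_def de_def del: of_nat_Suc)
  finally show ?thesis .
qed

text \<open>The commutator of the series of the \<open>h (Suc i)\<close> with e(x) has as
  coefficient of x^k the sum over i + j = k of \<open>2 e (Suc k)\<close>. There are k + 1 such
  terms, which makes it twice the derivative of e(x).\<close>

lemma h_conv: "conv (\<lambda>i. h (Suc i)) (conv e \<phi>) s = conv e (conv (\<lambda>i. h (Suc i)) \<phi>) s + cscale 2 (conv de \<phi> s)"
proof -
  have "conv (\<lambda>i. h (Suc i)) (conv e \<phi>) s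
    = (\<Sum>i\<le>s. \<Sum>j\<le>s - i. e j (h (Suc i) (\<phi> (s - i - j))))
      + cscale 2 (\<Sum>i\<le>s. \<Sum>j\<le>s - i. e (Suc (i + j)) (\<phi> (s - i - j)))"
    by (simp add: conv_def clin_sum[OF clin_h] h_e sum.distrib cvec.scale_sum_right)
  also have "(\<Sum>i\<le>s. \<Sum>j\<le>s - i. e j (h (Suc i) (\<phi> (s - i - j))))
      = (\<Sum>j\<le>s. \<Sum>i\<le>s - j. e j (h (Suc i) (\<phi> (s - i - j))))"
    by (rule sum_triangle_swap)
  also have "\<dots> = conv e (conv (\<lambda>i. h (Suc i)) \<phi>) s"
    by (simp add: conv_def clin_sum[OF clin_e] add.commute)
  also have "(\<Sum>i\<le>s. \<Sum>j\<le>s - i. e (Suc (i + j)) (\<phi> (s - i - j)))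
      = (\<Sum>k\<le>s. \<Sum>i\<le>k. e (Suc (i + (k - i))) (\<phi> (s - i - (k - i))))"
    by (rule sum_triangle_diagonal)
  also have "\<dots> = (\<Sum>k\<le>s. \<Sum>i\<le>k. e (Suc k) (\<phi> (s - k)))"
    by (intro sum.cong refl) auto
  also have "\<dots> = conv de \<phi> s"
    by (simp add: conv_def de_def cvec.sum_constant_scale del: sum_constant)
  finally show ?thesis .
qed

lemma conv_scale: "(\<And>i. clin (a i)) \<Longrightarrow> conv a (\<lambda>s. cscale c (\<phi> s)) s = cscale c (conv a \<phi> s)"
  for a :: "nat \<Rightarrow> ('b \<Rightarrow>\<^sub>0 complex) \<Rightarrow> ('b \<Rightarrow>\<^sub>0 complex)"
  by (simp add: conv_def clin_scale cvec.scale_sum_right)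

text \<open>Both sides vanish for \<open>p = 0\<close>, and both obey a product rule with the same
  extra term, twice the derivative of e(x), for each further factor e(x).\<close>

lemma h_X: "conv (\<lambda>i. h (Suc i)) (X p) = (\<lambda>s. cscale 2 (D (X p) s))"
proof (induction p)
  case 0
  show ?case
    by (auto simp: fun_eq_iff conv_def X_0 D_def h_u clin_zero[OF clin_h] intro!: sum.neutral)
next
  case (Suc p)
  show ?case
    by (simp add: fun_eq_iff X_Suc h_conv Suc conv_scale[OF clin_e] D_conv cvec.scale_right_distrib)
qed

text \<open>The power rule; derivatives can be collected in front because the \<open>e i\<close>
  commute.\<close>

lemma D_X: "D (X (Suc p)) s = cscale (of_nat (Suc p)) (conv de (X p) s)"
proof (induction p arbitrary: s)
  case 0
  have "D (X 0) = (\<lambda>s. 0)" by (auto simp: D_def X_0)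
  then show ?case by (simp add: X_Suc D_conv) (simp add: conv_def clin_zero[OF clin_e])
next
  case (Suc p)
  have "D (X (Suc (Suc p))) s = conv e (D (X (Suc p))) s + conv de (X (Suc p)) s"
    by (subst X_Suc) (rule D_conv)
  also have "D (X (Suc p)) = (\<lambda>s. cscale (of_nat (Suc p)) (conv de (X p) s))"
    using Suc by auto
  also have "conv e \<dots> s = cscale (of_nat (Suc p)) (conv e (conv de (X p)) s)"
    by (rule conv_scale[OF clin_e])
  also have "conv e (conv de (X p)) = conv de (X (Suc p))"
    unfolding X_Suc by (rule conv_commute) (simp_all add: clin_e clin_de de_def clin_scale[OF clin_e] e_e)
  finally show ?case
    by (simp add: poly_mapping_eq_iff fun_eq_iff lookup_add algebra_simps)
qed

text \<open>The Garland relations: \<open>f\<^sub>1\<close> acts on \<open>e(x)\<^sup>p u\<close> as \<open>- p e(x)\<^sup>p\<^sup>-\<^sup>1 u\<close> differentiated by \<open>x\<close>.\<close>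

lemma f_X: "f 1 (X (Suc p) s) = - cscale (of_nat (Suc p)) (D (X p) s)"
proof (induction p arbitrary: s)
  case 0
  have f: "f 1 (X 0 s) = 0" and h: "h (i + 1) (X 0 s) = 0" for s i
    using f_u by (simp_all add: X_0 h_u clin_zero[OF clin_f] clin_zero[OF clin_h])
  have "f 1 (X (Suc 0) s) = (\<Sum>i\<le>s. e i (f 1 (X 0 (s - i))) - h (i + 1) (X 0 (s - i)))"
    by (simp add: X_Suc conv_def clin_sum[OF clin_f] f_e)
  also have "\<dots> = 0"
    unfolding f h by (simp add: clin_zero[OF clin_e])
  finally show ?case by (simp add: D_def X_0)
next
  case (Suc p)
  have "f 1 (X (Suc (Suc p)) s) = conv e (\<lambda>s. f 1 (X (Suc p) s)) s - conv (\<lambda>i. h (Suc i)) (X (Suc p)) s"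
    by (subst X_Suc) (simp add: conv_def clin_sum[OF clin_f] f_e sum_subtractf)
  also have "conv e (\<lambda>s. f 1 (X (Suc p) s)) s = - cscale (of_nat (Suc p)) (conv e (D (X p)) s)"
    unfolding Suc cvec.scale_minus_left[symmetric] by (rule conv_scale[OF clin_e])
  also have "conv e (D (X p)) s = D (X (Suc p)) s - conv de (X p) s"
    by (simp add: X_Suc D_conv)
  finally show ?case
    by (simp add: h_X D_X[of p] cvec.scale_right_diff_distrib flip: D_X)
      (simp add: poly_mapping_eq_iff fun_eq_iff lookup_add lookup_minus algebra_simps)
qed

text \<open>By \<open>f_X\<close>, the vanishing of \<open>X (Suc p) s\<close> forces that of
  \<open>Suc s\<close> times \<open>X p (Suc s)\<close>. A factor e(x) is traded for one degree
  while \<open>p + s\<close> stays fixed; the start is a power of \<open>e 0\<close> beyond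
  \<open>m\<close>.\<close>

lemma X_eq_0: "p + s > m \<Longrightarrow> X p s = 0"
proof (induction s arbitrary: p)
  case 0
  then have p: "p = (p - Suc m) + Suc m" by simp
  have "(e 0 ^^ k) 0 = 0" for k by (induction k) (simp_all add: clin_zero[OF clin_e])
  then show ?case
    unfolding X_at_0 by (subst p) (simp only: funpow_add comp_apply e_u)
next
  case (Suc s)
  then have "X (Suc p) s = 0" by simp
  then have "D (X p) s = 0"
    using f_X[of p s] by (simp add: clin_zero[OF clin_f] del: of_nat_Suc)
  then show ?case by (simp add: D_def del: of_nat_Suc)
qed

lemma e_u_eq_0:
  assumes "i \<ge> m"
  shows "e i u = 0"
proof -
  have "X 1 i = (\<Sum>j\<in>{i}. e j (X 0 (i - j)))"
    unfolding One_nat_def X_Suc conv_def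
    by (rule sum.mono_neutral_right) (auto simp: X_0 clin_zero[OF clin_e])
  then show ?thesis using X_eq_0[of 1 i] assms by (simp add: X_0)
qed

lemma E_u: "j > 0 \<Longrightarrow> E j u = 0"
proof (induction j rule: less_induct)
  case (less j)
  then obtain k where k: "j = Suc k" by (cases j) auto
  have "P a (E (k - a) u) = 0" for a
  proof (cases "k - a = 0")
    case True
    then show ?thesis by (simp add: P_def h_u)
  next
    case False
    then have "E (k - a) u = 0" using less.IH by (simp add: k)
    then show ?thesis by (simp only: clin_zero[OF clin_P])
  qed
  then show ?case by (simp add: k E.simps(2))
qed

text \<open>By \<open>E_e\<close> each factor \<open>e 0\<close> raises the largest index of a
  nonzero \<open>E\<close> by at most one, just as elementary symmetric polynomials in r variables
  stop at degree r.\<close>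

lemma E_e0_power: "j > r \<Longrightarrow> E j ((e 0 ^^ r) u) = 0"
proof (induction r arbitrary: j)
  case (Suc r)
  then show ?case by (auto simp: E_e clin_zero[OF clin_e])
qed (simp add: E_u)

text \<open>The coefficients of E(-x), which is inverse to the series of the complete symmetric
  \<open>H\<close>.\<close>

definition sE :: "nat \<Rightarrow> ('b \<Rightarrow>\<^sub>0 complex) \<Rightarrow> ('b \<Rightarrow>\<^sub>0 complex)" where
  "sE i v = cscale ((-1) ^ i) (E i v)"

lemma clin_sE: "clin (sE i)"
  unfolding sE_def[abs_def] by (intro clin_compose[OF clin_cscale] clin_E)

text \<open>Passing a factor e(x), the series E(-x) contributes 1 - xS with S the shift of the index
  of e, and (1 - xS) e(x) telescopes to its constant term \<open>e 0\<close>.\<close>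

lemma sE_conv: "conv sE (conv e \<phi>) s = e 0 (conv sE \<phi> s)"
proof -
  have sE_e: "sE i (e j v) = e j (sE i v) - (if i = 0 then 0 else e (Suc j) (sE (i - 1) v))" for i j v
    by (cases i) (simp_all add: sE_def E_e clin_scale[OF clin_e] clin_neg[OF clin_e] cvec.scale_right_distrib)
  let ?g = "\<lambda>i j. if i = 0 then 0 else e (Suc j) (sE (i - 1) (\<phi> (s - i - j)))"
  have "conv sE (conv e \<phi>) s = (\<Sum>i\<le>s. \<Sum>j\<le>s - i. e j (sE i (\<phi> (s - i - j)))) - (\<Sum>i\<le>s. \<Sum>j\<le>s - i. ?g i j)"
    by (simp add: conv_def clin_sum[OF clin_sE] sE_e sum_subtractf del: diff_diff_left)
  also have "(\<Sum>i\<le>s. \<Sum>j\<le>s - i. e j (sE i (\<phi> (s - i - j)))) = conv e (conv sE \<phi>) s"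
    by (subst sum_triangle_swap) (simp add: conv_def clin_sum[OF clin_e] add.commute)
  also have "\<dots> - (\<Sum>i\<le>s. \<Sum>j\<le>s - i. ?g i j) = e 0 (conv sE \<phi> s)"
  proof (cases s)
    case (Suc r)
    have "(\<Sum>i\<le>s. \<Sum>j\<le>s - i. ?g i j) = (\<Sum>i\<le>r. \<Sum>j\<le>r - i. e (Suc j) (sE i (\<phi> (r - i - j))))"
      unfolding Suc by (subst sum.atMost_Suc_shift) simp
    also have "\<dots> = (\<Sum>j\<le>r. \<Sum>i\<le>r - j. e (Suc j) (sE i (\<phi> (r - i - j))))"
      by (rule sum_triangle_swap)
    also have "\<dots> = (\<Sum>j\<le>r. e (Suc j) (conv sE \<phi> (r - j)))"
      by (simp add: conv_def clin_sum[OF clin_e] add.commute)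
    finally show ?thesis
      unfolding Suc conv_def[of e] by (subst sum.atMost_Suc_shift) simp
  qed (simp add: conv_def)
  finally show ?thesis .
qed

lemma sE_X: "conv sE (X p) s = (if s = 0 then (e 0 ^^ p) u else 0)"
proof (induction p arbitrary: s)
  case 0
  show ?case
    by (auto simp: conv_def X_0 sE_def E_u clin_zero[OF clin_E] intro!: sum.neutral)
next
  case (Suc p)
  then show ?case by (simp add: X_Suc sE_conv clin_zero[OF clin_e])
qed

text \<open>By \<open>sE_X\<close>, E(-x) carries the series \<open>X p\<close> to the constant
  \<open>(e 0 ^^ p) u\<close>. Inverting E(-x) shows that \<open>X p\<close> is the series of the
  \<open>H s\<close> applied to this vector, so the Garland vanishing becomes the bound on
  \<open>H\<close> in \<open>orbit_dim_bound\<close>.\<close>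

lemma H_e0_power: "H s ((e 0 ^^ p) u) = X p s"
proof (induction s rule: less_induct)
  case (less s)
  show ?case
  proof (cases s)
    case 0
    then show ?thesis by (simp add: X_at_0)
  next
    case (Suc r)
    have "0 = conv sE (X p) s" by (simp add: sE_X Suc)
    also have "\<dots> = X p s + (\<Sum>i\<le>r. sE (Suc i) (X p (r - i)))"
      unfolding conv_def Suc by (subst sum.atMost_Suc_shift) (simp add: sE_def)
    also have "(\<Sum>i\<le>r. sE (Suc i) (X p (r - i))) = - H s ((e 0 ^^ p) u)"
      unfolding Suc H.simps(2) using less.IH by (simp add: Suc sE_def sum_negf)
    finally show ?thesis by simp
  qed
qed

lemma foldr_e_e: "foldr e J (e i v) = e i (foldr e J v)"
  by (induction J) (simp_all add: e_e)

lemma clin_foldr_e: "clin (foldr e J)"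
  by (induction J) (auto intro: clinI clin_compose[OF clin_e] simp: comp_def)

lemma P_foldr_e:
  "P c (foldr e J v) = foldr e J (P c v) + (\<Sum>i<length J. foldr e (J[i := J ! i + Suc c]) v)"
proof (induction J)
  case (Cons j J)
  then show ?case
    by (simp add: P_e clin_add[OF clin_e] clin_sum[OF clin_e] sum.lessThan_Suc_shift add_ac
        del: sum.lessThan_Suc)
qed simp

lemma P_e0_power: "P c ((e 0 ^^ Suc z) u) = cscale (of_nat (Suc z)) (e (Suc c) ((e 0 ^^ z) u))"
proof (induction z)
  case 0
  have "P c u = 0" by (simp add: P_def h_u)
  then show ?case by (simp add: P_e clin_zero[OF clin_e])
next
  case (Suc z)
  have "P c ((e 0 ^^ Suc (Suc z)) u) = e 0 (P c ((e 0 ^^ Suc z) u)) + e (Suc c) ((e 0 ^^ Suc z) u)"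
    by (subst funpow.simps, subst comp_apply, subst P_e) simp
  also have "\<dots> = cscale (of_nat (Suc z)) (e (Suc c) ((e 0 ^^ Suc z) u)) + e (Suc c) ((e 0 ^^ Suc z) u)"
    unfolding Suc by (simp add: clin_scale[OF clin_e] e_e[of "Suc c"] del: of_nat_Suc)
  finally show ?case by (simp add: poly_mapping_eq_iff fun_eq_iff lookup_add algebra_simps del: funpow.simps)
qed

text \<open>To produce a first factor \<open>e (Suc c)\<close>, apply \<open>P c\<close> to the word
  in which it is replaced by one more \<open>e 0\<close>. Hitting one of the \<open>Suc z\<close>
  factors \<open>e 0\<close> gives the wanted word; hitting a factor of \<open>J'\<close> gives
  words covered by induction, since their list is shorter.\<close>

lemma foldr_e_in_orbit:
  "foldr e J ((e 0 ^^ z) u) \<in> cvec.span (orbit ((e 0 ^^ (length J + z)) u))"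
proof (induction "length J" arbitrary: J z)
  case 0
  then show ?case by (simp add: cvec.span_base orbit_base)
next
  case (Suc q)
  then obtain j J' where J: "J = j # J'" "length J' = q" by (cases J) auto
  have IH: "foldr e J'' ((e 0 ^^ Suc z) u) \<in> cvec.span (orbit ((e 0 ^^ (length J + z)) u))"
    if "length J'' = q" for J''
    using Suc.hyps(1)[of J'' "Suc z"] that J by simp
  show ?case
  proof (cases j)
    case 0
    have "foldr e J ((e 0 ^^ z) u) = foldr e J' ((e 0 ^^ Suc z) u)"
      by (simp add: J 0 foldr_e_e)
    then show ?thesis using IH[OF J(2)] by simp
  next
    case (Suc c)
    let ?S = "cvec.span (orbit ((e 0 ^^ (length J + z)) u))"
    have st: "stable ?S" by (rule stable_span) (simp add: cvec.span_base orbit_P)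
    have "cscale (of_nat (Suc z)) (foldr e J ((e 0 ^^ z) u))
      = P c (foldr e J' ((e 0 ^^ Suc z) u)) - (\<Sum>i<length J'. foldr e (J'[i := J' ! i + Suc c]) ((e 0 ^^ Suc z) u))"
      unfolding P_foldr_e P_e0_power J Suc
      by (simp add: clin_scale[OF clin_foldr_e] foldr_e_e del: of_nat_Suc)
    also have "\<dots> \<in> ?S"
      by (intro cvec.span_diff cvec.span_sum stableD(2)[OF st] IH) (simp_all add: J)
    finally show ?thesis
      by (rule subspace_unscale[OF cvec.subspace_span]) (simp del: of_nat_Suc)
  qed
qed

lemma dim_bound: "\<exists>B. finite B \<and> card B \<le> 2 ^ m \<and> (\<forall>J. foldr e J u \<in> cvec.span B)"
proof -
  have st: "stable {0}" by (auto simp: stable_def clin_zero[OF clin_P])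
  \<comment> \<open>\<open>X_eq_0\<close> kills \<open>H s\<close> for \<open>s > m - r\<close>.
    With \<open>N = m - r\<close> the count \<open>(N + r) choose r\<close> is
    \<open>m choose r\<close>.\<close>
  have "\<exists>B. finite B \<and> card B \<le> m choose r \<and> orbit ((e 0 ^^ r) u) \<subseteq> cvec.span (B \<union> {0})" if "r \<le> m" for r
    using orbit_dim_bound[OF st, of r "(e 0 ^^ r) u" "m - r"] that
    by (simp add: E_e0_power H_e0_power X_eq_0)
  then obtain B where B: "\<And>r. r \<le> m \<Longrightarrow> finite (B r) \<and> card (B r) \<le> m choose r
      \<and> orbit ((e 0 ^^ r) u) \<subseteq> cvec.span (B r \<union> {0})"
    by metis
  let ?B = "\<Union>r\<le>m. B r"
  have "card ?B \<le> (\<Sum>r\<le>m. card (B r))" by (rule card_UN_le) simp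
  also have "\<dots> \<le> (\<Sum>r\<le>m. m choose r)" by (rule sum_mono) (use B in auto)
  also have "\<dots> = 2 ^ m" by (rule choose_row_sum)
  finally have card: "card ?B \<le> 2 ^ m" .
  have "foldr e J u \<in> cvec.span ?B" for J
  proof (cases "length J \<le> m")
    case True
    have "cvec.span (orbit ((e 0 ^^ length J) u)) \<subseteq> cvec.span (B (length J) \<union> {0})"
      using B[OF True] by (intro cvec.span_minimal) auto
    also have "\<dots> \<subseteq> cvec.span ?B"
      using True by (intro cvec.span_minimal) (auto intro: cvec.span_base cvec.span_zero)
    finally show ?thesis using foldr_e_in_orbit[of J 0] by auto
  next
    case False
    \<comment> \<open>With more than \<open>m\<close> factors the relevant orbit is that of the zero
      vector.\<close>
    then have "(e 0 ^^ length J) u = 0" using X_eq_0[of "length J" 0] by (simp add: X_at_0)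
    moreover have "orbit 0 \<subseteq> {0}" by (rule orbit_subset) (auto simp: clin_zero[OF clin_P])
    ultimately have "cvec.span (orbit ((e 0 ^^ length J) u)) \<subseteq> {0}"
      using cvec.span_mono[of "orbit 0" "{0}"] by auto
    then show ?thesis using foldr_e_in_orbit[of J 0] by (auto simp: cvec.span_zero)
  qed
  then show ?thesis using card B by (intro exI[of _ ?B]) auto
qed

end

section \<open>The upper bound for twisted Weyl modules\<close>

text \<open>Extend a basis \<open>B\<close> of \<open>Y\<close> to a basis of the whole space;
  \<open>\<pi>\<close> kills \<open>B\<close> and fixes the added vectors. Its range models the
  quotient by \<open>Y\<close> without leaving the type.\<close>

lemma quotient_projection:
  assumes Y: "cvec.subspace Y"
  obtains \<pi> :: "('b \<Rightarrow>\<^sub>0 complex) \<Rightarrow> ('b \<Rightarrow>\<^sub>0 complex)"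
  where "clin \<pi>" "\<And>v. \<pi> v = 0 \<longleftrightarrow> v \<in> Y" "\<And>v. v - \<pi> v \<in> Y"
proof -
  interpret vector_space_pair "cscale :: complex \<Rightarrow> ('b \<Rightarrow>\<^sub>0 complex) \<Rightarrow> _"
    "cscale :: complex \<Rightarrow> ('b \<Rightarrow>\<^sub>0 complex) \<Rightarrow> _" ..
  obtain B where B: "B \<subseteq> Y" "cvec.independent B" "Y \<subseteq> cvec.span B"
    using cvec.maximal_independent_subset by blast
  obtain C where C: "B \<subseteq> C" "cvec.independent C" "UNIV \<subseteq> cvec.span C"
    using cvec.maximal_independent_subset_extend[of B UNIV] B(2) by auto
  obtain \<pi> where \<pi>: "clin \<pi>" "\<And>c. c \<in> C \<Longrightarrow> \<pi> c = (if c \<in> B then 0 else c)"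
    using linear_independent_extend[OF C(2), of "\<lambda>c. if c \<in> B then 0 else c"] by blast
  have diff: "v - \<pi> v \<in> Y" for v
  proof -
    have "clin (\<lambda>v. v - \<pi> v)"
      by (rule clinI) (simp_all add: clin_add[OF \<pi>(1)] clin_scale[OF \<pi>(1)] cvec.scale_right_diff_distrib)
    moreover have "s - \<pi> s \<in> Y" if "s \<in> C" for s
      using \<pi>(2)[OF that] B(1) cvec.subspace_0[OF Y] by auto
    ultimately show ?thesis
      using clin_span_image[of "\<lambda>v. v - \<pi> v" v C Y] C(3) Y by auto
  qed
  have "\<pi> v = 0" if "v \<in> Y" for v
  proof -
    have "\<pi> s \<in> {0}" if "s \<in> B" for s using \<pi>(2)[of s] that C(1) by auto
    then show ?thesis
      using clin_span_image[OF \<pi>(1) _ _ cvec.subspace_single_0, of v B] that B(3) by auto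
  qed
  then have "\<pi> v = 0 \<longleftrightarrow> v \<in> Y" for v using diff[of v] by auto
  then show thesis using that \<pi>(1) diff by blast
qed

text \<open>The operators followed by \<open>\<pi>\<close> model the action on the quotient by
  \<open>Y\<close>. Stability of \<open>Y\<close> gives \<open>desc\<close>, through which the
  commutation relations descend. The exponent \<open>N\<close> may be arbitrary because
  \<open>e0_power_eq_0\<close> replaces it by \<open>m + 1\<close>.\<close>

lemma (in sl2_current) dim_bound_mod:
  assumes Y: "cvec.subspace Y" and st: "\<And>i v. v \<in> Y \<Longrightarrow> e i v \<in> Y" "\<And>i v. v \<in> Y \<Longrightarrow> f i v \<in> Y"
      "\<And>i v. v \<in> Y \<Longrightarrow> h i v \<in> Y"
    and u: "\<And>i. f i u \<in> Y" "\<And>i. h (Suc i) u \<in> Y" "h 0 u = cscale (- of_nat m) u" "(e 0 ^^ N) u \<in> Y"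
  shows "\<exists>B. finite B \<and> card B \<le> 2 ^ m \<and> (\<forall>J. foldr e J u \<in> cvec.span (B \<union> Y))"
proof -
  obtain \<pi> :: "('b \<Rightarrow>\<^sub>0 complex) \<Rightarrow> ('b \<Rightarrow>\<^sub>0 complex)"
    where \<pi>: "clin \<pi>" "\<And>v. \<pi> v = 0 \<longleftrightarrow> v \<in> Y" "\<And>v. v - \<pi> v \<in> Y"
    by (rule quotient_projection[OF Y]) blast
  have desc: "\<pi> (T (\<pi> v)) = \<pi> (T v)" if "clin T" "\<And>v. v \<in> Y \<Longrightarrow> T v \<in> Y" for T v
  proof -
    have "\<pi> (T (v - \<pi> v)) = 0" by (simp add: \<pi> that)
    then show ?thesis by (simp add: clin_diff[OF that(1)] clin_diff[OF \<pi>(1)])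
  qed
  note d = desc[OF clin_e st(1)] desc[OF clin_f st(2)] desc[OF clin_h st(3)]
  interpret Q: sl2_current "\<lambda>i v. \<pi> (e i v)" "\<lambda>i v. \<pi> (f i v)" "\<lambda>i v. \<pi> (h i v)"
    by (rule sl2_current.intro)
      (simp_all add: clin_compose[OF \<pi>(1)] clin_e clin_f clin_h d e_e h_h h_e f_e
        clin_add[OF \<pi>(1)] clin_scale[OF \<pi>(1)] clin_diff[OF \<pi>(1)])
  have pow: "((\<lambda>v. \<pi> (e 0 v)) ^^ N) (\<pi> u) = \<pi> ((e 0 ^^ N) u)" for N
    by (induction N) (simp_all add: d)
  have z: "\<pi> (f i u) = 0" "\<pi> (h (Suc i) u) = 0" "\<pi> ((e 0 ^^ N) u) = 0" for i
    using u \<pi>(2) by auto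
  have "((\<lambda>v. \<pi> (e 0 v)) ^^ Suc m) (\<pi> u) = 0"
    by (rule Q.e0_power_eq_0[where N = N]) (simp_all only: pow d z u(3) clin_scale[OF \<pi>(1)])
  then interpret Q: sl2_lowest_weight "\<lambda>i v. \<pi> (e i v)" "\<lambda>i v. \<pi> (f i v)" "\<lambda>i v. \<pi> (h i v)" m "\<pi> u"
    by unfold_locales (simp_all only: d z)
  obtain B where B: "finite B" "card B \<le> 2 ^ m" "\<And>J. foldr (\<lambda>i v. \<pi> (e i v)) J (\<pi> u) \<in> cvec.span B"
    using Q.dim_bound by blast
  have "foldr (\<lambda>i v. \<pi> (e i v)) J (\<pi> u) = \<pi> (foldr e J u)" for J
    by (induction J) (simp_all add: d)
  then have "\<pi> (foldr e J u) \<in> cvec.span (B \<union> Y)" for J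
    using B(3)[of J] cvec.span_mono[of B "B \<union> Y"] by auto
  moreover have "foldr e J u - \<pi> (foldr e J u) \<in> cvec.span (B \<union> Y)" for J
    using \<pi>(3) by (auto intro: cvec.span_base)
  ultimately have "(foldr e J u - \<pi> (foldr e J u)) + \<pi> (foldr e J u) \<in> cvec.span (B \<union> Y)" for J
    by (intro cvec.span_add)
  then have "foldr e J u \<in> cvec.span (B \<union> Y)" for J by simp
  then show ?thesis using B(1,2) by blast
qed

text \<open>Subsets without the new element contribute twice the old sum, those with it
  once.\<close>

lemma sum_Pow_power: "finite A \<Longrightarrow> (\<Sum>I\<in>Pow A. 2 ^ (card A - card I)) = (3 :: nat) ^ card A"
proof (induction A rule: finite_induct)
  case (insert a A)
  have inj: "inj_on (Set.insert a) (Pow A)" using insert.hyps by (auto simp: inj_on_def)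
  have "(\<Sum>I\<in>Pow (insert a A). 2 ^ (card (insert a A) - card I) :: nat)
    = (\<Sum>I\<in>Pow A. 2 ^ (Suc (card A) - card I)) + (\<Sum>I\<in>Set.insert a ` Pow A. 2 ^ (Suc (card A) - card I))"
    unfolding Pow_insert using insert.hyps by (subst sum.union_disjoint) auto
  also have "(\<Sum>I\<in>Set.insert a ` Pow A. 2 ^ (Suc (card A) - card I) :: nat) = (\<Sum>I\<in>Pow A. 2 ^ (card A - card I))"
    unfolding sum.reindex[OF inj] comp_def
    by (rule sum.cong) (use insert.hyps in \<open>auto simp: card_insert_if finite_subset\<close>)
  also have "(\<Sum>I\<in>Pow A. 2 ^ (Suc (card A) - card I) :: nat) = (\<Sum>I\<in>Pow A. 2 * 2 ^ (card A - card I))"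
    by (rule sum.cong) (auto simp: Suc_diff_le card_mono insert.hyps simp flip: power_Suc)
  finally show ?case using insert by (simp flip: sum_distrib_left)
qed simp

text \<open>Index \<open>i\<close> stands for \<open>t^(2i)\<close> in \<open>e\<close>,
  \<open>f\<close>, \<open>h\<close> and for \<open>t^(2i+1)\<close> in \<open>g\<close> and
  \<open>k\<close>, which are the actions of g^+ and g^-. Adding two odd exponents explains
  \<open>Suc (i + j)\<close> in \<open>k_g\<close> and \<open>g_g\<close>.\<close>

locale osp_current = sl2_current e f h
  for e f h :: "nat \<Rightarrow> ('b \<Rightarrow>\<^sub>0 complex) \<Rightarrow> ('b \<Rightarrow>\<^sub>0 complex)" +
  fixes g k :: "nat \<Rightarrow> ('b \<Rightarrow>\<^sub>0 complex) \<Rightarrow> ('b \<Rightarrow>\<^sub>0 complex)"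
    and n :: nat and w :: "'b \<Rightarrow>\<^sub>0 complex"
  assumes clin_g: "clin (g i)" and clin_k: "clin (k i)"
    and e_g: "e i (g j v) = g j (e i v)"
    and h_g: "h i (g j v) = g j (h i v) + g (i + j) v"
    and f_g: "f i (g j v) = g j (f i v) - k (i + j) v"
    and k_g: "k i (g j v) = h (Suc (i + j)) v - g j (k i v)"
    and g_g: "g i (g j v) = cscale 2 (e (Suc (i + j)) v) - g j (g i v)"
    and k_e: "k i (e j v) = e j (k i v) + g (i + j) v"
    and f_w: "f i w = 0" and k_w: "k i w = 0" and h_w: "h (Suc i) w = 0"
    and h0_w: "h 0 w = cscale (- of_nat n) w" and e_w: "(e 0 ^^ Suc n) w = 0"
begin

sublocale lw: sl2_lowest_weight e f h n w
  by unfold_locales (simp_all only: f_w h_w e_w)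

text \<open>\<open>g i w\<close> is the bracket of \<open>k 0\<close> and \<open>e i\<close> applied
  to \<open>w\<close>, and both kill \<open>w\<close> for these \<open>i\<close>.\<close>

lemma g_w_eq_0: "i \<ge> n \<Longrightarrow> g i w = 0"
  using k_e[of 0 i w] by (simp add: lw.e_u_eq_0 k_w clin_zero[OF clin_k] clin_zero[OF clin_e])

section \<open>Reordering products of the \<open>g i\<close> modulo products with fewer
  factors\<close>

abbreviation gs :: "nat list \<Rightarrow> ('b \<Rightarrow>\<^sub>0 complex)" where
  "gs l \<equiv> foldr g l w"

definition shorter :: "nat \<Rightarrow> ('b \<Rightarrow>\<^sub>0 complex) set" where
  "shorter d = cvec.span {foldr e J (gs l) | J l. length l < d}"

lemma e_foldr_g: "e i (foldr g l v) = foldr g l (e i v)"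
  by (induction l) (simp_all add: e_g)

lemma foldr_e_g: "foldr e J (g i v) = g i (foldr e J v)"
  by (induction J) (simp_all add: e_g)

lemma subspace_shorter: "cvec.subspace (shorter d)"
  by (simp add: shorter_def)

lemma shorterI: "length l < d \<Longrightarrow> foldr e J (gs l) \<in> shorter d"
  unfolding shorter_def by (rule cvec.span_base) auto

lemma g_shorter: "v \<in> shorter d \<Longrightarrow> g a v \<in> shorter (Suc d)"
  unfolding shorter_def
proof (rule clin_span_image[OF clin_g], assumption)
  fix s assume "s \<in> {foldr e J (gs l) |J l. length l < d}"
  then obtain J l where "s = foldr e J (gs l)" "length l < d" by blast
  then have "g a s = foldr e J (gs (a # l))" "length (a # l) < Suc d" by (simp_all add: foldr_e_g)
  then show "g a s \<in> cvec.span {foldr e J (gs l) |J l. length l < Suc d}"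
    by (blast intro: cvec.span_base)
qed simp

lemma gs_swap: "g a (g b (gs l)) + g b (g a (gs l)) \<in> shorter (Suc (Suc (length l)))"
  using cvec.subspace_scale[OF subspace_shorter shorterI[of l _ "[Suc (a + b)]"], of "Suc (Suc (length l))" 2]
  by (simp add: g_g[of a b])

text \<open>Two \<open>g\<close> anticommute up to a multiple of an \<open>e\<close>, which has
  fewer \<open>g\<close> factors. Modulo \<open>shorter\<close>, moving a factor only costs a sign,
  recorded by \<open>c\<close>.\<close>

lemma gs_insort: "\<exists>c. gs (a # s) - cscale c (gs (insort a s)) \<in> shorter (Suc (length s))"
proof (induction s)
  case Nil
  show ?case by (rule exI[of _ 1]) (simp add: cvec.subspace_0 subspace_shorter)
next
  case (Cons b s)
  show ?case
  proof (cases "a \<le> b")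
    case True
    then show ?thesis by (intro exI[of _ 1]) (simp add: cvec.subspace_0 subspace_shorter)
  next
    case False
    obtain c where "gs (a # s) - cscale c (gs (insort a s)) \<in> shorter (Suc (length s))"
      using Cons by blast
    from g_shorter[OF this, of b]
    have "g b (g a (gs s)) - cscale c (g b (gs (insort a s))) \<in> shorter (Suc (Suc (length s)))"
      by (simp add: clin_diff[OF clin_g] clin_scale[OF clin_g])
    from cvec.subspace_diff[OF subspace_shorter gs_swap[of a b s] this] False
    show ?thesis by (intro exI[of _ "- c"]) simp
  qed
qed

lemma gs_sort: "\<exists>c. gs l - cscale c (gs (sort l)) \<in> shorter (length l)"
proof (induction l)
  case Nil
  show ?case by (rule exI[of _ 1]) (simp add: cvec.subspace_0 subspace_shorter)
next
  case (Cons a l)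
  then obtain c where "gs l - cscale c (gs (sort l)) \<in> shorter (length l)" by blast
  from g_shorter[OF this, of a]
  have 1: "g a (gs l) - cscale c (g a (gs (sort l))) \<in> shorter (Suc (length l))"
    by (simp add: clin_diff[OF clin_g] clin_scale[OF clin_g])
  obtain d where "gs (a # sort l) - cscale d (gs (insort a (sort l))) \<in> shorter (Suc (length (sort l)))"
    using gs_insort by blast
  from cvec.subspace_add[OF subspace_shorter 1 cvec.subspace_scale[OF subspace_shorter this[unfolded length_sort], of c]]
  show ?case
    by (intro exI[of _ "c * d"]) (simp add: cvec.scale_right_diff_distrib)
qed

lemma sorted_repeat: "sorted l \<Longrightarrow> \<not> distinct l \<Longrightarrow> \<exists>xs a ys. l = xs @ a # a # ys" for l :: "nat list"
proof (induction l)
  case (Cons b l)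
  show ?case
  proof (cases "distinct l")
    case True
    then have "b \<in> set l" using Cons.prems by simp
    then obtain c l' where l: "l = c # l'" "b = c \<or> b \<in> set l'" by (cases l) auto
    then have "b = c" using Cons.prems(1) by force
    then show ?thesis using l by (intro exI[of _ "[]"]) simp
  next
    case False
    then obtain xs a ys where "l = xs @ a # a # ys" using Cons by auto
    then show ?thesis by (intro exI[of _ "b # xs"]) simp
  qed
qed simp

text \<open>A repeated index gives a square, and the square of \<open>g a\<close> is
  \<open>e (Suc (a + a))\<close>, so two factors are lost. For an index of at least
  \<open>n\<close>, sorting has put the largest index next to \<open>w\<close>, which it
  kills.\<close>

lemma gs_sorted_degenerate:
  assumes "sorted l" "\<not> distinct l \<or> (\<exists>a\<in>set l. a \<ge> n)"
  shows "gs l \<in> shorter (length l)"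
proof (cases "distinct l")
  case False
  then obtain xs a ys where l: "l = xs @ a # a # ys" using sorted_repeat assms by blast
  have "cscale 2 (g a (g a (gs ys))) = cscale 2 (e (Suc (a + a)) (gs ys))"
    using g_g[of a a "gs ys"] cvec.scale_left_distrib[of 1 1 "g a (g a (gs ys))"] by (simp add: eq_diff_eq)
  then have "gs (a # a # ys) = e (Suc (a + a)) (gs ys)"
    using cvec.scale_left_imp_eq[of 2 "g a (g a (gs ys))" "e (Suc (a + a)) (gs ys)"] by simp
  then have "gs l = foldr e [Suc (a + a)] (gs (xs @ ys))" by (simp add: l e_foldr_g)
  then show ?thesis using shorterI[of "xs @ ys" "length l" "[Suc (a + a)]"] by (simp add: l)
next
  case True
  then obtain a where a: "a \<in> set l" "a \<ge> n" using assms by blast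
  then have ne: "l \<noteq> []" by auto
  have "last l \<ge> a"
    using assms(1) a(1) ne by (auto simp: in_set_conv_nth last_conv_nth intro!: sorted_nth_mono)
  then have "g (last l) w = 0" using a g_w_eq_0 by simp
  moreover have "foldr g l' 0 = 0" for l' by (induction l') (simp_all add: clin_zero[OF clin_g])
  ultimately have "gs (butlast l @ [last l]) = 0" by simp
  then show ?thesis using ne by (simp add: cvec.subspace_0 subspace_shorter)
qed

section \<open>Spanning vectors indexed by subsets\<close>

definition G :: "nat set \<Rightarrow> ('b \<Rightarrow>\<^sub>0 complex)" where
  "G I = gs (sorted_list_of_set I)"

definition EG :: "nat set set \<Rightarrow> ('b \<Rightarrow>\<^sub>0 complex) set" where
  "EG S = cvec.span {foldr e J (G I) | J I. I \<in> S}"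

lemma subspace_EG: "cvec.subspace (EG S)"
  by (simp add: EG_def)

lemma EG_I: "I \<in> S \<Longrightarrow> foldr e J (G I) \<in> EG S"
  unfolding EG_def by (rule cvec.span_base) auto

lemma EG_mono: "S \<subseteq> S' \<Longrightarrow> EG S \<subseteq> EG S'"
  unfolding EG_def by (rule cvec.span_mono) auto

lemma EG_subset: "(\<And>J I. I \<in> S \<Longrightarrow> foldr e J (G I) \<in> Z) \<Longrightarrow> cvec.subspace Z \<Longrightarrow> EG S \<subseteq> Z"
  unfolding EG_def by (rule cvec.span_minimal) auto

lemma EG_image:
  assumes "clin T" "\<And>J I. I \<in> S \<Longrightarrow> T (foldr e J (G I)) \<in> Z" "cvec.subspace Z" "v \<in> EG S"
  shows "T v \<in> Z"
  by (rule clin_span_image[OF assms(1) assms(4)[unfolded EG_def] _ assms(3)]) (use assms(2) in auto)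

lemma e_EG: "v \<in> EG S \<Longrightarrow> e i v \<in> EG S"
  by (erule EG_image[OF clin_e _ subspace_EG, rotated]) (use EG_I[of _ S "i # _"] in simp)

lemma foldr_e_EG: "v \<in> EG S \<Longrightarrow> foldr e J v \<in> EG S"
  by (induction J) (simp_all add: e_EG)

text \<open>Sorting preserves the length and the sum of the indices, and what it discards has fewer
  factors. The sum is recorded because the order on subsets depends on it.\<close>

lemma gs_in_EG:
  "gs l \<in> EG {I \<in> Pow {..<n}. card I < length l \<or> card I = length l \<and> \<Sum>I = sum_list l}"
  (is "_ \<in> EG (?S l)")
proof (induction "length l" arbitrary: l rule: less_induct)
  case less
  have short: "shorter (length l) \<subseteq> EG (?S l)"
    unfolding shorter_def
  proof (rule cvec.span_minimal[OF _ subspace_EG], clarify)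
    fix J and l' :: "nat list" assume l': "length l' < length l"
    then have "EG (?S l') \<subseteq> EG (?S l)" by (intro EG_mono) auto
    then show "foldr e J (gs l') \<in> EG (?S l)" using less[OF l'] foldr_e_EG by blast
  qed
  obtain c where c: "gs l - cscale c (gs (sort l)) \<in> EG (?S l)" using gs_sort[of l] short by blast
  have "gs (sort l) \<in> EG (?S l)"
  proof (cases "\<not> distinct (sort l) \<or> (\<exists>a\<in>set (sort l). a \<ge> n)")
    case True
    then show ?thesis using gs_sorted_degenerate[of "sort l"] short by auto
  next
    case False
    then have d: "distinct l" "set l \<subseteq> {..<n}" by (auto simp: not_le)
    have "gs (sort l) = G (set l)"
      using d by (simp add: G_def sorted_list_of_set_sort_remdups distinct_remdups_id)
    moreover have "set l \<in> ?S l"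
      using d by (simp add: distinct_card distinct_sum_list_conv_Sum)
    ultimately show ?thesis using EG_I[of "set l" "?S l" "[]"] by simp
  qed
  from cvec.subspace_add[OF subspace_EG c cvec.subspace_scale[OF subspace_EG this, of c]]
  show ?case by simp
qed

lemma h0_gs: "h 0 (gs l) = cscale (of_nat (length l) - of_nat n) (gs l)"
proof (induction l)
  case (Cons a l)
  have "h 0 (gs (a # l)) = cscale (of_nat (length l) - of_nat n) (gs (a # l)) + cscale 1 (gs (a # l))"
    by (simp add: h_g Cons clin_scale[OF clin_g])
  then show ?case by (simp add: algebra_simps flip: cvec.scale_left_distrib del: cvec.scale_one)
qed (simp add: h0_w)

lemma e0_power_gs: "(e 0 ^^ Suc n) (gs l) = 0"
proof -
  have "(e 0 ^^ p) (foldr g l v) = foldr g l ((e 0 ^^ p) v)" for p v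
    by (induction p) (simp_all add: e_foldr_g)
  moreover have "foldr g l 0 = 0" by (induction l) (simp_all add: clin_zero[OF clin_g])
  ultimately show ?thesis by (simp only: e_w)
qed

text \<open>Commuting \<open>h (Suc i)\<close> through the product raises one index at a time by
  \<open>Suc i\<close>, and at the end it kills \<open>w\<close>.\<close>

lemma h_gs: "h (Suc i) (gs l) \<in> cvec.span {gs l' | l'. length l' = length l \<and> sum_list l' = sum_list l + Suc i}"
proof (induction l)
  case (Cons a l)
  let ?S = "{gs l' | l'. length l' = length (a # l) \<and> sum_list l' = sum_list (a # l) + Suc i}"
  have "g a (h (Suc i) (gs l)) \<in> cvec.span ?S"
  proof (rule clin_span_image[OF clin_g Cons])
    fix s assume "s \<in> {gs l' | l'. length l' = length l \<and> sum_list l' = sum_list l + Suc i}"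
    then obtain l' where "s = gs l'" "length l' = length l" "sum_list l' = sum_list l + Suc i" by blast
    then show "g a s \<in> cvec.span ?S" by (intro cvec.span_base CollectI exI[of _ "a # l'"]) simp
  qed simp
  moreover have "g (Suc i + a) (gs l) \<in> cvec.span ?S"
    by (intro cvec.span_base CollectI exI[of _ "(Suc i + a) # l"]) simp
  ultimately show ?case by (simp add: h_g cvec.span_add)
qed (simp add: h_w cvec.span_zero)

abbreviation pure :: "nat \<Rightarrow> ('b \<Rightarrow>\<^sub>0 complex) set" where
  "pure d \<equiv> cvec.span {gs l | l. length l < d}"

lemma g_pure: "v \<in> pure d \<Longrightarrow> g a v \<in> pure (Suc d)"
proof (rule clin_span_image[OF clin_g], assumption)
  fix s assume "s \<in> {gs l | l. length l < d}"
  then obtain l where "s = gs l" "length l < d" by blast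
  then show "g a s \<in> pure (Suc d)" by (intro cvec.span_base CollectI exI[of _ "a # l"]) simp
qed simp

lemma pure_mono: "d \<le> d' \<Longrightarrow> pure d \<subseteq> pure d'"
  by (rule cvec.span_mono) auto

text \<open>Against a factor \<open>g\<close>, the operator \<open>k\<close> becomes an
  \<open>h\<close>, which preserves the number of the remaining factors. Hence at least one factor
  is lost.\<close>

lemma k_gs: "k i (gs l) \<in> pure (length l)"
proof (induction l)
  case (Cons a l)
  have "h (Suc (i + a)) (gs l) \<in> pure (Suc (length l))"
    using h_gs[of "i + a" l] by (rule subsetD[OF cvec.span_mono, rotated]) auto
  then show ?case using g_pure[OF Cons] by (simp add: k_g cvec.span_diff)
qed (simp add: k_w cvec.span_zero)

lemma f_gs: "f i (gs l) \<in> pure (length l)"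
proof (induction l)
  case (Cons a l)
  have "k (i + a) (gs l) \<in> pure (Suc (length l))"
    using k_gs[of "i + a" l] pure_mono[of "length l" "Suc (length l)"] by auto
  then show ?case using g_pure[OF Cons] by (simp add: f_g cvec.span_diff)
qed (simp add: f_w cvec.span_zero)

text \<open>
  Increasing size comes first, then decreasing sum. Modulo the span of all \<open>foldr e J (G I')\<close> with
  \<open>I'\<close> of smaller rank, \<open>G I\<close> is a lowest weight vector of weight \<open>card I - n\<close>.
\<close>

definition rank :: "nat set \<Rightarrow> int" where
  "rank I = int (card I) * int (n * n + 1) - int (\<Sum>I)"

text \<open>Subsets of \<open>{..<n}\<close> have sum at most \<open>n * n\<close>, so the weight
  \<open>n * n + 1\<close> on the cardinality lets the size decide before the sum does.\<close>

lemma rank_less: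
  assumes "I \<subseteq> {..<n}" "card I' < card I \<or> card I' = card I \<and> \<Sum>I' > \<Sum>I"
  shows "rank I' < rank I"
  using assms(2)
proof
  assume card: "card I' < card I"
  have "\<Sum>I \<le> card I * n"
    using sum_bounded_above[of I "\<lambda>i. i" n] assms(1) by (auto simp: less_imp_le subset_eq)
  also have "\<dots> \<le> n * n"
    using card_mono[OF _ assms(1)] by simp
  finally have "int (\<Sum>I) < int (n * n + 1)" by linarith
  also have "\<dots> \<le> (int (card I) - int (card I')) * int (n * n + 1)"
    using mult_right_mono[of 1 "int (card I) - int (card I')" "int (n * n + 1)"] card by simp
  finally show ?thesis unfolding rank_def left_diff_distrib by linarith
qed (simp add: rank_def del: of_nat_sum)

text \<open>Lower sets for \<open>rank\<close>. On these \<open>EG S\<close> is stable under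
  \<open>e\<close>, \<open>f\<close> and \<open>h\<close>, and deleting an element of maximal rank
  leaves a lower set.\<close>

definition closed :: "nat set set \<Rightarrow> bool" where
  "closed S \<longleftrightarrow> S \<subseteq> Pow {..<n} \<and> (\<forall>I\<in>S. \<forall>I'\<in>Pow {..<n}. rank I' < rank I \<longrightarrow> I' \<in> S)"

definition below :: "nat set \<Rightarrow> nat set set" where
  "below I = {I' \<in> Pow {..<n}. rank I' < rank I}"

lemma pure_subset_EG:
  assumes "I \<subseteq> {..<n}"
  shows "pure (card I) \<subseteq> EG (below I)"
proof (rule cvec.span_minimal[OF _ subspace_EG], clarify)
  fix l :: "nat list" assume "length l < card I"
  then have "EG {I' \<in> Pow {..<n}. card I' < length l \<or> card I' = length l \<and> \<Sum>I' = sum_list l} \<subseteq> EG (below I)"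
    using assms by (intro EG_mono) (auto simp: below_def intro!: rank_less)
  then show "gs l \<in> EG (below I)" using gs_in_EG by blast
qed

lemma h_G:
  assumes I: "I \<subseteq> {..<n}"
  shows "h (Suc i) (G I) \<in> EG (below I)"
proof -
  have fin: "finite I" using I finite_subset by blast
  have "cvec.span {gs l' | l'. length l' = card I \<and> sum_list l' = \<Sum>I + Suc i} \<subseteq> EG (below I)"
  proof (rule cvec.span_minimal[OF _ subspace_EG], clarify)
    fix l :: "nat list" assume "length l = card I" "sum_list l = \<Sum>I + Suc i"
    then have "EG {I' \<in> Pow {..<n}. card I' < length l \<or> card I' = length l \<and> \<Sum>I' = sum_list l} \<subseteq> EG (below I)"
      using I by (intro EG_mono) (auto simp: below_def intro!: rank_less)
    then show "gs l \<in> EG (below I)" using gs_in_EG by blast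
  qed
  moreover have "sum_list (sorted_list_of_set I) = \<Sum>I"
    using fin by (metis distinct_sorted_list_of_set distinct_sum_list_conv_Sum set_sorted_list_of_set)
  ultimately show ?thesis using h_gs[of i "sorted_list_of_set I"] fin by (auto simp: G_def)
qed

lemma f_G:
  assumes I: "I \<subseteq> {..<n}"
  shows "f i (G I) \<in> EG (below I)"
  using f_gs[of i "sorted_list_of_set I"] pure_subset_EG[OF I] I
  by (auto simp: G_def finite_subset)

lemma h0_G:
  assumes "I \<subseteq> {..<n}"
  shows "h 0 (G I) = cscale (- of_nat (n - card I)) (G I)"
proof -
  have "card I \<le> n" using card_mono[OF _ assms] by simp
  then show ?thesis by (simp add: G_def h0_gs of_nat_diff)
qed

text \<open>Moving \<open>h i\<close> past the \<open>e\<close> factors only creates further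
  \<open>e\<close> words. On \<open>G I\<close> it is a scalar for \<open>i = 0\<close> and
  otherwise drops to smaller rank, which stays inside a closed \<open>S\<close>.\<close>

lemma h_EG:
  assumes "closed S" "v \<in> EG S"
  shows "h i v \<in> EG S"
proof (rule EG_image[OF clin_h _ subspace_EG assms(2)])
  fix J I assume I: "I \<in> S"
  then have I': "I \<subseteq> {..<n}" and sub: "EG (below I) \<subseteq> EG S"
    using assms(1) by (auto simp: closed_def below_def intro!: EG_mono)
  show "h i (foldr e J (G I)) \<in> EG S"
  proof (induction J)
    case Nil
    show ?case
      using h_G[OF I'] sub EG_I[OF I, of "[]"]
      by (cases i) (auto simp: h0_G[OF I'] cvec.subspace_scale subspace_EG simp del: cvec.scale_minus_left)
  next
    case (Cons j J)
    then show ?case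
      using EG_I[OF I, of "(i + j) # J"]
      by (simp add: h_e e_EG cvec.subspace_add cvec.subspace_scale subspace_EG)
  qed
qed

lemma f_EG:
  assumes "closed S" "v \<in> EG S"
  shows "f i v \<in> EG S"
proof (rule EG_image[OF clin_f _ subspace_EG assms(2)])
  fix J I assume I: "I \<in> S"
  then have I': "I \<subseteq> {..<n}" and sub: "EG (below I) \<subseteq> EG S"
    using assms(1) by (auto simp: closed_def below_def intro!: EG_mono)
  show "f i (foldr e J (G I)) \<in> EG S"
  proof (induction J)
    case Nil
    show ?case using f_G[OF I'] sub by auto
  next
    case (Cons j J)
    then show ?case
      using h_EG[OF assms(1) EG_I[OF I]]
      by (simp add: f_e e_EG cvec.subspace_diff subspace_EG)
  qed
qed

lemma EG_dim:
  assumes "closed S"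
  shows "\<exists>B. finite B \<and> card B \<le> (\<Sum>I\<in>S. 2 ^ (n - card I)) \<and> EG S \<subseteq> cvec.span B"
  using assms
proof (induction "card S" arbitrary: S)
  case 0
  then have "S = {}" by (auto simp: closed_def finite_subset)
  then have "EG S = {0}" by (simp add: EG_def)
  then show ?case by (intro exI[of _ "{}"]) auto
next
  case (Suc d)
  have fin: "finite S" and ne: "S \<noteq> {}" using Suc.hyps(2) by (auto intro: card_ge_0_finite)
  then have "Max (rank ` S) \<in> rank ` S" by (intro Max_in) auto
  then obtain I where "I \<in> S" and max: "Max (rank ` S) = rank I" by auto
  then have I: "I \<in> S" "\<And>I'. I' \<in> S \<Longrightarrow> rank I' \<le> rank I"
    using fin by (auto simp flip: max)
  let ?S = "S - {I}"
  have I': "I \<subseteq> {..<n}" using I Suc.prems by (auto simp: closed_def)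
  have S': "closed ?S" using Suc.prems I(2) by (force simp: closed_def)
  obtain B where B: "finite B" "card B \<le> (\<Sum>I\<in>?S. 2 ^ (n - card I))" "EG ?S \<subseteq> cvec.span B"
  proof -
    have "d = card ?S" using Suc.hyps(2) I(1) fin by simp
    from Suc.hyps(1)[OF this S'] show thesis using that by blast
  qed
  have sub: "EG (below I) \<subseteq> EG ?S"
    using I(1) Suc.prems by (intro EG_mono) (auto simp: below_def closed_def)
  have "\<exists>B. finite B \<and> card B \<le> 2 ^ (n - card I) \<and> (\<forall>J. foldr e J (G I) \<in> cvec.span (B \<union> EG ?S))"
  \<comment> \<open>The exponent \<open>n + 1\<close> is inherited from \<open>w\<close> because
    \<open>e\<close> commutes with every \<open>g\<close>. It may exceed what the weight of
    \<open>G I\<close> allows; \<open>dim_bound_mod\<close> sharpens it.\<close>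
  proof (rule dim_bound_mod[where N = "Suc n"])
    show "(e 0 ^^ Suc n) (G I) \<in> EG ?S"
      by (simp only: G_def e0_power_gs cvec.subspace_0 subspace_EG)
  qed (use h_G[OF I'] f_G[OF I'] sub S' in \<open>auto simp: h0_G[OF I'] subspace_EG e_EG h_EG f_EG\<close>)
  then obtain C where C: "finite C" "card C \<le> 2 ^ (n - card I)"
    "\<And>J. foldr e J (G I) \<in> cvec.span (C \<union> EG ?S)" by blast
  have "C \<union> EG ?S \<subseteq> cvec.span (B \<union> C)"
    using B(3) cvec.span_mono[of B "B \<union> C"] by (auto intro: cvec.span_base)
  then have CS: "cvec.span (C \<union> EG ?S) \<subseteq> cvec.span (B \<union> C)" by (rule cvec.span_minimal) simp
  have "EG S \<subseteq> cvec.span (B \<union> C)"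
  proof (rule EG_subset)
    fix J I'' assume I'': "I'' \<in> S"
    show "foldr e J (G I'') \<in> cvec.span (B \<union> C)"
    proof (cases "I'' = I")
      case True
      then show ?thesis using C(3) CS by auto
    next
      case False
      then have "foldr e J (G I'') \<in> EG ?S" using I'' by (intro EG_I) auto
      then show ?thesis using B(3) cvec.span_mono[of B "B \<union> C"] by auto
    qed
  qed simp
  moreover have "card (B \<union> C) \<le> (\<Sum>I\<in>S. 2 ^ (n - card I))"
    using card_Un_le[of B C] B(2) C(2) sum.remove[OF fin I(1), of "\<lambda>I. 2 ^ (n - card I) :: nat"] by linarith
  ultimately show ?case using B(1) C(1) by (intro exI[of _ "B \<union> C"]) auto
qed

lemma closed_Pow: "closed (Pow {..<n})"
  by (simp add: closed_def)

lemma gs_in_EG_Pow: "gs l \<in> EG (Pow {..<n})"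
  using gs_in_EG EG_mono[of "{I \<in> Pow {..<n}. card I < length l \<or> card I = length l \<and> \<Sum>I = sum_list l}" "Pow {..<n}"]
  by blast

lemma g_EG: "v \<in> EG (Pow {..<n}) \<Longrightarrow> g i v \<in> EG (Pow {..<n})"
proof (erule EG_image[OF clin_g _ subspace_EG, rotated])
  fix J I
  have "g i (foldr e J (G I)) = foldr e J (gs (i # sorted_list_of_set I))"
    by (simp add: G_def foldr_e_g)
  then show "g i (foldr e J (G I)) \<in> EG (Pow {..<n})"
    using foldr_e_EG[OF gs_in_EG_Pow] by metis
qed

lemma k_EG: "v \<in> EG (Pow {..<n}) \<Longrightarrow> k i v \<in> EG (Pow {..<n})"
proof (erule EG_image[OF clin_k _ subspace_EG, rotated])
  fix J I assume I: "I \<in> Pow {..<n}"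
  show "k i (foldr e J (G I)) \<in> EG (Pow {..<n})"
  proof (induction J)
    case Nil
    have "pure (card I) \<subseteq> EG (Pow {..<n})"
      by (rule cvec.span_minimal[OF _ subspace_EG]) (use gs_in_EG_Pow in auto)
    then show ?case using k_gs[of i "sorted_list_of_set I"] I by (auto simp: G_def finite_subset)
  next
    case (Cons j J)
    then show ?case
      using g_EG[OF EG_I[OF I]] by (simp add: k_e e_EG cvec.subspace_add subspace_EG)
  qed
qed

text \<open>The ambient type may be larger than the module generated by \<open>w\<close>.
  \<open>Z\<close> is stable and contains \<open>w\<close>, hence contains that module.\<close>

theorem osp_dim_bound:
  obtains B Z where "finite B" "card B \<le> 3 ^ n" "Z \<subseteq> cvec.span B" "cvec.subspace Z" "w \<in> Z"
    "\<And>i v. v \<in> Z \<Longrightarrow> e i v \<in> Z" "\<And>i v. v \<in> Z \<Longrightarrow> f i v \<in> Z" "\<And>i v. v \<in> Z \<Longrightarrow> h i v \<in> Z"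
    "\<And>i v. v \<in> Z \<Longrightarrow> g i v \<in> Z" "\<And>i v. v \<in> Z \<Longrightarrow> k i v \<in> Z"
proof -
  obtain B where "finite B" "card B \<le> (\<Sum>I\<in>Pow {..<n}. 2 ^ (n - card I))" "EG (Pow {..<n}) \<subseteq> cvec.span B"
    using EG_dim[OF closed_Pow] by blast
  then show thesis
    using that[of B "EG (Pow {..<n})"] gs_in_EG_Pow[of "[]"] sum_Pow_power[of "{..<n}"]
    by (simp add: subspace_EG e_EG f_EG[OF closed_Pow] h_EG[OF closed_Pow] g_EG k_EG)
qed

end

section \<open>Tensor products of evaluation modules\<close>

lemma lin_ext_lin_ext: "lin_ext \<phi> (lin_ext \<psi> p) = lin_ext (\<lambda>a. lin_ext \<phi> (\<psi> a)) p"
proof -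
  have "lin_ext \<phi> (\<Sum>a\<in>A. F a) = (\<Sum>a\<in>A. lin_ext \<phi> (F a))" for A :: "'c set" and F
    by (rule clin_sum[OF clin_lin_ext])
  then show ?thesis by (simp add: lin_ext_def[of \<psi>] lin_ext_def[of "\<lambda>a. lin_ext \<phi> (\<psi> a)"] lin_ext_cscale)
qed

lemma clin_apply_lin_ext: "clin T \<Longrightarrow> T (lin_ext \<phi> p) = lin_ext (\<lambda>a. T (\<phi> a)) p"
  by (simp add: lin_ext_def clin_sum clin_scale)

lemma lin_ext_add_fun: "lin_ext (\<lambda>a. \<phi> a + \<psi> a) p = lin_ext \<phi> p + lin_ext \<psi> p"
  by (simp add: lin_ext_def cvec.scale_right_distrib sum.distrib)

lemma lin_ext_cscale_fun: "lin_ext (\<lambda>a. cscale c (\<phi> a)) p = cscale c (lin_ext \<phi> p)"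
  by (simp add: lin_ext_def cvec.scale_sum_right mult.commute)

lemma lin_ext_diff_fun: "lin_ext (\<lambda>a. \<phi> a - \<psi> a) p = lin_ext \<phi> p - lin_ext \<psi> p"
  by (simp add: lin_ext_def cvec.scale_right_diff_distrib sum_subtractf)

lemma lin_ext_zero_fun: "lin_ext (\<lambda>a. 0) p = 0"
  by (simp add: lin_ext_def)

lemma lin_ext_cong: "(\<And>a. a \<in> Poly_Mapping.keys p \<Longrightarrow> \<phi> a = \<psi> a) \<Longrightarrow> lin_ext \<phi> p = lin_ext \<psi> p"
  by (simp add: lin_ext_def)

lemma lin_ext_swap: "lin_ext (\<lambda>a. lin_ext (\<lambda>b. F a b) q) p = lin_ext (\<lambda>b. lin_ext (\<lambda>a. F a b) p) q"
  unfolding lin_ext_def cvec.scale_sum_right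
  by (subst sum.swap) (simp add: mult.commute)

lemma lin_ext_bas: "lin_ext bas p = p"
proof (rule poly_mapping_eqI)
  fix b
  have "Poly_Mapping.lookup (lin_ext bas p) b
    = (\<Sum>a\<in>Poly_Mapping.keys p. if a = b then Poly_Mapping.lookup p b else 0)"
    by (auto simp: lin_ext_def lookup_sum lookup_single when_def intro!: sum.cong)
  then show "Poly_Mapping.lookup (lin_ext bas p) b = Poly_Mapping.lookup p b"
    by (simp add: in_keys_iff)
qed

lemma lin_ext_mem:
  "cvec.subspace S \<Longrightarrow> (\<And>a. a \<in> Poly_Mapping.keys p \<Longrightarrow> \<phi> a \<in> S) \<Longrightarrow> lin_ext \<phi> p \<in> S"
  unfolding lin_ext_def by (intro cvec.subspace_sum cvec.subspace_scale)

lemma subspace_keys: "cvec.subspace {p :: 'b \<Rightarrow>\<^sub>0 complex. Poly_Mapping.keys p \<subseteq> K}"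
proof (rule cvec.subspaceI)
  fix p q :: "'b \<Rightarrow>\<^sub>0 complex" and c
  assume "p \<in> {p. Poly_Mapping.keys p \<subseteq> K}"
  then show "cscale c p \<in> {p. Poly_Mapping.keys p \<subseteq> K}" by (auto simp: in_keys_iff)
  assume "q \<in> {p. Poly_Mapping.keys p \<subseteq> K}"
  then show "p + q \<in> {p. Poly_Mapping.keys p \<subseteq> K}" using \<open>p \<in> _\<close> keys_add[of p q] by auto
qed simp

lemma keys_subset_eq_span: "{p :: 'b \<Rightarrow>\<^sub>0 complex. Poly_Mapping.keys p \<subseteq> K} = cvec.span (bas ` K)"
proof
  show "{p. Poly_Mapping.keys p \<subseteq> K} \<subseteq> cvec.span (bas ` K)"
  proof clarify
    fix p :: "'b \<Rightarrow>\<^sub>0 complex" assume "Poly_Mapping.keys p \<subseteq> K"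
    then have "lin_ext bas p \<in> cvec.span (bas ` K)"
      by (intro lin_ext_mem) (auto intro: cvec.span_base)
    then show "p \<in> cvec.span (bas ` K)" by (simp add: lin_ext_bas)
  qed
  show "cvec.span (bas ` K) \<subseteq> {p. Poly_Mapping.keys p \<subseteq> K}"
    by (rule cvec.span_minimal[OF _ subspace_keys]) auto
qed

lemma keys_lin_ext: "Poly_Mapping.keys (lin_ext \<phi> p) \<subseteq> (\<Union>a\<in>Poly_Mapping.keys p. Poly_Mapping.keys (\<phi> a))"
proof -
  have "lin_ext \<phi> p \<in> {q. Poly_Mapping.keys q \<subseteq> (\<Union>a\<in>Poly_Mapping.keys p. Poly_Mapping.keys (\<phi> a))}"
    by (rule lin_ext_mem[OF subspace_keys]) auto
  then show ?thesis by simp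
qed

section \<open>The signed Leibniz rule on tensor words\<close>

definition tens :: "('a \<Rightarrow>\<^sub>0 complex) \<Rightarrow> ('a list \<Rightarrow>\<^sub>0 complex) \<Rightarrow> ('a list \<Rightarrow>\<^sub>0 complex)" where
  "tens p q = lin_ext (\<lambda>c. lin_ext (\<lambda>cs. bas (c # cs)) q) p"

lemma tens_bas_right: "tens p (bas bs) = lin_ext (\<lambda>c. bas (c # bs)) p"
  and tens_bas_left: "tens (bas b) q = lin_ext (\<lambda>cs. bas (b # cs)) q"
  by (simp_all add: tens_def)

lemma clin_tens: "clin (tens p)"
  unfolding tens_def[abs_def] by (subst lin_ext_swap) (rule clin_lin_ext)

lemma clin_tens_left: "clin (\<lambda>p. tens p q)"
  unfolding tens_def[abs_def] by (rule clin_lin_ext)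

lemma keys_tens: "Poly_Mapping.keys (tens p q) \<subseteq> {c # cs | c cs. c \<in> Poly_Mapping.keys p \<and> cs \<in> Poly_Mapping.keys q}"
  unfolding tens_def using keys_lin_ext[of _ p] keys_lin_ext[of "\<lambda>cs. bas (_ # cs)" q] by fastforce

lemma eval_tensor_act_Cons:
  "eval_tensor_act (z # zs) (y, k) (b # bs) = cscale (z ^ k) (tens (V_act y b) (bas bs))
     + cscale (koszul (osp_odd y) (V_odd b)) (tens (bas b) (eval_tensor_act zs (y, k) bs))"
  by (simp add: tens_bas_right tens_bas_left lin_ext_cscale)

lemma V_odd_act: "c \<in> Poly_Mapping.keys (V_act y b) \<Longrightarrow> V_odd c = (osp_odd y \<noteq> V_odd b)"
  by (cases y; cases b) (auto split: if_splits)

lemma osp_odd_bracket: "u \<in> Poly_Mapping.keys (osp_bracket x y) \<Longrightarrow> osp_odd u = (osp_odd x \<noteq> osp_odd y)"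
  by (cases x; cases y) (auto simp: in_keys_iff lookup_single when_def split: if_splits)

text \<open>The sign depends on the parity of the first factor, so \<open>p\<close> has to be
  homogeneous for a single sign to appear.\<close>

lemma eval_tensor_act_tens:
  assumes "\<And>c. c \<in> Poly_Mapping.keys p \<Longrightarrow> V_odd c = par"
  shows "lin_ext (eval_tensor_act (z # zs) (y, k)) (tens p q)
    = cscale (z ^ k) (tens (lin_ext (V_act y) p) q)
    + cscale (koszul (osp_odd y) par) (tens p (lin_ext (eval_tensor_act zs (y, k)) q))"
proof -
  let ?A = "eval_tensor_act zs (y, k)"
  have 1: "lin_ext (eval_tensor_act (z # zs) (y, k)) (tens (bas c) q)
    = cscale (z ^ k) (tens (V_act y c) q) + cscale (koszul (osp_odd y) (V_odd c)) (tens (bas c) (lin_ext ?A q))" for c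
  proof -
    have "lin_ext (eval_tensor_act (z # zs) (y, k)) (tens (bas c) q)
      = lin_ext (\<lambda>cs. cscale (z ^ k) (tens (V_act y c) (bas cs))
          + cscale (koszul (osp_odd y) (V_odd c)) (tens (bas c) (?A cs))) q"
      by (simp add: tens_bas_left lin_ext_lin_ext eval_tensor_act_Cons del: eval_tensor_act.simps)
    then show ?thesis
      by (simp add: lin_ext_add_fun lin_ext_cscale_fun lin_ext_bas flip: clin_apply_lin_ext[OF clin_tens])
  qed
  have bas: "tens p q = lin_ext (\<lambda>c. tens (bas c) q) p" for p :: "V_basis \<Rightarrow>\<^sub>0 complex" and q
    by (simp add: lin_ext_bas flip: clin_apply_lin_ext[OF clin_tens_left])
  have "lin_ext (eval_tensor_act (z # zs) (y, k)) (tens p q)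
    = lin_ext (\<lambda>c. cscale (z ^ k) (tens (V_act y c) q) + cscale (koszul (osp_odd y) par) (tens (bas c) (lin_ext ?A q))) p"
    by (subst bas) (simp add: lin_ext_lin_ext 1 assms cong: lin_ext_cong)
  also have "\<dots> = cscale (z ^ k) (lin_ext (\<lambda>c. tens (V_act y c) q) p)
      + cscale (koszul (osp_odd y) par) (tens p (lin_ext ?A q))"
    by (simp add: lin_ext_add_fun lin_ext_cscale_fun flip: bas)
  also have "lin_ext (\<lambda>c. tens (V_act y c) q) p = tens (lin_ext (V_act y) p) q"
    by (simp add: clin_apply_lin_ext[OF clin_tens_left])
  finally show ?thesis .
qed

text \<open>Terms with both elements on the first factor are \<open>V_act_bracket\<close>, those
  with both on the rest are the induction hypothesis. The mixed terms cancel by the Koszul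
  signs.\<close>

lemma eval_tensor_act_bracket:
  "lin_ext (\<lambda>u. eval_tensor_act zs (u, i + j) bs) (osp_bracket x y)
     = lin_ext (eval_tensor_act zs (x, i)) (eval_tensor_act zs (y, j) bs)
     - cscale (koszul (osp_odd x) (osp_odd y)) (lin_ext (eval_tensor_act zs (y, j)) (eval_tensor_act zs (x, i) bs))"
proof (induction zs arbitrary: bs)
  case Nil
  show ?case by (simp add: lin_ext_zero_fun)
next
  case (Cons z zs)
  show ?case
  proof (cases bs)
    case Nil
    then show ?thesis by (simp add: lin_ext_zero_fun)
  next
    case (Cons b cs)
    let ?x = "osp_odd x" and ?y = "osp_odd y" and ?b = "V_odd b"
    let ?A = "\<lambda>g. eval_tensor_act zs g" and ?B = "\<lambda>g. eval_tensor_act (z # zs) g"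
    let ?t = "\<lambda>v. tens v (bas cs)" and ?r = "\<lambda>q. tens (bas b) q"
    have AA: "lin_ext (?B (x, i)) (?B (y, j) bs)
      = cscale (z ^ j) (cscale (z ^ i) (?t (lin_ext (V_act x) (V_act y b)))
          + cscale (koszul (osp_odd x) (osp_odd y \<noteq> ?b)) (tens (V_act y b) (?A (x, i) cs)))
      + cscale (koszul (osp_odd y) ?b) (cscale (z ^ i) (tens (V_act x b) (?A (y, j) cs))
          + cscale (koszul (osp_odd x) ?b) (?r (lin_ext (?A (x, i)) (?A (y, j) cs))))" for x y i j
      unfolding Cons eval_tensor_act_Cons lin_ext_add lin_ext_cscale
      by (subst eval_tensor_act_tens[where par = "osp_odd y \<noteq> ?b"], simp add: V_odd_act,
          subst eval_tensor_act_tens[where par = ?b], simp) simp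
    have "lin_ext (\<lambda>u. ?B (u, i + j) bs) (osp_bracket x y)
      = lin_ext (\<lambda>u. cscale (z ^ (i + j)) (?t (V_act u b)) + cscale (koszul (?x \<noteq> ?y) ?b) (?r (?A (u, i + j) cs))) (osp_bracket x y)"
      unfolding Cons eval_tensor_act_Cons by (rule lin_ext_cong) (simp add: osp_odd_bracket)
    also have "\<dots> = cscale (z ^ (i + j)) (?t (lin_ext (\<lambda>u. V_act u b) (osp_bracket x y)))
      + cscale (koszul (?x \<noteq> ?y) ?b) (?r (lin_ext (\<lambda>u. ?A (u, i + j) cs) (osp_bracket x y)))"
      by (simp add: lin_ext_add_fun lin_ext_cscale_fun clin_apply_lin_ext[OF clin_tens_left]
          clin_apply_lin_ext[OF clin_tens])
    also have "\<dots> = lin_ext (?B (x, i)) (?B (y, j) bs)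
      - cscale (koszul ?x ?y) (lin_ext (?B (y, j)) (?B (x, i) bs))"
      unfolding AA V_act_bracket Cons.IH clin_diff[OF clin_tens] clin_diff[OF clin_tens_left]
        clin_scale[OF clin_tens] clin_scale[OF clin_tens_left]
      by (rule poly_mapping_eqI, cases ?x; cases ?y; cases ?b)
        (simp_all add: koszul_def lookup_add lookup_minus power_add algebra_simps)
    finally show ?thesis .
  qed
qed

lemma eval_tensor_bracket:
  "lin_ext (\<lambda>u. lin_ext (eval_tensor_act zs (u, i + j)) p) (osp_bracket x y)
     = lin_ext (eval_tensor_act zs (x, i)) (lin_ext (eval_tensor_act zs (y, j)) p)
     - cscale (koszul (osp_odd x) (osp_odd y))
         (lin_ext (eval_tensor_act zs (y, j)) (lin_ext (eval_tensor_act zs (x, i)) p))"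
  unfolding lin_ext_lin_ext
  by (subst lin_ext_swap) (simp add: eval_tensor_act_bracket lin_ext_diff_fun lin_ext_cscale_fun)

section \<open>Weights and the nilpotency of e and f\<close>

fun V_weight :: "V_basis \<Rightarrow> int" where
  "V_weight V_m = -1" | "V_weight V_0 = 0" | "V_weight V_p = 1"

fun osp_weight :: "osp_basis \<Rightarrow> int" where
  "osp_weight osp_e = 2" | "osp_weight osp_h = 0" | "osp_weight osp_f = -2"
| "osp_weight osp_gp = 1" | "osp_weight osp_gm = -1"

definition word_weight :: "V_basis list \<Rightarrow> int" where
  "word_weight bs = sum_list (map V_weight bs)"

lemma word_weight_bound: "\<bar>word_weight bs\<bar> \<le> int (length bs)"
proof (induction bs)
  case (Cons b bs)
  then show ?case by (cases b) (simp_all add: word_weight_def)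
qed (simp add: word_weight_def)

lemma V_weight_act: "c \<in> Poly_Mapping.keys (V_act y b) \<Longrightarrow> V_weight c = V_weight b + osp_weight y"
  by (cases y; cases b) (auto split: if_splits)

lemma keys_eval_tensor_act:
  "Poly_Mapping.keys (eval_tensor_act zs (y, k) bs) \<subseteq> {cs. length cs = length bs
     \<and> word_weight cs = word_weight bs + osp_weight y
     \<and> odd (length (filter V_odd cs)) = (osp_odd y \<noteq> odd (length (filter V_odd bs)))}"
proof (induction zs arbitrary: bs)
  case (Cons z zs)
  show ?case
  proof (cases bs)
    case (Cons b bs')
    let ?K = "{cs. length cs = length bs \<and> word_weight cs = word_weight bs + osp_weight y
     \<and> odd (length (filter V_odd cs)) = (osp_odd y \<noteq> odd (length (filter V_odd bs)))}"
    have "Poly_Mapping.keys (tens (V_act y b) (bas bs')) \<subseteq> ?K"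
    proof
      fix cs assume "cs \<in> Poly_Mapping.keys (tens (V_act y b) (bas bs'))"
      then obtain c where c: "c \<in> Poly_Mapping.keys (V_act y b)" "cs = c # bs'"
        using keys_tens[of "V_act y b" "bas bs'"] by auto
      then show "cs \<in> ?K"
        using V_odd_act[OF c(1)] V_weight_act[OF c(1)] by (auto simp: Cons word_weight_def)
    qed
    moreover have "Poly_Mapping.keys (tens (bas b) (eval_tensor_act zs (y, k) bs')) \<subseteq> ?K"
    proof
      fix cs assume "cs \<in> Poly_Mapping.keys (tens (bas b) (eval_tensor_act zs (y, k) bs'))"
      then obtain cs' where c: "cs' \<in> Poly_Mapping.keys (eval_tensor_act zs (y, k) bs')" "cs = b # cs'"
        using keys_tens[of "bas b" "eval_tensor_act zs (y, k) bs'"] by auto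
      then show "cs \<in> ?K"
        using subsetD[OF Cons.IH c(1)] by (auto simp: Cons word_weight_def)
    qed
    ultimately have "eval_tensor_act (z # zs) (y, k) bs \<in> {p. Poly_Mapping.keys p \<subseteq> ?K}"
      unfolding Cons eval_tensor_act_Cons
      by (intro cvec.subspace_add cvec.subspace_scale subspace_keys) (simp_all add: Cons)
    then show ?thesis by simp
  qed simp
qed simp

text \<open>Words of length \<open>n\<close> have weights between -n and n, while each application
  moves the weight by 2 in a fixed direction; \<open>n + 1\<close> applications leave this
  range.\<close>

lemma eval_tensor_nilpotent:
  assumes p: "Poly_Mapping.keys p \<subseteq> {bs. length bs = n}" and y: "y \<in> {osp_e, osp_f}"
  shows "(lin_ext (eval_tensor_act zs (y, 0)) ^^ Suc n) p = 0"
proof -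
  let ?T = "lin_ext (eval_tensor_act zs (y, 0))"
  have "Poly_Mapping.keys ((?T ^^ m) p) \<subseteq> {cs. length cs = n \<and> (\<exists>bs. length bs = n
      \<and> word_weight cs = word_weight bs + int m * osp_weight y)}" for m
  proof (induction m)
    case 0
    then show ?case using p by auto
  next
    case (Suc m)
    have "(?T ^^ Suc m) p = ?T ((?T ^^ m) p)" by simp
    then have "Poly_Mapping.keys ((?T ^^ Suc m) p) \<subseteq> (\<Union>bs\<in>Poly_Mapping.keys ((?T ^^ m) p).
        Poly_Mapping.keys (eval_tensor_act zs (y, 0) bs))"
      using keys_lin_ext by metis
    also have "\<dots> \<subseteq> {cs. length cs = n \<and> (\<exists>bs. length bs = n
      \<and> word_weight cs = word_weight bs + int (Suc m) * osp_weight y)}"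
    proof clarify
      fix cs' cs assume "cs' \<in> Poly_Mapping.keys ((?T ^^ m) p)" "cs \<in> Poly_Mapping.keys (eval_tensor_act zs (y, 0) cs')"
      moreover from this(1) Suc obtain bs where "length cs' = n" "length bs = n" "word_weight cs' = word_weight bs + int m * osp_weight y"
        by blast
      ultimately show "length cs = n \<and> (\<exists>bs. length bs = n
          \<and> word_weight cs = word_weight bs + int (Suc m) * osp_weight y)"
        using keys_eval_tensor_act[of zs y 0 cs'] by (intro conjI exI[of _ bs]) (auto simp: algebra_simps)
    qed
    finally show ?case .
  qed
  moreover have False if "length cs = n" "length bs = n" "word_weight cs = word_weight bs + int (Suc n) * osp_weight y" for cs bs
    using word_weight_bound[of cs] word_weight_bound[of bs] that y by auto
  ultimately have "Poly_Mapping.keys ((?T ^^ Suc n) p) = {}" by blast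
  then show ?thesis by simp
qed

text \<open>The action on the tensor factor with index \<open>j\<close> alone, including the sign
  for passing the earlier factors.\<close>

fun site_act :: "nat \<Rightarrow> osp_basis \<Rightarrow> V_basis list \<Rightarrow> (V_basis list \<Rightarrow>\<^sub>0 complex)" where
  "site_act 0 y (b # bs) = tens (V_act y b) (bas bs)"
| "site_act (Suc j) y (b # bs) = cscale (koszul (osp_odd y) (V_odd b)) (tens (bas b) (site_act j y bs))"
| "site_act _ _ [] = 0"

lemma eval_tensor_act_eq_sum_site_act:
  "length bs = length zs \<Longrightarrow> eval_tensor_act zs (y, k) bs = (\<Sum>j<length zs. cscale ((zs ! j) ^ k) (site_act j y bs))"
proof (induction zs arbitrary: bs)
  case (Cons z zs)
  then obtain b cs where bs: "bs = b # cs" "length cs = length zs" by (cases bs) auto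
  show ?case
    unfolding bs eval_tensor_act_Cons Cons.IH[OF bs(2)] length_Cons sum.lessThan_Suc_shift
    by (simp add: clin_sum[OF clin_tens] clin_scale[OF clin_tens] cvec.scale_sum_right mult.commute)
qed simp

text \<open>The scalar is the product of the Koszul signs of the earlier factors; being nonzero, it
  can be divided out.\<close>

lemma site_act_append:
  "\<exists>c. c \<noteq> 0 \<and> site_act (length xs) y (xs @ b # ys) = cscale c (lin_ext (\<lambda>a. bas (xs @ a # ys)) (V_act y b))"
proof (induction xs)
  case Nil
  show ?case by (rule exI[of _ 1]) (simp add: tens_bas_right)
next
  case (Cons x xs)
  then obtain c where "c \<noteq> 0" "site_act (length xs) y (xs @ b # ys) = cscale c (lin_ext (\<lambda>a. bas (xs @ a # ys)) (V_act y b))"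
    by blast
  then show ?case
    by (intro exI[of _ "koszul (osp_odd y) (V_odd x) * c"])
      (auto simp: clin_scale[OF clin_tens] tens_bas_left lin_ext_lin_ext koszul_def)
qed

text \<open>Elimination: from the combination with exponent \<open>i + 1\<close> subtract
  \<open>x a\<close> times the one with exponent \<open>i\<close>. The index \<open>a\<close>
  disappears, and the other vectors are scaled by the nonzero \<open>x j - x a\<close>.\<close>

lemma vandermonde_mem:
  assumes S: "cvec.subspace S" and "finite J" "inj_on x J"
    and "\<And>i. (\<Sum>j\<in>J. cscale (x j ^ i) (v j)) \<in> S"
  shows "\<forall>j\<in>J. v j \<in> S"
  using assms(2-)
proof (induction J arbitrary: v rule: finite_induct)
  case (insert a J)
  have "\<forall>j\<in>J. cscale (x j - x a) (v j) \<in> S"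
  proof (rule insert.IH)
    show "inj_on x J" using insert.prems(1) by (simp add: inj_on_def)
    fix i
    have "(\<Sum>j\<in>insert a J. cscale (x j ^ Suc i) (v j)) - cscale (x a) (\<Sum>j\<in>insert a J. cscale (x j ^ i) (v j)) \<in> S"
      by (intro cvec.subspace_diff[OF S] cvec.subspace_scale[OF S] insert.prems(2))
    also have "(\<Sum>j\<in>insert a J. cscale (x j ^ Suc i) (v j)) - cscale (x a) (\<Sum>j\<in>insert a J. cscale (x j ^ i) (v j))
      = (\<Sum>j\<in>J. cscale (x j ^ i) (cscale (x j - x a) (v j)))"
      using insert.hyps by (simp add: cvec.scale_right_distrib cvec.scale_sum_right algebra_simps flip: sum_subtractf)
    finally show "(\<Sum>j\<in>J. cscale (x j ^ i) (cscale (x j - x a) (v j))) \<in> S" .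
  qed
  moreover have "x j - x a \<noteq> 0" if "j \<in> J" for j using insert.prems(1) insert.hyps that by (auto simp: inj_on_def)
  ultimately have J: "\<forall>j\<in>J. v j \<in> S" using subspace_unscale[OF S] by blast
  have "v a = (\<Sum>j\<in>insert a J. cscale (x j ^ 0) (v j)) - (\<Sum>j\<in>J. v j)" using insert.hyps by simp
  also have "\<dots> \<in> S" by (intro cvec.subspace_diff[OF S] cvec.subspace_sum[OF S] insert.prems(2)) (use J in auto)
  finally show ?case using J by simp
qed simp

lemma eval_tensor_generated:
  fixes zs :: "complex list"
  assumes distinct: "\<And>i j. i < length zs \<Longrightarrow> j < length zs \<Longrightarrow> i \<noteq> j \<Longrightarrow> (zs ! i)\<^sup>2 \<noteq> (zs ! j)\<^sup>2"
    and nz: "\<And>i. i < length zs \<Longrightarrow> zs ! i \<noteq> 0"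
    and S: "cvec.subspace S" "lowest_tensor (length zs) \<in> S"
    and act: "\<And>g v. g \<in> twisted_basis \<Longrightarrow> v \<in> S \<Longrightarrow> lin_ext (eval_tensor_act zs g) v \<in> S"
    and "length bs = length zs"
  shows "bas bs \<in> S"
proof -
  have site: "site_act j y bs \<in> S" if bs: "bas bs \<in> S" "length bs = length zs" and j: "j < length zs" for y bs j
  proof -
    \<comment> \<open>In the twisted algebra \<open>y\<close> occurs with the exponents
      \<open>2 * i + ?o\<close>. So the Vandermonde nodes are the squares of the points, and for odd
      \<open>y\<close> a factor \<open>zs ! j\<close> remains, which \<open>nz\<close> allows to
      cancel.\<close>
    let ?o = "if osp_odd y then 1 else 0 :: nat"
    have "\<forall>j\<in>{..<length zs}. cscale ((zs ! j) ^ ?o) (site_act j y bs) \<in> S"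
    proof (rule vandermonde_mem[OF S(1)])
      show "inj_on (\<lambda>j. (zs ! j)\<^sup>2) {..<length zs}" using distinct by (auto simp: inj_on_def)
      fix i
      have "(y, 2 * i + ?o) \<in> twisted_basis" by (simp add: twisted_basis_def)
      from act[OF this bs(1)] show "(\<Sum>j<length zs. cscale (((zs ! j)\<^sup>2) ^ i) (cscale ((zs ! j) ^ ?o) (site_act j y bs))) \<in> S"
        by (simp add: eval_tensor_act_eq_sum_site_act[OF bs(2)] power_add flip: power_mult)
    qed simp
    then show ?thesis using subspace_unscale[OF S(1), of "(zs ! j) ^ ?o"] nz[OF j] j by auto
  qed
  \<comment> \<open>Words are built from the left. Acting on the next factor alone, g^+ turns
    \<open>V_m\<close> into \<open>V_0\<close> and e turns it into \<open>V_p\<close>.\<close>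
  have step: "bas (xs @ replicate (length zs - length xs) V_m) \<in> S" if "length xs \<le> length zs" for xs
    using that
  proof (induction xs rule: rev_induct)
    case Nil
    then show ?case using S(2) by (simp add: lowest_tensor_def)
  next
    case (snoc b xs)
    let ?r = "replicate (length zs - Suc (length xs)) V_m"
    have r: "replicate (length zs - length xs) V_m = V_m # ?r"
      using snoc.prems by (simp add: Suc_diff_Suc flip: replicate_Suc)
    have IH: "bas (xs @ V_m # ?r) \<in> S" using snoc by (simp add: r)
    have s: "bas (xs @ a # ?r) \<in> S" if "V_act y V_m = bas a" for y a
    proof -
      obtain c where "c \<noteq> 0"
        "site_act (length xs) y (xs @ V_m # ?r) = cscale c (lin_ext (\<lambda>a. bas (xs @ a # ?r)) (V_act y V_m))"
        using site_act_append[of xs y V_m ?r] by blast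
      then have c: "c \<noteq> 0" "site_act (length xs) y (xs @ V_m # ?r) = cscale c (bas (xs @ a # ?r))"
        by (simp_all add: that)
      have "site_act (length xs) y (xs @ V_m # ?r) \<in> S"
        using snoc.prems by (intro site[OF IH]) auto
      then show ?thesis unfolding c(2) by (rule subspace_unscale[OF S(1) _ c(1)])
    qed
    show ?case using IH s[of osp_gp V_0] s[of osp_e V_p] by (cases b) simp_all
  qed
  show ?thesis using step[of bs] assms(6) by simp
qed

section \<open>Modules presented by the tensor algebra\<close>

type_synonym tensor = "(osp_basis \<times> nat) list \<Rightarrow>\<^sub>0 complex"

abbreviation TC :: "tensor set" where
  "TC \<equiv> {a. Poly_Mapping.keys a \<subseteq> lists twisted_basis}"

abbreviation TP :: "bool \<Rightarrow> tensor set" where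
  "TP p \<equiv> {a. Poly_Mapping.keys a \<subseteq> {u \<in> lists twisted_basis. word_odd u = p}}"

abbreviation tact :: "current \<Rightarrow> tensor \<Rightarrow> tensor" where
  "tact \<equiv> sm_act tensor_algebra"

definition letter :: "osp_basis \<times> nat \<Rightarrow> tensor \<Rightarrow> tensor" where
  "letter g = lin_ext (\<lambda>u. bas (g # u))"

definition parity_part :: "bool \<Rightarrow> tensor \<Rightarrow> tensor" where
  "parity_part p = lin_ext (\<lambda>u. if word_odd u = p then bas u else 0)"

lemma clin_letter: "clin (letter g)"
  and clin_parity_part: "clin (parity_part p)"
  unfolding letter_def parity_part_def by (rule clin_lin_ext)+

lemma subspace_TC: "cvec.subspace TC" and subspace_TP: "cvec.subspace (TP p)"
  by (rule subspace_keys)+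

lemma TP_subset_TC: "TP p \<subseteq> TC"
  by auto

lemma tact_eq: "tact x a = lin_ext (\<lambda>g. letter g a) x"
  by (simp add: tensor_algebra_def bilin_ext_def letter_def)

lemma tact_cur: "tact (cur y k) a = letter (y, k) a"
  by (simp add: tact_eq)

lemma clin_tact: "clin (tact x)"
  by (rule clinI) (simp_all add: tact_eq clin_add[OF clin_letter] clin_scale[OF clin_letter]
      lin_ext_add_fun lin_ext_cscale_fun)

lemma clin_tact_left: "clin (\<lambda>x. tact x a)"
  unfolding tact_eq by (rule clin_lin_ext)

lemma letter_TC: "g \<in> twisted_basis \<Longrightarrow> a \<in> TC \<Longrightarrow> letter g a \<in> TC"
  unfolding letter_def by (rule lin_ext_mem[OF subspace_TC]) auto

lemma letter_TP: "g \<in> twisted_basis \<Longrightarrow> a \<in> TP p \<Longrightarrow> letter g a \<in> TP (osp_odd (fst g) \<noteq> p)"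
  unfolding letter_def by (rule lin_ext_mem[OF subspace_TP]) (auto simp: word_odd_def)

lemma tact_TC: "x \<in> twisted_current \<Longrightarrow> a \<in> TC \<Longrightarrow> tact x a \<in> TC"
  unfolding tact_eq by (rule lin_ext_mem[OF subspace_TC letter_TC]) (auto simp: twisted_current_def)

lemma tact_TP: "x \<in> twisted_part p \<Longrightarrow> a \<in> TP q \<Longrightarrow> tact x a \<in> TP (p \<noteq> q)"
  unfolding tact_eq
proof (rule lin_ext_mem[OF subspace_TP])
  fix g assume "x \<in> twisted_part p" "a \<in> TP q" "g \<in> Poly_Mapping.keys x"
  moreover from this have "g \<in> twisted_basis" "osp_odd (fst g) = p"
    by (auto simp: twisted_part_def twisted_current_def)
  ultimately show "letter g a \<in> TP (p \<noteq> q)" using letter_TP by blast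
qed

lemma parity_part_TP: "a \<in> TC \<Longrightarrow> parity_part p a \<in> TP p"
  unfolding parity_part_def by (rule lin_ext_mem[OF subspace_TP]) auto

lemma parity_part_TP_eq: "a \<in> TP q \<Longrightarrow> parity_part p a = (if p = q then a else 0)"
proof -
  assume a: "a \<in> TP q"
  have "parity_part p a = lin_ext (\<lambda>u. if p = q then bas u else 0) a"
    unfolding parity_part_def by (rule lin_ext_cong) (use a in auto)
  then show ?thesis by (simp add: lin_ext_bas lin_ext_zero_fun)
qed

lemma parity_part_sum: "parity_part False a + parity_part True a = a"
proof -
  have "parity_part False a + parity_part True a = lin_ext bas a"
    unfolding parity_part_def lin_ext_add_fun[symmetric] by (rule lin_ext_cong) auto
  then show ?thesis by (simp add: lin_ext_bas)
qed

lemma tensor_algebra_simps: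
  "carrier tensor_algebra = TC" "zero tensor_algebra = 0" "add tensor_algebra = (+)"
  "smult tensor_algebra = cscale" "sm_part tensor_algebra = TP"
  by (simp_all add: tensor_algebra_def)

lemma cring_cplx: "cring cplx"
  by (rule cringI, rule abelian_groupI)
    (auto simp: cplx_def algebra_simps intro!: comm_monoidI exI[of _ "- _"] bexI[of _ "- _"])

lemma module_tensor_algebra: "Module.module cplx tensor_algebra"
proof (intro Module.moduleI abelian_groupI cring_cplx)
  fix x assume "x \<in> carrier tensor_algebra"
  then show "\<exists>y\<in>carrier tensor_algebra. y \<oplus>\<^bsub>tensor_algebra\<^esub> x = \<zero>\<^bsub>tensor_algebra\<^esub>"
    using cvec.subspace_neg[OF subspace_TC, of x] by (intro bexI[of _ "- x"]) (auto simp: tensor_algebra_simps)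
qed (use cvec.subspace_add[OF subspace_TC] cvec.subspace_scale[OF subspace_TC] in
    \<open>auto simp: tensor_algebra_simps cplx_def algebra_simps\<close>)

lemma submodule_tensor_algebra_iff: "submodule J cplx tensor_algebra \<longleftrightarrow> cvec.subspace J \<and> J \<subseteq> TC"
proof
  assume J: "submodule J cplx tensor_algebra"
  show "cvec.subspace J \<and> J \<subseteq> TC"
    using submodule.smult_closed[OF J] submodule.axioms(1)[OF J]
    by (auto simp: cvec.subspace_def subgroup_def tensor_algebra_simps cplx_def)
next
  assume J: "cvec.subspace J \<and> J \<subseteq> TC"
  interpret Module.module cplx tensor_algebra by (rule module_tensor_algebra)
  have neg: "\<ominus>\<^bsub>tensor_algebra\<^esub> a = - a" if "a \<in> TC" for a
    using that cvec.subspace_neg[OF subspace_TC, of a]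
    by (intro minus_equality) (auto simp: tensor_algebra_simps)
  show "submodule J cplx tensor_algebra"
    using J by (intro submoduleI)
      (auto simp: tensor_algebra_simps neg subset_eq cvec.subspace_0 cvec.subspace_neg cvec.subspace_add
        cvec.subspace_scale)
qed

text \<open>With \<open>s\<close> the Koszul sign, these are the vectors that a left ideal must
  contain for its quotient to satisfy \<open>act_bracket\<close>.\<close>

definition bracket_defect :: "complex \<Rightarrow> current \<Rightarrow> current \<Rightarrow> tensor \<Rightarrow> tensor" where
  "bracket_defect s x y v = tact (cur_bracket x y) v - (tact x (tact y v) - cscale s (tact y (tact x v)))"

lemma cur_bracket_closed: "x \<in> twisted_current \<Longrightarrow> y \<in> twisted_current \<Longrightarrow> cur_bracket x y \<in> twisted_current"
proof -
  assume x: "x \<in> twisted_current" and y: "y \<in> twisted_current"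
  have sub: "cvec.subspace twisted_current" unfolding twisted_current_def by (rule subspace_keys)
  show ?thesis
    unfolding cur_bracket_def bilin_ext_def
  proof (intro lin_ext_mem[OF sub])
    fix g g' assume g: "g \<in> Poly_Mapping.keys x" "g' \<in> Poly_Mapping.keys y"
    obtain z i z' j where e: "g = (z, i)" "g' = (z', j)" by force
    have "lin_ext (\<lambda>u. cur u (i + j)) (osp_bracket z z') \<in> twisted_current"
      by (rule lin_ext_mem[OF sub])
        (use g x y e in \<open>auto simp: twisted_current_def twisted_basis_def dest!: osp_odd_bracket\<close>)
    then show "(case g of (x, i) \<Rightarrow> \<lambda>(y, j). lin_ext (\<lambda>u. cur u (i + j)) (osp_bracket x y)) g' \<in> twisted_current"
      by (simp add: e)
  qed
qed

text \<open>\<open>q\<close> exhibits \<open>N\<close> as the quotient of \<open>TC\<close> by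
  \<open>J\<close>. Its target type is free, so cosets of tensors and families of cosets in the
  graded tensor product are handled alike.\<close>

locale presentation =
  fixes q :: "tensor \<Rightarrow> 'w"
    and J :: "tensor set" and N :: "'w supermodule" (structure)
  assumes surj: "carrier N = q ` TC"
    and q_zero: "q 0 = \<zero>"
    and q_add: "a \<in> TC \<Longrightarrow> b \<in> TC \<Longrightarrow> q (a + b) = q a \<oplus> q b"
    and q_scale: "a \<in> TC \<Longrightarrow> q (cscale c a) = c \<odot> q a"
    and q_act: "x \<in> twisted_current \<Longrightarrow> a \<in> TC \<Longrightarrow> q (tact x a) = sm_act N x (q a)"
    and q_part: "sm_part N p = q ` TP p"
    and kernel: "a \<in> TC \<Longrightarrow> b \<in> TC \<Longrightarrow> q a = q b \<longleftrightarrow> a - b \<in> J"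
begin

lemma q_eq_zero: "a \<in> TC \<Longrightarrow> q a = \<zero> \<longleftrightarrow> a \<in> J"
  using kernel[of a 0] by (simp add: q_zero)

lemma q_neg: "a \<in> TC \<Longrightarrow> Module.module cplx N \<Longrightarrow> q (- a) = \<ominus> q a"
proof -
  assume a: "a \<in> TC" and N: "Module.module cplx N"
  interpret Module.module cplx N by (rule N)
  have "- a \<in> TC" using a cvec.subspace_neg[OF subspace_TC] by simp
  then show ?thesis
    using a by (intro minus_equality[symmetric]) (auto simp: surj q_zero simp flip: q_add)
qed

lemma module: "Module.module cplx N"
proof -
  note mem = cvec.subspace_add[OF subspace_TC] cvec.subspace_scale[OF subspace_TC]
    cvec.subspace_neg[OF subspace_TC] cvec.subspace_0[OF subspace_TC]
  show ?thesis
  proof (intro Module.moduleI abelian_groupI cring_cplx)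
    fix x assume "x \<in> carrier N"
    then obtain a where "a \<in> TC" "x = q a" by (auto simp: surj)
    then show "\<exists>y\<in>carrier N. y \<oplus> x = \<zero>"
      using mem(3)[of a] by (intro bexI[of _ "q (- a)"]) (auto simp: surj q_zero simp flip: q_add)
  qed (use mem in \<open>auto simp: surj cplx_def algebra_simps simp flip: q_zero q_add q_scale\<close>)
qed

lemma bracket_iff:
  assumes x: "x \<in> twisted_current" and y: "y \<in> twisted_current" and v: "v \<in> TC"
  shows "sm_act N (cur_bracket x y) (q v) = sm_act N x (sm_act N y (q v)) \<ominus> s \<odot> sm_act N y (sm_act N x (q v))
    \<longleftrightarrow> bracket_defect s x y v \<in> J"
proof -
  interpret Module.module cplx N by (rule module)
  have mem: "tact (cur_bracket x y) v \<in> TC" "tact x (tact y v) \<in> TC" "tact y (tact x v) \<in> TC"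
    "tact x v \<in> TC" "tact y v \<in> TC"
    using tact_TC cur_bracket_closed x y v by blast+
  have mem': "cscale s (tact y (tact x v)) \<in> TC" "- cscale s (tact y (tact x v)) \<in> TC"
    using mem(3) cvec.subspace_scale[OF subspace_TC] cvec.subspace_neg[OF subspace_TC] by blast+
  have mem'': "tact x (tact y v) + - cscale s (tact y (tact x v)) \<in> TC"
    by (rule cvec.subspace_add[OF subspace_TC mem(2) mem'(2)])
  have "sm_act N x (sm_act N y (q v)) \<ominus> s \<odot> sm_act N y (sm_act N x (q v))
    = q (tact x (tact y v) + - cscale s (tact y (tact x v)))"
    using mem mem' x y v
    by (simp only: q_add q_neg[OF _ module] q_scale q_act a_minus_def)
  moreover have "sm_act N (cur_bracket x y) (q v) = q (tact (cur_bracket x y) v)"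
    using x y v by (simp add: q_act cur_bracket_closed)
  ultimately show ?thesis
    using kernel[OF mem(1) mem''] by (simp add: bracket_defect_def)
qed

text \<open>Closure of \<open>J\<close> under parity components is what makes the even and odd parts
  of a vector unique: two decompositions differ by an element of \<open>J\<close>, hence so do their
  components.\<close>

lemma twisted_supermodule:
  assumes J: "cvec.subspace J"
    and homogeneous: "\<And>a p. a \<in> TC \<Longrightarrow> a \<in> J \<Longrightarrow> parity_part p a \<in> J"
    and bracket: "\<And>x y p p' v. x \<in> twisted_part p \<Longrightarrow> y \<in> twisted_part p' \<Longrightarrow> v \<in> TC \<Longrightarrow>
      bracket_defect (koszul p p') x y v \<in> J"
  shows "twisted_supermodule N"
proof (rule twisted_supermodule.intro[OF module], rule twisted_supermodule_axioms.intro)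
  interpret Module.module cplx N by (rule module)
  note TCs = cvec.subspace_add[OF subspace_TC] cvec.subspace_scale[OF subspace_TC]
    cvec.subspace_neg[OF subspace_TC] cvec.subspace_0[OF subspace_TC]
  note TPs = cvec.subspace_add[OF subspace_TP] cvec.subspace_scale[OF subspace_TP]
    cvec.subspace_neg[OF subspace_TP] cvec.subspace_0[OF subspace_TP]
  have tc: "a \<in> TC" if "a \<in> TP p" for a p using that by auto
  show "submodule (sm_part N p) cplx N" for p
  proof (rule submoduleI)
    show "sm_part N p \<subseteq> carrier N" unfolding q_part surj by (rule image_mono[OF TP_subset_TC])
    show "\<zero> \<in> sm_part N p" unfolding q_part q_zero[symmetric] by (rule imageI[OF TPs(4)])
    fix a assume "a \<in> sm_part N p"
    then obtain a' where a': "a' \<in> TP p" "a = q a'" unfolding q_part by (rule imageE)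
    have "\<ominus> a = q (- a')" unfolding a'(2) by (rule q_neg[OF tc[OF a'(1)] module, symmetric])
    then show "\<ominus> a \<in> sm_part N p" unfolding q_part by (rule image_eqI[OF _ TPs(3)[OF a'(1)]])
    show "c \<odot> a \<in> sm_part N p" for c
      unfolding q_part a'(2) q_scale[OF tc[OF a'(1)], symmetric] by (rule imageI[OF TPs(2)[OF a'(1)]])
    fix b assume "b \<in> sm_part N p"
    then obtain b' where b': "b' \<in> TP p" "b = q b'" unfolding q_part by (rule imageE)
    show "a \<oplus> b \<in> sm_part N p"
      unfolding q_part a'(2) b'(2) q_add[OF tc[OF a'(1)] tc[OF b'(1)], symmetric]
      by (rule imageI[OF TPs(1)[OF a'(1) b'(1)]])
  qed
  show "\<exists>!(a, b). a \<in> sm_part N False \<and> b \<in> sm_part N True \<and> v = a \<oplus> b" if v: "v \<in> carrier N" for v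
  proof -
    obtain a where a: "a \<in> TC" "v = q a" using v by (auto simp: surj)
    note pp = parity_part_TP[OF a(1)]
    have v_eq: "v = q (parity_part False a) \<oplus> q (parity_part True a)"
      unfolding a(2) q_add[OF tc[OF pp] tc[OF pp], symmetric] parity_part_sum ..
    show ?thesis
    proof (rule ex1I[of _ "(q (parity_part False a), q (parity_part True a))"])
      show "case (q (parity_part False a), q (parity_part True a)) of
        (a, b) \<Rightarrow> a \<in> sm_part N False \<and> b \<in> sm_part N True \<and> v = a \<oplus> b"
        unfolding q_part prod.case by (intro conjI imageI pp v_eq)
      fix r assume r: "case r of (a, b) \<Rightarrow> a \<in> sm_part N False \<and> b \<in> sm_part N True \<and> v = a \<oplus> b"
      obtain r1 r2 where r12: "r = (r1, r2)" by (cases r)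
      then have "r1 \<in> q ` TP False" "r2 \<in> q ` TP True" and r_eq: "v = r1 \<oplus> r2"
        using r unfolding q_part by simp_all
      then obtain b c where b: "b \<in> TP False" "r1 = q b" and c: "c \<in> TP True" "r2 = q c"
        by (elim imageE)
      then have bc: "b \<in> TP False" "c \<in> TP True" "r = (q b, q c)" "v = q b \<oplus> q c"
        by (simp_all only: r12 r_eq)
      have bcT: "b + c \<in> TC" using TCs(1)[OF tc[OF bc(1)] tc[OF bc(2)]] .
      have "q a = q (b + c)" using bc(4) a(2) q_add[OF tc[OF bc(1)] tc[OF bc(2)]] by simp
      then have J': "a - (b + c) \<in> J" using kernel[OF a(1) bcT] by simp
      have "a - (b + c) \<in> TC" using cvec.subspace_diff[OF subspace_TC a(1) bcT] .
      from homogeneous[OF this J'] have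
        "parity_part p a - (parity_part p b + parity_part p c) \<in> J" for p
        by (simp add: clin_diff[OF clin_parity_part] clin_add[OF clin_parity_part])
      from this[of False] this[of True] have "parity_part False a - b \<in> J" "parity_part True a - c \<in> J"
        by (simp_all add: parity_part_TP_eq[OF bc(1)] parity_part_TP_eq[OF bc(2)])
      then have "q (parity_part False a) = q b" "q (parity_part True a) = q c"
        using kernel[OF tc[OF pp] tc[OF bc(1)]] kernel[OF tc[OF pp] tc[OF bc(2)]] by simp_all
      then show "r = (q (parity_part False a), q (parity_part True a))" by (simp only: bc(3))
    qed
  qed
  have tw: "x \<in> twisted_current" if "x \<in> twisted_part p" for x p using that by (simp add: twisted_part_def)
  have tws: "x + y \<in> twisted_current" "cscale c x \<in> twisted_current"
    if "x \<in> twisted_current" "y \<in> twisted_current" for x y c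
    using that cvec.subspace_add[OF subspace_keys, of x _ y] cvec.subspace_scale[OF subspace_keys, of x _ c]
    by (simp_all add: twisted_current_def)
  show "sm_act N x v \<in> carrier N" if "x \<in> twisted_current" "v \<in> carrier N" for x v
  proof -
    note hyp = that
    obtain a where a: "a \<in> TC" "v = q a" using hyp(2) unfolding surj by blast
    show ?thesis
      unfolding a(2) surj q_act[OF that(1) a(1), symmetric] using tact_TC[OF that(1) a(1)] by (rule imageI)
  qed
  show "sm_act N (x + y) v = sm_act N x v \<oplus> sm_act N y v"
    if "x \<in> twisted_current" "y \<in> twisted_current" "v \<in> carrier N" for x y v
  proof -
    note hyp = that
    obtain a where a: "a \<in> TC" "v = q a" using hyp unfolding surj by blast
    show ?thesis
      unfolding a(2) q_act[OF that(1) a(1), symmetric] q_act[OF that(2) a(1), symmetric]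
        q_act[OF tws(1)[OF that(1,2)] a(1), symmetric] clin_add[OF clin_tact_left]
      by (rule q_add[OF tact_TC[OF that(1) a(1)] tact_TC[OF that(2) a(1)]])
  qed
  show "sm_act N (cscale c x) v = c \<odot> sm_act N x v"
    if "x \<in> twisted_current" "v \<in> carrier N" for c x v
  proof -
    note hyp = that
    obtain a where a: "a \<in> TC" "v = q a" using hyp unfolding surj by blast
    show ?thesis
      unfolding a(2) q_act[OF that(1) a(1), symmetric] q_act[OF tws(2)[OF that(1,1)] a(1), symmetric]
        clin_scale[OF clin_tact_left]
      by (rule q_scale[OF tact_TC[OF that(1) a(1)]])
  qed
  show "sm_act N x (u \<oplus> v) = sm_act N x u \<oplus> sm_act N x v"
    if "x \<in> twisted_current" "u \<in> carrier N" "v \<in> carrier N" for x u v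
  proof -
    note hyp = that
    obtain a where a: "a \<in> TC" "u = q a" using hyp(2) unfolding surj by blast
    obtain b where b: "b \<in> TC" "v = q b" using hyp(3) unfolding surj by blast
    show ?thesis
      unfolding a(2) b(2) q_add[OF a(1) b(1), symmetric] q_act[OF that(1) a(1), symmetric]
        q_act[OF that(1) b(1), symmetric] q_act[OF that(1) TCs(1)[OF a(1) b(1)], symmetric] clin_add[OF clin_tact]
      by (rule q_add[OF tact_TC[OF that(1) a(1)] tact_TC[OF that(1) b(1)]])
  qed
  show "sm_act N x (c \<odot> v) = c \<odot> sm_act N x v"
    if "x \<in> twisted_current" "v \<in> carrier N" for x c v
  proof -
    note hyp = that
    obtain a where a: "a \<in> TC" "v = q a" using hyp unfolding surj by blast
    show ?thesis
      unfolding a(2) q_scale[OF a(1), symmetric] q_act[OF that(1) a(1), symmetric]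
        q_act[OF that(1) TCs(2)[OF a(1)], symmetric] clin_scale[OF clin_tact]
      by (rule q_scale[OF tact_TC[OF that(1) a(1)]])
  qed
  show "sm_act N x v \<in> sm_part N (p \<noteq> p')" if "x \<in> twisted_part p" "v \<in> sm_part N p'" for x v p p'
  proof -
    note hyp = that
    obtain a where a: "a \<in> TP p'" "v = q a" using hyp(2) unfolding q_part by blast
    show ?thesis
      unfolding a(2) q_part q_act[OF tw[OF that(1)] tc[OF a(1)], symmetric]
      using tact_TP[OF that(1) a(1)] by blast
  qed
  show "sm_act N (cur_bracket x y) v = sm_act N x (sm_act N y v) \<ominus> koszul p p' \<odot> sm_act N y (sm_act N x v)"
    if "x \<in> twisted_part p" "y \<in> twisted_part p'" "v \<in> carrier N" for x y v p p'
  proof -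
    note hyp = that
    obtain a where a: "a \<in> TC" "v = q a" using hyp(3) unfolding surj by blast
    show ?thesis
      unfolding a(2) bracket_iff[OF tw[OF that(1)] tw[OF that(2)] a(1)] by (rule bracket[OF that(1,2) a(1)])
  qed
qed

lemma bracket_defect_mem:
  assumes "twisted_supermodule N" "x \<in> twisted_part p" "y \<in> twisted_part p'" "v \<in> TC"
  shows "bracket_defect (koszul p p') x y v \<in> J"
proof -
  have "x \<in> twisted_current" "y \<in> twisted_current" using assms by (simp_all add: twisted_part_def)
  from bracket_iff[OF this assms(4), of "koszul p p'"] twisted_supermodule.act_bracket[OF assms(1,2,3), of "q v"] assms(4)
  show ?thesis by (auto simp: surj)
qed

lemma q_letter_power:
  assumes "(y, k) \<in> twisted_basis" "a \<in> TC"
  shows "(letter (y, k) ^^ m) a \<in> TC \<and> (sm_act N (cur y k) ^^ m) (q a) = q ((letter (y, k) ^^ m) a)"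
proof (induction m)
  case (Suc m)
  have "cur y k \<in> twisted_current" using assms by (simp add: twisted_current_def)
  with Suc show ?case
    using letter_TC[OF assms(1)] q_act[of "cur y k" "(letter (y, k) ^^ m) a"] by (simp add: tact_cur)
qed (use assms in simp)

lemma sl2_integrable_iff:
  "sl2_integrable N \<longleftrightarrow> (\<forall>a\<in>TC. \<forall>y\<in>{osp_e, osp_f}. \<exists>m. (letter (y, 0) ^^ m) a \<in> J)"
proof -
  have "(sm_act N (cur y 0) ^^ m) (q a) = \<zero> \<longleftrightarrow> (letter (y, 0) ^^ m) a \<in> J"
    if "a \<in> TC" "y \<in> {osp_e, osp_f}" for a y m
  proof -
    have "(y, 0) \<in> twisted_basis" using that(2) by (auto simp: twisted_basis_def)
    then show ?thesis using q_letter_power[of y 0 a m] that(1) q_eq_zero by simp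
  qed
  moreover have "(\<forall>v\<in>q ` TC. Q v) \<longleftrightarrow> (\<forall>a\<in>TC. Q (q a))" for Q by blast
  ultimately show ?thesis unfolding sl2_integrable_def surj by (simp cong: ball_cong)
qed

text \<open>Turns the relations into memberships in \<open>J\<close>, a form that passes to
  intersections of ideals.\<close>

lemma weyl_relations_iff:
  "weyl_relations n N (q (bas [])) \<longleftrightarrow>
     (\<forall>i. bas [(osp_f, 2 * i)] \<in> J) \<and> (\<forall>i. bas [(osp_gm, 2 * i + 1)] \<in> J) \<and>
     (\<forall>i. bas [(osp_h, 2 * i + 2)] \<in> J) \<and> bas [(osp_h, 0)] - cscale (- of_nat n) (bas []) \<in> J \<and>
     (letter (osp_e, 0) ^^ (n + 1)) (bas []) \<in> J"
proof -
  have act: "sm_act N (cur y k) (q (bas [])) = q (bas [(y, k)])" and mem: "bas [(y, k)] \<in> TC"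
    if "(y, k) \<in> twisted_basis" for y k
    using that q_act[of "cur y k" "bas []"] by (simp_all add: twisted_current_def tact_cur letter_def)
  have tw: "(osp_f, 2 * i) \<in> twisted_basis" "(osp_gm, 2 * i + 1) \<in> twisted_basis"
    "(osp_h, 2 * i + 2) \<in> twisted_basis" "(osp_h, 0) \<in> twisted_basis" "(osp_e, 0) \<in> twisted_basis" for i
    by (simp_all add: twisted_basis_def)
  have nil: "bas [] \<in> TC" by simp
  have "- of_nat n \<odot> q (bas []) = q (cscale (- of_nat n) (bas []))"
    by (rule q_scale[OF nil, symmetric])
  moreover have "cscale (- of_nat n) (bas []) \<in> TC"
    by (rule cvec.subspace_scale[OF subspace_TC nil])
  ultimately have h: "sm_act N (cur osp_h 0) (q (bas [])) = - of_nat n \<odot> q (bas [])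
      \<longleftrightarrow> bas [(osp_h, 0)] - cscale (- of_nat n) (bas []) \<in> J"
    using kernel[OF mem[OF tw(4)]] by (simp only: act[OF tw(4)])
  have e: "(sm_act N (cur osp_e 0) ^^ (n + 1)) (q (bas [])) = \<zero> \<longleftrightarrow> (letter (osp_e, 0) ^^ (n + 1)) (bas []) \<in> J"
    using q_letter_power[OF tw(5) nil, of "n + 1"] q_eq_zero by (simp only:)
  show ?thesis
    unfolding weyl_relations_def h e act[OF tw(1)] act[OF tw(2)] act[OF tw(3)]
      q_eq_zero[OF mem[OF tw(1)]] q_eq_zero[OF mem[OF tw(2)]] q_eq_zero[OF mem[OF tw(3)]] ..
qed

end

text \<open>\<open>\<theta>\<close> chooses any preimage under \<open>q\<close>; since the kernels
  agree, its image under \<open>q'\<close> does not depend on the choice.\<close>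

lemma presentation_iso:
  assumes "presentation q J N" "presentation q' J N'"
  shows "\<exists>\<theta>. supermodule_iso N N' \<theta>"
proof -
  interpret N: presentation q J N by (rule assms(1))
  interpret N': presentation q' J N' by (rule assms(2))
  define \<theta> where "\<theta> v = q' (SOME a. a \<in> TC \<and> q a = v)" for v
  have \<theta>: "\<theta> (q a) = q' a" if a: "a \<in> TC" for a
  proof -
    have "(SOME b. b \<in> TC \<and> q b = q a) \<in> TC \<and> q (SOME b. b \<in> TC \<and> q b = q a) = q a"
      by (rule someI[of _ a]) (use a in simp)
    then show ?thesis unfolding \<theta>_def using N.kernel N'.kernel a by meson
  qed
  note TCs = cvec.subspace_add[OF subspace_TC] cvec.subspace_scale[OF subspace_TC]
  have "bij_betw \<theta> (carrier N) (carrier N')"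
  proof (rule bij_betw_imageI)
    show "inj_on \<theta> (carrier N)"
      unfolding N.surj
    proof (rule inj_onI, elim imageE)
      fix u v a b assume "\<theta> u = \<theta> v" "u = q a" "a \<in> TC" "v = q b" "b \<in> TC"
      then show "u = v" by (simp only: \<theta> N.kernel N'.kernel)
    qed
    show "\<theta> ` carrier N = carrier N'"
      unfolding N.surj N'.surj image_image by (rule image_cong) (use \<theta> in auto)
  qed
  moreover have "\<theta> ` sm_part N p = sm_part N' p" for p
    unfolding N.q_part N'.q_part image_image by (rule image_cong[OF refl], rule \<theta>) auto
  moreover have "\<theta> (u \<oplus>\<^bsub>N\<^esub> v) = \<theta> u \<oplus>\<^bsub>N'\<^esub> \<theta> v" if "u \<in> carrier N" "v \<in> carrier N" for u v
  proof -
    note hyp = that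
    obtain a where a: "a \<in> TC" "u = q a" using hyp(1) unfolding N.surj by blast
    obtain b where b: "b \<in> TC" "v = q b" using hyp(2) unfolding N.surj by blast
    note ab = a b
    then show ?thesis
      using \<theta>[OF TCs(1)[OF ab(1,3)]] by (simp only: \<theta> N.q_add N'.q_add)
  qed
  moreover have "\<theta> (c \<odot>\<^bsub>N\<^esub> v) = c \<odot>\<^bsub>N'\<^esub> \<theta> v" if "v \<in> carrier N" for c v
  proof -
    note hyp = that
    obtain a where a: "a \<in> TC" "v = q a" using hyp by (auto simp: N.surj)
    then show ?thesis
      using \<theta>[OF TCs(2)[OF a(1)]] by (simp only: \<theta> N.q_scale N'.q_scale)
  qed
  moreover have "\<theta> (sm_act N x v) = sm_act N' x (\<theta> v)" if "x \<in> twisted_current" "v \<in> carrier N" for x v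
  proof -
    note hyp = that
    obtain a where a: "a \<in> TC" "v = q a" using hyp by (auto simp: N.surj)
    then show ?thesis
      using \<theta>[OF tact_TC[OF that(1) a(1)]] that(1) by (simp only: \<theta> N.q_act N'.q_act)
  qed
  ultimately show ?thesis unfolding supermodule_iso_def by blast
qed

lemma set_add_eq: "add R = (+) \<Longrightarrow> A <+>\<^bsub>R\<^esub> B = {a + b | a b. a \<in> A \<and> b \<in> B}"
  by (auto simp: set_add_def set_mult_def)

lemma a_r_coset_eq: "add R = (+) \<Longrightarrow> A +>\<^bsub>R\<^esub> b = {a + b | a. a \<in> A}"
  by (auto simp: a_r_coset_def r_coset_def)

section \<open>Cosets of a subspace\<close>

abbreviation vcoset :: "('b \<Rightarrow>\<^sub>0 complex) set \<Rightarrow> ('b \<Rightarrow>\<^sub>0 complex) \<Rightarrow> ('b \<Rightarrow>\<^sub>0 complex) set" where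
  "vcoset Y b \<equiv> {a + b | a. a \<in> Y}"

lemma vcoset_mem: "x \<in> vcoset Y b \<longleftrightarrow> x - b \<in> Y"
  by (auto intro!: exI[of _ "x - b"])

lemma vcoset_eq: "cvec.subspace Y \<Longrightarrow> vcoset Y a = vcoset Y b \<longleftrightarrow> a - b \<in> Y"
proof
  assume Y: "cvec.subspace Y" and "vcoset Y a = vcoset Y b"
  then have "a \<in> vcoset Y b" using cvec.subspace_0[OF Y] by (metis (no_types) diff_self vcoset_mem)
  then show "a - b \<in> Y" by (simp only: vcoset_mem)
next
  assume Y: "cvec.subspace Y" and ab: "a - b \<in> Y"
  have "x - a \<in> Y \<longleftrightarrow> x - b \<in> Y" for x
    using cvec.subspace_add[OF Y _ ab, of "x - a"] cvec.subspace_diff[OF Y _ ab, of "x - b"] by auto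
  then show "vcoset Y a = vcoset Y b" by (intro Set.set_eqI) (simp only: vcoset_mem)
qed

lemma vcoset_zero: "vcoset Y 0 = Y"
  by auto

lemma vcoset_add:
  assumes "cvec.subspace Y"
  shows "{x + y | x y. x \<in> vcoset Y a \<and> y \<in> vcoset Y b} = vcoset Y (a + b)" (is "?L = ?R")
proof (intro Set.set_eqI iffI)
  fix x assume "x \<in> ?L"
  then obtain c d where "c \<in> Y" "d \<in> Y" "x = (c + a) + (d + b)" by blast
  then show "x \<in> ?R" using cvec.subspace_add[OF assms] by (intro CollectI exI[of _ "c + d"]) (simp add: algebra_simps)
next
  fix x assume "x \<in> ?R"
  then obtain c where "c \<in> Y" "x = c + (a + b)" by blast
  then show "x \<in> ?L" using cvec.subspace_0[OF assms]
    by (intro CollectI exI[of _ "c + a"] exI[of _ "0 + b"]) (auto simp: algebra_simps)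
qed

text \<open>\<open>T\<close> may shrink a coset, as scaling by 0 does; adding \<open>Y\<close> fills
  it up again.\<close>

lemma vcoset_image:
  assumes "cvec.subspace Y" "clin T" "T ` Y \<subseteq> Y"
  shows "{x + y | x y. x \<in> Y \<and> y \<in> T ` vcoset Y a} = vcoset Y (T a)" (is "?L = ?R")
proof (intro Set.set_eqI iffI)
  fix x assume "x \<in> ?L"
  then obtain c d where "c \<in> Y" "d \<in> Y" "x = c + T (d + a)" by blast
  then show "x \<in> ?R" using cvec.subspace_add[OF assms(1)] assms(3)
    by (intro CollectI exI[of _ "c + T d"]) (auto simp: clin_add[OF assms(2)] algebra_simps)
next
  fix x assume "x \<in> ?R"
  then obtain c where "c \<in> Y" "x = c + T a" by blast
  moreover have "a \<in> vcoset Y a" using cvec.subspace_0[OF assms(1)] by (intro CollectI exI[of _ 0]) simp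
  ultimately show "x \<in> ?L" by blast
qed

lemma presentation_quot:
  assumes "stable_submodule J tensor_algebra"
  shows "presentation (\<lambda>a. J +>\<^bsub>tensor_algebra\<^esub> a) J (quot_module tensor_algebra J)"
proof -
  have J: "cvec.subspace J" "J \<subseteq> TC" "\<And>x. x \<in> twisted_current \<Longrightarrow> tact x ` J \<subseteq> J"
    using assms by (auto simp: stable_submodule_def submodule_tensor_algebra_iff)
  note eq = a_r_coset_eq[OF tensor_algebra_simps(3)] set_add_eq[OF tensor_algebra_simps(3)]
  show ?thesis
  proof
    show "carrier (quot_module tensor_algebra J) = (\<lambda>a. J +>\<^bsub>tensor_algebra\<^esub> a) ` TC"
      by (auto simp: quot_module_def A_RCOSETS_def RCOSETS_def a_r_coset_def tensor_algebra_simps)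
    show "J +>\<^bsub>tensor_algebra\<^esub> 0 = \<zero>\<^bsub>quot_module tensor_algebra J\<^esub>"
      by (simp add: quot_module_def eq)
    show "J +>\<^bsub>tensor_algebra\<^esub> (a + b) = (J +>\<^bsub>tensor_algebra\<^esub> a) \<oplus>\<^bsub>quot_module tensor_algebra J\<^esub> (J +>\<^bsub>tensor_algebra\<^esub> b)" for a b
      unfolding quot_module_def ring.simps module.simps eq vcoset_add[OF J(1)] ..
    show "J +>\<^bsub>tensor_algebra\<^esub> (cscale c a) = c \<odot>\<^bsub>quot_module tensor_algebra J\<^esub> (J +>\<^bsub>tensor_algebra\<^esub> a)" for c a
      unfolding quot_module_def module.simps eq tensor_algebra_simps
      by (subst vcoset_image[OF J(1) clin_cscale]) (auto simp: cvec.subspace_scale[OF J(1)])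
    show "J +>\<^bsub>tensor_algebra\<^esub> (tact x a) = sm_act (quot_module tensor_algebra J) x (J +>\<^bsub>tensor_algebra\<^esub> a)"
      if "x \<in> twisted_current" for x a
      unfolding quot_module_def supermodule.simps eq vcoset_image[OF J(1) clin_tact J(3)[OF that]] ..
    show "sm_part (quot_module tensor_algebra J) p = (\<lambda>a. J +>\<^bsub>tensor_algebra\<^esub> a) ` TP p" for p
      by (simp add: quot_module_def tensor_algebra_simps)
    show "(J +>\<^bsub>tensor_algebra\<^esub> a = J +>\<^bsub>tensor_algebra\<^esub> b) = (a - b \<in> J)" for a b
      unfolding eq by (rule vcoset_eq[OF J(1)])
  qed
qed

section \<open>The associated graded module\<close>

definition degree_part :: "nat \<Rightarrow> tensor \<Rightarrow> tensor" where
  "degree_part s = lin_ext (\<lambda>u. if sum_list (map snd u) = s then bas u else 0)"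

text \<open>The bound is strict so that \<open>TD 0\<close> is zero and the image of
  \<open>TD s\<close> is the filtration step before \<open>s\<close> for every \<open>s\<close>,
  including 0.\<close>

abbreviation TD :: "nat \<Rightarrow> tensor set" where
  "TD s \<equiv> {a. Poly_Mapping.keys a \<subseteq> {u \<in> lists twisted_basis. sum_list (map snd u) < s}}"

lemma clin_degree_part: "clin (degree_part s)"
  unfolding degree_part_def by (rule clin_lin_ext)

lemma lookup_degree_part:
  "Poly_Mapping.lookup (degree_part s a) u = (if sum_list (map snd u) = s then Poly_Mapping.lookup a u else 0)"
proof -
  have "Poly_Mapping.lookup (degree_part s a) u
    = (\<Sum>w\<in>Poly_Mapping.keys a. Poly_Mapping.lookup a w
        * Poly_Mapping.lookup (if sum_list (map snd w) = s then bas w else 0) u)"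
    by (simp add: degree_part_def lin_ext_def lookup_sum)
  also have "\<dots> = (\<Sum>w\<in>Poly_Mapping.keys a.
      if w = u then if sum_list (map snd u) = s then Poly_Mapping.lookup a u else 0 else 0)"
    by (rule sum.cong) (auto simp: lookup_single when_def)
  finally show ?thesis by (auto simp: in_keys_iff)
qed

lemma keys_degree_part: "Poly_Mapping.keys (degree_part s a) = {u \<in> Poly_Mapping.keys a. sum_list (map snd u) = s}"
  by (auto simp: in_keys_iff lookup_degree_part split: if_splits)

lemma degree_part_eq_self: "Poly_Mapping.keys a \<subseteq> {u. sum_list (map snd u) = s} \<Longrightarrow> degree_part t a = (if t = s then a else 0)"
  by (rule poly_mapping_eqI) (auto simp: lookup_degree_part in_keys_iff)

lemma degree_part_letter:
  "degree_part s (letter g a) = (if snd g \<le> s then letter g (degree_part (s - snd g) a) else 0)"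
proof -
  have "degree_part s (letter g a) = lin_ext (\<lambda>u. if snd g + sum_list (map snd u) = s then bas (g # u) else 0) a"
    by (simp add: degree_part_def letter_def lin_ext_lin_ext)
  also have "\<dots> = (if snd g \<le> s then lin_ext (\<lambda>u. lin_ext (\<lambda>u. bas (g # u)) (if sum_list (map snd u) = s - snd g then bas u else 0)) a else 0)"
    by (auto simp: lin_ext_zero_fun intro!: lin_ext_cong trans[OF lin_ext_cong lin_ext_zero_fun])
  finally show ?thesis by (simp add: degree_part_def letter_def lin_ext_lin_ext)
qed

lemma degree_part_letter0_power: "degree_part s ((letter (y, 0) ^^ m) a) = (letter (y, 0) ^^ m) (degree_part s a)"
  by (induction m) (simp_all add: degree_part_letter)

lemma degree_part_parity_part: "degree_part s (parity_part p a) = parity_part p (degree_part s a)"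
  by (simp add: degree_part_def parity_part_def lin_ext_lin_ext) (rule lin_ext_cong, simp)

lemma keys_parity_part: "Poly_Mapping.keys (parity_part p a) \<subseteq> Poly_Mapping.keys a"
  unfolding parity_part_def by (rule order_trans[OF keys_lin_ext]) (auto split: if_splits)

lemma degree_part_TC: "a \<in> TC \<Longrightarrow> degree_part s a \<in> TC"
  by (auto simp: keys_degree_part)

lemma degree_part_TD: "a \<in> TC \<Longrightarrow> degree_part s a \<in> TD (Suc s)"
  by (auto simp: keys_degree_part)

lemma diff_degree_part_TD: "a \<in> TD (Suc s) \<Longrightarrow> a - degree_part s a \<in> TD s"
  by (auto simp: in_keys_iff lookup_minus lookup_degree_part subset_eq less_Suc_eq split: if_splits)

lemma letter_TD: "g \<in> twisted_basis \<Longrightarrow> a \<in> TD s \<Longrightarrow> letter g a \<in> TD (s + snd g)"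
  unfolding letter_def by (rule lin_ext_mem[OF subspace_keys]) auto

section \<open>Evaluation of tensors on the lowest tensor, and the filtration\<close>

definition ev :: "complex list \<Rightarrow> tensor \<Rightarrow> (V_basis list \<Rightarrow>\<^sub>0 complex)" where
  "ev zs = lin_ext (\<lambda>u. word_act (eval_tensor zs) u (lowest_tensor (length zs)))"

lemma clin_ev: "clin (ev zs)"
  unfolding ev_def by (rule clin_lin_ext)

lemma eval_act: "sm_act (eval_tensor zs) x p = lin_ext (\<lambda>g. lin_ext (eval_tensor_act zs g) p) x"
  by (simp add: eval_tensor_def bilin_ext_def)

lemma clin_eval_act: "clin (sm_act (eval_tensor zs) x)"
  by (rule clinI) (simp_all add: eval_act lin_ext_add lin_ext_cscale lin_ext_add_fun lin_ext_cscale_fun)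

lemma ev_Nil: "ev zs (bas []) = lowest_tensor (length zs)"
  by (simp add: ev_def word_act_def)

lemma ev_letter: "ev zs (letter g a) = lin_ext (eval_tensor_act zs g) (ev zs a)"
proof -
  have "word_act (eval_tensor zs) (g # u) v = lin_ext (eval_tensor_act zs g) (word_act (eval_tensor zs) u v)" for u v
    by (cases g) (simp add: word_act_def eval_act)
  then show ?thesis by (simp add: ev_def letter_def lin_ext_lin_ext)
qed

lemma eval_parity_closed:
  assumes "p \<in> sm_part (eval_tensor zs) q"
  shows "lin_ext (eval_tensor_act zs g) p \<in> sm_part (eval_tensor zs) (osp_odd (fst g) \<noteq> q)"
proof -
  obtain y k where g: "g = (y, k)" by force
  show ?thesis
    unfolding g using assms keys_lin_ext[of "eval_tensor_act zs (y, k)" p] keys_eval_tensor_act[of zs y k]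
    by (fastforce simp: eval_tensor_def)
qed

lemma subspace_eval_part: "cvec.subspace (sm_part (eval_tensor zs) q)"
  by (simp add: eval_tensor_def subspace_keys)

lemma eval_part_disjoint:
  assumes "p \<in> sm_part (eval_tensor zs) q" "p \<in> sm_part (eval_tensor zs) (\<not> q)"
  shows "p = 0"
proof -
  have False if "bs \<in> Poly_Mapping.keys p" for bs using assms that by (auto simp: eval_tensor_def subset_eq)
  then have "Poly_Mapping.keys p = {}" by blast
  then show ?thesis by simp
qed

lemma ev_word_part:
  "ev zs (bas u) \<in> sm_part (eval_tensor zs) (word_odd u)"
proof (induction u)
  case Nil
  have "lowest_tensor (length zs) \<in> sm_part (eval_tensor zs) False"
    by (simp add: eval_tensor_def lowest_tensor_def)
  then show ?case by (simp add: ev_Nil word_odd_def)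
next
  case (Cons g u)
  have "word_odd (g # u) = (osp_odd (fst g) \<noteq> word_odd u)" by (simp add: word_odd_def)
  then show ?case
    using eval_parity_closed[OF Cons, of g] ev_letter[of zs g "bas u"] by (simp add: letter_def)
qed

lemma ev_eq: "ev zs a = lin_ext (\<lambda>u. ev zs (bas u)) a"
  by (simp add: ev_def)

lemma ev_part: "a \<in> TP p \<Longrightarrow> ev zs a \<in> sm_part (eval_tensor zs) p"
proof (subst ev_eq, rule lin_ext_mem[OF subspace_eval_part])
  fix u assume "a \<in> TP p" "u \<in> Poly_Mapping.keys a"
  then have "word_odd u = p" by auto
  then show "ev zs (bas u) \<in> sm_part (eval_tensor zs) p" using ev_word_part[of zs u] by simp
qed

lemma ev_carrier: "ev zs a \<in> carrier (eval_tensor zs)"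
proof -
  have "cvec.subspace (carrier (eval_tensor zs))" by (simp add: eval_tensor_def subspace_keys)
  moreover have "ev zs (bas u) \<in> carrier (eval_tensor zs)" for u
    using ev_word_part[of zs u] by (auto simp: eval_tensor_def)
  ultimately show ?thesis by (subst ev_eq) (rule lin_ext_mem)
qed

lemma ev_span_image: "ev zs ` {a. Poly_Mapping.keys a \<subseteq> K} = cvec.span {ev zs (bas u) | u. u \<in> K}"
proof -
  interpret vector_space_pair "cscale :: complex \<Rightarrow> tensor \<Rightarrow> _"
    "cscale :: complex \<Rightarrow> (V_basis list \<Rightarrow>\<^sub>0 complex) \<Rightarrow> _" ..
  have "ev zs ` {a. Poly_Mapping.keys a \<subseteq> K} = cvec.span (ev zs ` bas ` K)"
    unfolding keys_subset_eq_span by (rule linear_span_image[OF clin_ev, symmetric])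
  also have "ev zs ` bas ` K = {ev zs (bas u) | u. u \<in> K}" by auto
  finally show ?thesis .
qed

lemma ev_bas: "ev zs (bas u) = word_act (eval_tensor zs) u (lowest_tensor (length zs))"
  by (simp add: ev_def)

lemma span_Union_U_act:
  "cvec.span (\<Union>r\<in>R. U_act (eval_tensor zs) (lowest_tensor (length zs)) r)
    = ev zs ` {a. Poly_Mapping.keys a \<subseteq> {u \<in> lists twisted_basis. sum_list (map snd u) \<in> R}}"
proof -
  let ?U = "\<lambda>r. {word_act (eval_tensor zs) u (lowest_tensor (length zs)) | u. u \<in> lists twisted_basis \<and> sum_list (map snd u) = r}"
  let ?W = "{ev zs (bas u) | u. u \<in> {u \<in> lists twisted_basis. sum_list (map snd u) \<in> R}}"
  have "cvec.span (\<Union>r\<in>R. cvec.span (?U r)) = cvec.span ?W"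
  proof (rule cvec.span_eq[THEN iffD2], intro conjI)
    show "(\<Union>r\<in>R. cvec.span (?U r)) \<subseteq> cvec.span ?W"
    proof (rule UN_least, rule cvec.span_mono)
      fix r assume "r \<in> R"
      then show "?U r \<subseteq> ?W" by (auto simp: ev_bas)
    qed
    show "?W \<subseteq> cvec.span (\<Union>r\<in>R. cvec.span (?U r))"
    proof
      fix x assume "x \<in> ?W"
      then obtain u where u: "x = ev zs (bas u)" "u \<in> lists twisted_basis" "sum_list (map snd u) \<in> R" by blast
      then have "x \<in> cvec.span (?U (sum_list (map snd u)))" by (auto simp: ev_bas intro!: cvec.span_base)
      then show "x \<in> cvec.span (\<Union>r\<in>R. cvec.span (?U r))" using u(3) by (auto intro: cvec.span_base)
    qed
  qed
  then show ?thesis unfolding U_act_def ev_span_image .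
qed

lemma filt_eq: "filt (eval_tensor zs) (lowest_tensor (length zs)) s = ev zs ` TD (Suc s)"
proof -
  have "{u \<in> lists twisted_basis. sum_list (map snd u) \<in> {..s}} = {u \<in> lists twisted_basis. sum_list (map snd u) < Suc s}"
    by auto
  then show ?thesis unfolding filt_def span_Union_U_act by simp
qed

definition Fb :: "complex list \<Rightarrow> nat \<Rightarrow> (V_basis list \<Rightarrow>\<^sub>0 complex) set" where
  "Fb zs s = ev zs ` TD s"

lemma filt_below_eq: "filt_below (eval_tensor zs) (lowest_tensor (length zs)) s = Fb zs s"
proof (cases s)
  case 0
  have "TD 0 = {0}" by auto
  then have "Fb zs 0 = {0}" by (simp only: Fb_def image_insert image_empty clin_zero[OF clin_ev])
  then show ?thesis unfolding 0 filt_below_def by simp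
qed (simp add: filt_below_def filt_eq Fb_def)

lemma subspace_Fb: "cvec.subspace (Fb zs s)"
  unfolding Fb_def ev_span_image by (rule cvec.subspace_span)

lemma ev_TD: "a \<in> TD s \<Longrightarrow> ev zs a \<in> Fb zs s"
  unfolding Fb_def by (rule imageI)

text \<open>The kernel of the map from the tensor algebra to the associated graded module.\<close>

definition graded_kernel :: "complex list \<Rightarrow> tensor set" where
  "graded_kernel zs = {a \<in> TC. \<forall>s. ev zs (degree_part s a) \<in> Fb zs s}"

lemma graded_kernel_iff: "a \<in> graded_kernel zs \<longleftrightarrow> a \<in> TC \<and> (\<forall>s. ev zs (degree_part s a) \<in> Fb zs s)"
  unfolding graded_kernel_def by (rule mem_Collect_eq)

lemma graded_kernelD:
  assumes "a \<in> graded_kernel zs"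
  shows "a \<in> TC" "ev zs (degree_part s a) \<in> Fb zs s"
  using assms unfolding graded_kernel_iff by (rule conjunct1, rule spec[OF conjunct2])

lemma subspace_graded_kernel: "cvec.subspace (graded_kernel zs)"
proof (rule cvec.subspaceI)
  show "0 \<in> graded_kernel zs"
    using cvec.subspace_0[OF subspace_Fb]
    by (simp add: graded_kernel_iff clin_zero[OF clin_degree_part] clin_zero[OF clin_ev])
next
  fix x y assume xy: "x \<in> graded_kernel zs" "y \<in> graded_kernel zs"
  show "x + y \<in> graded_kernel zs"
    unfolding graded_kernel_iff clin_add[OF clin_degree_part] clin_add[OF clin_ev]
    by (intro conjI allI cvec.subspace_add[OF subspace_Fb] cvec.subspace_add[OF subspace_TC]
        graded_kernelD[OF xy(1)] graded_kernelD[OF xy(2)])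
next
  fix c x assume x: "x \<in> graded_kernel zs"
  show "cscale c x \<in> graded_kernel zs"
    unfolding graded_kernel_iff clin_scale[OF clin_degree_part] clin_scale[OF clin_ev]
    by (intro conjI allI cvec.subspace_scale[OF subspace_Fb] cvec.subspace_scale[OF subspace_TC] graded_kernelD[OF x])
qed

lemma graded_kernel_subset: "graded_kernel zs \<subseteq> TC"
  by (auto simp: graded_kernel_def)

text \<open>The right side is the action formula of \<open>assoc_graded\<close>. Hence the map to
  the graded module respects the action and its kernel is stable.\<close>

lemma ev_degree_part_tact:
  "ev zs (degree_part m (tact x a))
    = (\<Sum>j\<le>m. sm_act (eval_tensor zs) (t_component (m - j) x) (ev zs (degree_part j a)))"
proof -
  let ?A = "\<lambda>g. lin_ext (eval_tensor_act zs g)"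
  have "(\<Sum>j\<le>m. sm_act (eval_tensor zs) (t_component (m - j) x) (ev zs (degree_part j a)))
    = (\<Sum>j\<le>m. lin_ext (\<lambda>g. if snd g = m - j then ?A g (ev zs (degree_part j a)) else 0) x)"
    unfolding eval_act t_component_def lin_ext_lin_ext
    by (intro sum.cong refl lin_ext_cong) (auto split: prod.splits)
  also have "\<dots> = lin_ext (\<lambda>g. \<Sum>j\<le>m. if snd g = m - j then ?A g (ev zs (degree_part j a)) else 0) x"
    unfolding lin_ext_def by (subst sum.swap) (simp only: cvec.scale_sum_right)
  also have "\<dots> = lin_ext (\<lambda>g. ev zs (degree_part m (letter g a))) x"
  proof (rule lin_ext_cong)
    fix g
    show "(\<Sum>j\<le>m. if snd g = m - j then ?A g (ev zs (degree_part j a)) else 0) = ev zs (degree_part m (letter g a))"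
    proof (cases "snd g \<le> m")
      case True
      have "(\<Sum>j\<le>m. if snd g = m - j then ?A g (ev zs (degree_part j a)) else 0)
        = (\<Sum>j\<le>m. if j = m - snd g then ?A g (ev zs (degree_part j a)) else 0)"
        using True by (intro sum.cong refl) auto
      then show ?thesis using True by (simp add: degree_part_letter ev_letter)
    next
      case False
      then show ?thesis by (auto simp: degree_part_letter clin_zero[OF clin_ev] intro!: sum.neutral)
    qed
  qed
  also have "\<dots> = ev zs (degree_part m (tact x a))"
    by (simp add: tact_eq clin_apply_lin_ext[OF clin_ev] clin_apply_lin_ext[OF clin_degree_part])
  finally show ?thesis by simp
qed

lemma eval_act_Fb:
  assumes "x \<in> twisted_current" "p \<in> Fb zs s"
  shows "sm_act (eval_tensor zs) (t_component k x) p \<in> Fb zs (s + k)"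
proof -
  obtain a where a: "a \<in> TD s" "p = ev zs a" using assms(2) unfolding Fb_def by (rule imageE)
  show ?thesis
    unfolding eval_act t_component_def lin_ext_lin_ext
  proof (rule lin_ext_mem[OF subspace_Fb])
    fix g assume g: "g \<in> Poly_Mapping.keys x"
    then have gt: "g \<in> twisted_basis" using assms(1) by (auto simp: twisted_current_def)
    obtain y i where yi: "g = (y, i)" by force
    have "ev zs (letter g a) \<in> Fb zs (s + i)" using letter_TD[OF gt a(1)] yi by (intro ev_TD) simp
    then show "lin_ext (\<lambda>g. lin_ext (eval_tensor_act zs g) p) (case g of (y, j) \<Rightarrow> if j = k then cur y j else 0) \<in> Fb zs (s + k)"
      using cvec.subspace_0[OF subspace_Fb] by (auto simp: yi a(2) ev_letter)
  qed
qed

lemma stable_graded_kernel: "stable_submodule (graded_kernel zs) tensor_algebra"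
  unfolding stable_submodule_def submodule_tensor_algebra_iff
proof (intro conjI subspace_graded_kernel graded_kernel_subset ballI)
  fix x a assume x: "x \<in> twisted_current" and a: "a \<in> graded_kernel zs"
  have "ev zs (degree_part m (tact x a)) \<in> Fb zs m" for m
    unfolding ev_degree_part_tact
  proof (rule cvec.subspace_sum[OF subspace_Fb])
    fix j assume "j \<in> {..m}"
    then show "sm_act (eval_tensor zs) (t_component (m - j) x) (ev zs (degree_part j a)) \<in> Fb zs m"
      using eval_act_Fb[OF x, of "ev zs (degree_part j a)" zs j "m - j"] a by (simp add: graded_kernel_def)
  qed
  then show "tact x a \<in> graded_kernel zs"
    unfolding graded_kernel_iff by (intro conjI allI tact_TC[OF x graded_kernelD(1)[OF a]])
qed

lemma graded_kernel_parity:
  assumes "a \<in> graded_kernel zs"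
  shows "parity_part p a \<in> graded_kernel zs"
proof -
  have a: "a \<in> TC" by (rule graded_kernelD(1)[OF assms])
  have "ev zs (degree_part s (parity_part p a)) \<in> Fb zs s" for s
  proof -
    let ?c = "degree_part s a"
    obtain d where d: "d \<in> TD s" "ev zs ?c = ev zs d"
      using graded_kernelD(2)[OF assms, of s] unfolding Fb_def by (rule imageE)
    \<comment> \<open>\<open>?b\<close> evaluates to zero, and its parity components evaluate into
      complementary parts, so each evaluates to zero. The parity component of \<open>d\<close> is
      then the required representative of lower degree.\<close>
    let ?b = "?c - d"
    have dT: "d \<in> TC" using d(1) by auto
    have b: "?b \<in> TC" by (rule cvec.subspace_diff[OF subspace_TC degree_part_TC[OF a] dT])
    have part: "ev zs (parity_part r ?b) \<in> sm_part (eval_tensor zs) r" for r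
      by (rule ev_part[OF parity_part_TP[OF b]])
    have "ev zs (parity_part False ?b) + ev zs (parity_part True ?b) = 0"
      using d(2) by (simp add: parity_part_sum clin_diff[OF clin_ev] flip: clin_add[OF clin_ev])
    then have neg: "ev zs (parity_part p ?b) = - ev zs (parity_part (\<not> p) ?b)"
      by (cases p) (simp_all add: eq_neg_iff_add_eq_0 add.commute)
    then have "ev zs (parity_part p ?b) \<in> sm_part (eval_tensor zs) (\<not> p)"
      using cvec.subspace_neg[OF subspace_eval_part part[of "\<not> p"]] by simp
    then have "ev zs (parity_part p ?b) = 0" using eval_part_disjoint part by blast
    then have "ev zs (parity_part p ?c) = ev zs (parity_part p d)"
      by (simp add: clin_diff[OF clin_parity_part] clin_diff[OF clin_ev])
    also have "\<dots> \<in> Fb zs s" using d(1) keys_parity_part[of p d] by (intro ev_TD) auto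
    finally show ?thesis by (simp add: degree_part_parity_part)
  qed
  then show ?thesis
    unfolding graded_kernel_iff by (intro conjI allI subsetD[OF TP_subset_TC parity_part_TP[OF a]])
qed

text \<open>The defect of two basis letters. It shifts \<open>t\<close>-degree by a fixed amount,
  which a defect of general elements need not do.\<close>

definition letter_defect where
  "letter_defect g g' v = lin_ext (\<lambda>u. letter (u, snd g + snd g') v) (osp_bracket (fst g) (fst g'))
     - (letter g (letter g' v) - cscale (koszul (osp_odd (fst g)) (osp_odd (fst g'))) (letter g' (letter g v)))"

lemma tact_cur_bracket:
  "tact (cur_bracket x y) v
    = lin_ext (\<lambda>g. lin_ext (\<lambda>g'. lin_ext (\<lambda>u. letter (u, snd g + snd g') v) (osp_bracket (fst g) (fst g'))) y) x"
  unfolding tact_eq cur_bracket_def bilin_ext_def lin_ext_lin_ext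
  by (intro lin_ext_cong) (simp add: lin_ext_lin_ext split: prod.splits)

lemma letter_lin_ext: "letter g (lin_ext \<phi> p) = lin_ext (\<lambda>a. letter g (\<phi> a)) p"
  by (rule clin_apply_lin_ext[OF clin_letter])

lemma bracket_defect_eq:
  assumes "x \<in> twisted_part p" "y \<in> twisted_part p'"
  shows "bracket_defect (koszul p p') x y v = lin_ext (\<lambda>g. lin_ext (\<lambda>g'. letter_defect g g' v) y) x"
proof -
  have 1: "tact x (tact y v) = lin_ext (\<lambda>g. lin_ext (\<lambda>g'. letter g (letter g' v)) y) x" for x y
    by (simp add: tact_eq letter_lin_ext)
  have 2: "tact y (tact x v) = lin_ext (\<lambda>g. lin_ext (\<lambda>g'. letter g' (letter g v)) y) x"
    unfolding 1 by (rule lin_ext_swap)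
  have "bracket_defect (koszul p p') x y v = lin_ext (\<lambda>g. lin_ext (\<lambda>g'.
      lin_ext (\<lambda>u. letter (u, snd g + snd g') v) (osp_bracket (fst g) (fst g'))
      - (letter g (letter g' v) - cscale (koszul p p') (letter g' (letter g v)))) y) x"
    by (simp only: bracket_defect_def 1[of x] 2 tact_cur_bracket lin_ext_diff_fun lin_ext_cscale_fun)
  also have "\<dots> = lin_ext (\<lambda>g. lin_ext (\<lambda>g'. letter_defect g g' v) y) x"
  proof (intro lin_ext_cong)
    fix g g' assume "g \<in> Poly_Mapping.keys x" "g' \<in> Poly_Mapping.keys y"
    then have "osp_odd (fst g) = p" "osp_odd (fst g') = p'" using assms by (auto simp: twisted_part_def)
    then show "lin_ext (\<lambda>u. letter (u, snd g + snd g') v) (osp_bracket (fst g) (fst g'))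
      - (letter g (letter g' v) - cscale (koszul p p') (letter g' (letter g v))) = letter_defect g g' v"
      by (simp add: letter_defect_def)
  qed
  finally show ?thesis .
qed

lemma ev_letter_defect: "ev zs (letter_defect g g' v) = 0"
  unfolding letter_defect_def clin_diff[OF clin_ev] clin_scale[OF clin_ev] clin_apply_lin_ext[OF clin_ev] ev_letter
  by (simp add: eval_tensor_bracket)

lemma degree_part_letter_defect:
  "degree_part s (letter_defect g g' v)
    = (if snd g + snd g' \<le> s then letter_defect g g' (degree_part (s - (snd g + snd g')) v) else 0)"
  unfolding letter_defect_def clin_diff[OF clin_degree_part] clin_scale[OF clin_degree_part]
    clin_apply_lin_ext[OF clin_degree_part] degree_part_letter
  by (auto simp: lin_ext_zero_fun clin_zero[OF clin_letter] diff_diff_left add.commute)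

lemma letter_defect_TC:
  assumes g: "g \<in> twisted_basis" "g' \<in> twisted_basis" and v: "v \<in> TC"
  shows "letter_defect g g' v \<in> TC"
proof -
  have tw: "(u, snd g + snd g') \<in> twisted_basis" if "u \<in> Poly_Mapping.keys (osp_bracket (fst g) (fst g'))" for u
    using osp_odd_bracket[OF that] g by (auto simp: twisted_basis_def)
  show ?thesis
    unfolding letter_defect_def
    by (intro cvec.subspace_diff[OF subspace_TC] cvec.subspace_scale[OF subspace_TC]
        lin_ext_mem[OF subspace_TC] letter_TC g v tw)
qed

text \<open>Letter defects already vanish on the tensor product, and each degree part of one is zero
  or again a letter defect.\<close>

lemma bracket_defect_graded_kernel:
  assumes "x \<in> twisted_part p" "y \<in> twisted_part p'" "v \<in> TC"
  shows "bracket_defect (koszul p p') x y v \<in> graded_kernel zs"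
  unfolding bracket_defect_eq[OF assms(1,2)]
proof (intro lin_ext_mem[OF subspace_graded_kernel])
  fix g g' assume "g \<in> Poly_Mapping.keys x" "g' \<in> Poly_Mapping.keys y"
  then have "letter_defect g g' v \<in> TC"
    using assms by (intro letter_defect_TC) (auto simp: twisted_part_def twisted_current_def)
  moreover have "ev zs (degree_part s (letter_defect g g' v)) = 0" for s
    by (simp add: degree_part_letter_defect ev_letter_defect clin_zero[OF clin_ev])
  ultimately show "letter_defect g g' v \<in> graded_kernel zs"
    using cvec.subspace_0[OF subspace_Fb] by (simp add: graded_kernel_def)
qed

lemma eval_lowest_annihilated:
  "y \<in> {osp_f, osp_gm} \<Longrightarrow> eval_tensor_act zs (y, k) (replicate (length zs) V_m) = 0"
proof (induction zs)
  case (Cons z zs)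
  then show ?case
    unfolding length_Cons replicate_Suc eval_tensor_act_Cons
    by (auto simp: clin_zero[OF clin_tens] clin_zero[OF clin_tens_left])
qed simp

lemma eval_lowest_h:
  "eval_tensor_act zs (osp_h, k) (replicate (length zs) V_m)
    = cscale (- (\<Sum>z\<leftarrow>zs. z ^ k)) (bas (replicate (length zs) V_m))"
proof (induction zs)
  case (Cons z zs)
  show ?case
    unfolding length_Cons replicate_Suc eval_tensor_act_Cons Cons.IH
    by (simp add: tens_bas_left tens_bas_right koszul_def flip: single_add single_uminus single_diff)
qed simp

lemma graded_kernel_integrable:
  assumes "a \<in> TC" "y \<in> {osp_e, osp_f}"
  shows "(letter (y, 0) ^^ Suc (length zs)) a \<in> graded_kernel zs"
proof -
  let ?m = "Suc (length zs)"
  have ev_pow: "ev zs ((letter (y, 0) ^^ m) b) = (lin_ext (eval_tensor_act zs (y, 0)) ^^ m) (ev zs b)" for m b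
    by (induction m) (simp_all add: ev_letter)
  have "ev zs (degree_part s ((letter (y, 0) ^^ ?m) a)) = 0" for s
    unfolding degree_part_letter0_power ev_pow
    by (rule eval_tensor_nilpotent[OF _ assms(2)])
      (use ev_carrier[of zs "degree_part s a"] in \<open>simp add: eval_tensor_def\<close>)
  moreover have "(letter (y, 0) ^^ m) a \<in> TC" for m
  proof (induction m)
    case (Suc m)
    have "(y, 0) \<in> twisted_basis" using assms(2) by (auto simp: twisted_basis_def)
    from letter_TC[OF this Suc] show ?case by simp
  qed (use assms in simp)
  ultimately show ?thesis
    using cvec.subspace_0[OF subspace_Fb] unfolding graded_kernel_def by (simp del: funpow.simps)
qed

lemma graded_kernelI:
  assumes "a \<in> TC" "Poly_Mapping.keys a \<subseteq> {u. sum_list (map snd u) = s}" "ev zs a \<in> Fb zs s"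
  shows "a \<in> graded_kernel zs"
  using assms cvec.subspace_0[OF subspace_Fb]
  by (auto simp: graded_kernel_def degree_part_eq_self clin_zero[OF clin_ev])

lemma presentation_graded_quot:
  "presentation (\<lambda>a. graded_kernel zs +>\<^bsub>tensor_algebra\<^esub> a) (graded_kernel zs) (quot_module tensor_algebra (graded_kernel zs))"
  by (rule presentation_quot[OF stable_graded_kernel])

lemma graded_kernel_admissible:
  fixes zs :: "complex list"
  defines "Q \<equiv> quot_module tensor_algebra (graded_kernel zs)"
  shows "twisted_supermodule Q" "sl2_integrable Q"
    "weyl_relations (length zs) Q (graded_kernel zs +>\<^bsub>tensor_algebra\<^esub> bas [])"
proof -
  let ?J = "graded_kernel zs"
  interpret presentation "\<lambda>a. ?J +>\<^bsub>tensor_algebra\<^esub> a" ?J Q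
    unfolding Q_def by (rule presentation_graded_quot)
  show "twisted_supermodule Q"
    by (rule twisted_supermodule[OF subspace_graded_kernel graded_kernel_parity bracket_defect_graded_kernel])
  show "sl2_integrable Q"
    unfolding sl2_integrable_iff using graded_kernel_integrable by blast
  have word: "ev zs (bas [g]) = lin_ext (eval_tensor_act zs g) (lowest_tensor (length zs))" for g
    using ev_letter[of zs g "bas []"] by (simp add: letter_def ev_Nil)
  have "bas [(osp_f, 2 * i)] \<in> ?J" for i
    by (rule graded_kernelI[where s = "2 * i"])
      (use cvec.subspace_0[OF subspace_Fb] in
        \<open>auto simp: twisted_basis_def word lowest_tensor_def eval_lowest_annihilated\<close>)
  moreover have "bas [(osp_gm, 2 * i + 1)] \<in> ?J" for i
    by (rule graded_kernelI[where s = "2 * i + 1"])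
      (use cvec.subspace_0[OF subspace_Fb] in
        \<open>auto simp: twisted_basis_def word lowest_tensor_def eval_lowest_annihilated\<close>)
  moreover have "bas [(osp_h, 2 * i + 2)] \<in> ?J" for i
  proof (rule graded_kernelI[where s = "2 * i + 2"])
    \<comment> \<open>The lowest tensor has degree 0, which is below \<open>2 * i + 2\<close>. So a
      scalar multiple of it is zero in the graded piece.\<close>
    have mem: "lowest_tensor (length zs) \<in> Fb zs (2 * i + 2)"
      unfolding ev_Nil[symmetric] by (rule ev_TD) simp
    have eq: "ev zs (bas [(osp_h, 2 * i + 2)]) = cscale (- (\<Sum>z\<leftarrow>zs. z ^ (2 * i + 2))) (lowest_tensor (length zs))"
      unfolding word unfolding lowest_tensor_def lin_ext_single cvec.scale_one by (rule eval_lowest_h)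
    show "ev zs (bas [(osp_h, 2 * i + 2)]) \<in> Fb zs (2 * i + 2)"
      unfolding eq by (rule cvec.subspace_scale[OF subspace_Fb mem])
  qed (auto simp: twisted_basis_def)
  moreover have "bas [(osp_h, 0)] - cscale (- of_nat (length zs)) (bas []) \<in> ?J"
  proof (rule graded_kernelI[where s = 0])
    have "bas [(osp_h, 0)] \<in> TC" "bas [] \<in> TC" by (auto simp: twisted_basis_def)
    then show "bas [(osp_h, 0)] - cscale (- of_nat (length zs)) (bas []) \<in> TC"
      by (intro cvec.subspace_diff[OF subspace_TC] cvec.subspace_scale[OF subspace_TC])
    show "Poly_Mapping.keys (bas [(osp_h, 0)] - cscale (- of_nat (length zs)) (bas [])) \<subseteq> {u. sum_list (map snd u) = 0}"
      by (auto simp: in_keys_iff lookup_minus lookup_single when_def split: if_splits)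
    have "ev zs (bas [(osp_h, 0)]) = cscale (- (\<Sum>z\<leftarrow>zs. z ^ 0)) (lowest_tensor (length zs))"
      unfolding word unfolding lowest_tensor_def lin_ext_single cvec.scale_one by (rule eval_lowest_h)
    moreover have "(\<Sum>z\<leftarrow>zs. z ^ 0) = (of_nat (length zs) :: complex)" by (induction zs) simp_all
    ultimately have "ev zs (bas [(osp_h, 0)] - cscale (- of_nat (length zs)) (bas [])) = 0"
      by (simp only: clin_diff[OF clin_ev] clin_scale[OF clin_ev] ev_Nil diff_self)
    then show "ev zs (bas [(osp_h, 0)] - cscale (- of_nat (length zs)) (bas [])) \<in> Fb zs 0"
      using cvec.subspace_0[OF subspace_Fb] by (simp only:)
  qed
  moreover have "(letter (osp_e, 0) ^^ (length zs + 1)) (bas []) \<in> ?J"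
    using graded_kernel_integrable[of "bas []" osp_e zs] by simp
  ultimately show "weyl_relations (length zs) Q (?J +>\<^bsub>tensor_algebra\<^esub> bas [])"
    unfolding weyl_relations_iff by blast
qed

section \<open>The map from tensors onto the associated graded module\<close>

definition graded_map :: "complex list \<Rightarrow> tensor \<Rightarrow> nat \<Rightarrow> (V_basis list \<Rightarrow>\<^sub>0 complex) set" where
  "graded_map zs a s = vcoset (Fb zs s) (ev zs (degree_part s a))"

lemma gr_piece_simps:
  fixes zs :: "complex list"
  defines "G \<equiv> \<lambda>s. gr_piece (eval_tensor zs) (lowest_tensor (length zs)) s"
  shows "carrier (G s) = vcoset (Fb zs s) ` (ev zs ` TD (Suc s))"
    "zero (G s) = Fb zs s"
    "add (G s) A B = {x + y | x y. x \<in> A \<and> y \<in> B}"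
    "smult (G s) c A = {x + y | x y. x \<in> Fb zs s \<and> y \<in> cscale c ` A}"
    "sm_part (G s) p = vcoset (Fb zs s) ` (sm_part (eval_tensor zs) p \<inter> ev zs ` TD (Suc s))"
proof -
  let ?M = "eval_tensor zs\<lparr>carrier := ev zs ` TD (Suc s), sm_part := \<lambda>p. sm_part (eval_tensor zs) p \<inter> ev zs ` TD (Suc s)\<rparr>"
  have G: "G s = quot_module ?M (Fb zs s)"
    unfolding G_def gr_piece_def filt_eq filt_below_eq ..
  have add: "add ?M = (+)" by (simp add: eval_tensor_def)
  show "carrier (G s) = vcoset (Fb zs s) ` (ev zs ` TD (Suc s))"
    unfolding G quot_module_def A_RCOSETS_def RCOSETS_def a_r_coset_def[symmetric]
    by (auto simp: a_r_coset_def[symmetric] a_r_coset_eq[OF add])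
  show "zero (G s) = Fb zs s" by (simp add: G quot_module_def)
  show "add (G s) A B = {x + y | x y. x \<in> A \<and> y \<in> B}"
    by (simp add: G quot_module_def set_add_eq[OF add])
  show "smult (G s) c A = {x + y | x y. x \<in> Fb zs s \<and> y \<in> cscale c ` A}"
    by (simp add: G quot_module_def set_add_eq[OF add]) (simp add: eval_tensor_def)
  show "sm_part (G s) p = vcoset (Fb zs s) ` (sm_part (eval_tensor zs) p \<inter> ev zs ` TD (Suc s))"
    by (simp add: G quot_module_def a_r_coset_eq[OF add])
qed

text \<open>\<open>Y\<close> will be \<open>TC\<close> or one of the parity parts. The lift is the
  sum of the homogeneous representatives over the finitely many nonzero classes; at all other
  degrees the lift is 0 instead of \<open>b s\<close>.\<close>

lemma graded_map_image:
  assumes Y: "cvec.subspace Y" "Y \<subseteq> TC"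
    and rep: "\<And>s. \<exists>b\<in>Y. Poly_Mapping.keys b \<subseteq> {u. sum_list (map snd u) = s} \<and> \<phi> s = vcoset (Fb zs s) (ev zs b)"
    and fin: "finite {s. \<phi> s \<noteq> Fb zs s}"
  shows "\<phi> \<in> graded_map zs ` Y"
proof -
  have "\<forall>s. \<exists>b. b \<in> Y \<and> Poly_Mapping.keys b \<subseteq> {u. sum_list (map snd u) = s} \<and> \<phi> s = vcoset (Fb zs s) (ev zs b)"
    using rep unfolding Bex_def by (intro allI)
  from choice[OF this] obtain b where all: "\<forall>s. b s \<in> Y \<and> Poly_Mapping.keys (b s) \<subseteq> {u. sum_list (map snd u) = s}
      \<and> \<phi> s = vcoset (Fb zs s) (ev zs (b s))" ..
  note b = conjunct1[OF spec[OF all]] conjunct1[OF conjunct2[OF spec[OF all]]] conjunct2[OF conjunct2[OF spec[OF all]]]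
  let ?K = "{s. \<phi> s \<noteq> Fb zs s}"
  let ?a = "\<Sum>s\<in>?K. b s"
  have dp: "degree_part s ?a = (if s \<in> ?K then b s else 0)" for s
    using fin by (simp add: clin_sum[OF clin_degree_part] degree_part_eq_self[OF b(2)] sum.delta)
  have "graded_map zs ?a s = \<phi> s" for s
  proof (cases "s \<in> ?K")
    case True
    then have "degree_part s ?a = b s" using dp by simp
    then show ?thesis by (simp only: graded_map_def b(3))
  next
    case False
    then have "degree_part s ?a = 0" "\<phi> s = Fb zs s" using dp by simp_all
    then show ?thesis by (simp only: graded_map_def clin_zero[OF clin_ev] vcoset_zero)
  qed
  then have eq: "graded_map zs ?a = \<phi>" by (rule ext)
  have "?a \<in> Y" using b(1) by (intro cvec.subspace_sum[OF Y(1)])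
  then show ?thesis by (subst eq[symmetric]) (rule imageI)
qed

lemma finite_graded_map: "finite {s. graded_map zs a s \<noteq> Fb zs s}"
proof (rule finite_subset)
  show "{s. graded_map zs a s \<noteq> Fb zs s} \<subseteq> (\<lambda>u. sum_list (map snd u)) ` Poly_Mapping.keys a"
  proof clarify
    fix s assume s: "graded_map zs a s \<noteq> Fb zs s"
    show "s \<in> (\<lambda>u. sum_list (map snd u)) ` Poly_Mapping.keys a"
    proof (rule ccontr)
      assume "s \<notin> (\<lambda>u. sum_list (map snd u)) ` Poly_Mapping.keys a"
      then have "Poly_Mapping.keys (degree_part s a) = {}" by (auto simp: keys_degree_part)
      then have "degree_part s a = 0" by simp
      then have "graded_map zs a s = Fb zs s" by (simp only: graded_map_def clin_zero[OF clin_ev] vcoset_zero)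
      then show False using s by blast
    qed
  qed
qed simp

lemma vcoset_cong_Fb: "x - y \<in> Fb zs s \<Longrightarrow> vcoset (Fb zs s) x = vcoset (Fb zs s) y"
  by (rule vcoset_eq[OF subspace_Fb, THEN iffD2])

text \<open>Words of degree below \<open>s\<close> evaluate into \<open>Fb zs s\<close>, so only the
  top degree is visible in the quotient.\<close>

lemma vcoset_degree_part:
  assumes "a \<in> TD (Suc s)"
  shows "vcoset (Fb zs s) (ev zs a) = vcoset (Fb zs s) (ev zs (degree_part s a))"
  by (rule vcoset_cong_Fb) (use ev_TD[OF diff_degree_part_TD[OF assms]] in \<open>simp only: clin_diff[OF clin_ev]\<close>)

lemma presentation_graded_tensor: "presentation (graded_map zs) (graded_kernel zs) (graded_tensor zs)"
proof
  let ?M = "eval_tensor zs" and ?v = "lowest_tensor (length zs)"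
  note gr = graded_tensor_def assoc_graded_def
  have carrier: "carrier (graded_tensor zs)
      = {\<phi>. (\<forall>s. \<phi> s \<in> vcoset (Fb zs s) ` (ev zs ` TD (Suc s))) \<and> finite {s. \<phi> s \<noteq> Fb zs s}}"
    unfolding gr partial_object.simps gr_piece_simps ..
  have sm_part: "sm_part (graded_tensor zs) p
      = {\<phi>. (\<forall>s. \<phi> s \<in> vcoset (Fb zs s) ` (sm_part ?M p \<inter> ev zs ` TD (Suc s))) \<and> finite {s. \<phi> s \<noteq> Fb zs s}}" for p
    unfolding gr supermodule.simps gr_piece_simps ..
  show "carrier (graded_tensor zs) = graded_map zs ` TC"
  proof (intro Set.set_eqI iffI)
    fix \<phi> assume "\<phi> \<in> carrier (graded_tensor zs)"
    then have \<phi>: "\<And>s. \<phi> s \<in> vcoset (Fb zs s) ` (ev zs ` TD (Suc s))" "finite {s. \<phi> s \<noteq> Fb zs s}"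
      unfolding carrier mem_Collect_eq by (rule conjunct1[THEN spec], rule conjunct2)
    show "\<phi> \<in> graded_map zs ` TC"
    proof (rule graded_map_image[OF subspace_TC order_refl _ \<phi>(2)])
      fix s
      obtain m where "m \<in> ev zs ` TD (Suc s)" "\<phi> s = vcoset (Fb zs s) m"
        using \<phi>(1)[of s] by (rule imageE)
      then obtain a where a: "a \<in> TD (Suc s)" "\<phi> s = vcoset (Fb zs s) (ev zs a)" by (elim imageE) simp
      have "degree_part s a \<in> TC" using a(1) by (intro degree_part_TC) auto
      moreover have "Poly_Mapping.keys (degree_part s a) \<subseteq> {u. sum_list (map snd u) = s}"
        by (auto simp: keys_degree_part)
      ultimately show "\<exists>b\<in>TC. Poly_Mapping.keys b \<subseteq> {u. sum_list (map snd u) = s} \<and> \<phi> s = vcoset (Fb zs s) (ev zs b)"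
        unfolding a(2) vcoset_degree_part[OF a(1)] by (intro bexI[of _ "degree_part s a"] conjI refl)
    qed
  next
    fix \<phi> assume "\<phi> \<in> graded_map zs ` TC"
    then obtain a where a: "\<phi> = graded_map zs a" "a \<in> TC" by (rule imageE)
    have "graded_map zs a s \<in> vcoset (Fb zs s) ` (ev zs ` TD (Suc s))" for s
      unfolding graded_map_def by (intro imageI degree_part_TD a(2))
    then show "\<phi> \<in> carrier (graded_tensor zs)"
      unfolding a(1) carrier mem_Collect_eq by (intro conjI allI finite_graded_map)
  qed
  show "graded_map zs 0 = \<zero>\<^bsub>graded_tensor zs\<^esub>"
    unfolding gr ring.simps gr_piece_simps graded_map_def[abs_def] clin_zero[OF clin_degree_part] clin_zero[OF clin_ev] vcoset_zero ..
  show "graded_map zs (a + b) = graded_map zs a \<oplus>\<^bsub>graded_tensor zs\<^esub> graded_map zs b" for a b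
    unfolding gr ring.simps gr_piece_simps graded_map_def[abs_def] vcoset_add[OF subspace_Fb]
      clin_add[OF clin_degree_part] clin_add[OF clin_ev] ..
  show "graded_map zs (cscale c a) = c \<odot>\<^bsub>graded_tensor zs\<^esub> graded_map zs a" for c a
  proof -
    have "cscale c ` Fb zs s \<subseteq> Fb zs s" for s
      by (rule image_subsetI) (rule cvec.subspace_scale[OF subspace_Fb])
    then show ?thesis
      unfolding gr module.simps gr_piece_simps graded_map_def[abs_def]
        vcoset_image[OF subspace_Fb clin_cscale] clin_scale[OF clin_degree_part] clin_scale[OF clin_ev]
      by (simp only: vcoset_image[OF subspace_Fb clin_cscale])
  qed
  show "graded_map zs (tact x a) = sm_act (graded_tensor zs) x (graded_map zs a)" if x: "x \<in> twisted_current" for x a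
  proof (rule ext)
    fix m
    let ?e = "\<lambda>j. ev zs (degree_part j a)"
    let ?t = "\<lambda>j. sm_act ?M (t_component (m - j) x)"
    have "sm_act (graded_tensor zs) x (graded_map zs a) m
      = {(\<Sum>j\<le>m. ?t j (b j)) + c | b c. (\<forall>j\<le>m. b j \<in> vcoset (Fb zs j) (?e j)) \<and> c \<in> Fb zs m}"
      unfolding gr supermodule.simps filt_below_eq graded_map_def ..
    also have "\<dots> = vcoset (Fb zs m) (\<Sum>j\<le>m. ?t j (?e j))"
    proof (intro Set.set_eqI iffI)
      fix r assume "r \<in> {(\<Sum>j\<le>m. ?t j (b j)) + c | b c. (\<forall>j\<le>m. b j \<in> vcoset (Fb zs j) (?e j)) \<and> c \<in> Fb zs m}"
      then obtain b c where bc: "r = (\<Sum>j\<le>m. ?t j (b j)) + c" "\<And>j. j \<le> m \<Longrightarrow> b j \<in> vcoset (Fb zs j) (?e j)" "c \<in> Fb zs m"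
        by (elim CollectE exE conjE) (simp only: simp_thms)
      have "r - (\<Sum>j\<le>m. ?t j (?e j)) = (\<Sum>j\<le>m. ?t j (b j - ?e j)) + c"
        unfolding bc(1) clin_diff[OF clin_eval_act] sum_subtractf by simp
      also have "\<dots> \<in> Fb zs m"
      proof (intro cvec.subspace_add[OF subspace_Fb _ bc(3)] cvec.subspace_sum[OF subspace_Fb])
        fix j assume "j \<in> {..m}"
        then have j: "j \<le> m" by simp
        have "b j - ?e j \<in> Fb zs j" using bc(2)[OF j] unfolding vcoset_mem .
        from eval_act_Fb[OF x this, of "m - j"] j show "?t j (b j - ?e j) \<in> Fb zs m" by simp
      qed
      finally show "r \<in> vcoset (Fb zs m) (\<Sum>j\<le>m. ?t j (?e j))" unfolding vcoset_mem .
    next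
      fix r assume "r \<in> vcoset (Fb zs m) (\<Sum>j\<le>m. ?t j (?e j))"
      then obtain c where c: "c \<in> Fb zs m" "r = c + (\<Sum>j\<le>m. ?t j (?e j))"
        by (elim CollectE exE conjE) (simp only: simp_thms)
      have "?e j \<in> vcoset (Fb zs j) (?e j)" for j
        unfolding vcoset_mem diff_self by (rule cvec.subspace_0[OF subspace_Fb])
      then have mem: "\<forall>j\<le>m. ?e j \<in> vcoset (Fb zs j) (?e j)" by (rule allI[OF impI])
      have "r = (\<Sum>j\<le>m. ?t j (?e j)) + c" unfolding c(2) by (rule add.commute)
      then show "r \<in> {(\<Sum>j\<le>m. ?t j (b j)) + c | b c. (\<forall>j\<le>m. b j \<in> vcoset (Fb zs j) (?e j)) \<and> c \<in> Fb zs m}"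
        by - (rule CollectI, rule exI[of _ ?e], rule exI[of _ c], erule conjI, rule conjI[OF mem c(1)])
    qed
    finally show "graded_map zs (tact x a) m = sm_act (graded_tensor zs) x (graded_map zs a) m"
      unfolding graded_map_def ev_degree_part_tact ..
  qed
  show "sm_part (graded_tensor zs) p = graded_map zs ` TP p" for p
  proof (intro Set.set_eqI iffI)
    fix \<phi> assume "\<phi> \<in> sm_part (graded_tensor zs) p"
    then have \<phi>: "\<And>s. \<phi> s \<in> vcoset (Fb zs s) ` (sm_part ?M p \<inter> ev zs ` TD (Suc s))" "finite {s. \<phi> s \<noteq> Fb zs s}"
      unfolding sm_part mem_Collect_eq by (rule conjunct1[THEN spec], rule conjunct2)
    show "\<phi> \<in> graded_map zs ` TP p"
    proof (rule graded_map_image[OF subspace_TP TP_subset_TC _ \<phi>(2)])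
      fix s
      obtain m where "m \<in> sm_part ?M p \<inter> ev zs ` TD (Suc s)" "\<phi> s = vcoset (Fb zs s) m"
        using \<phi>(1)[of s] by (rule imageE)
      then obtain c where c: "c \<in> TD (Suc s)" "ev zs c \<in> sm_part ?M p" "\<phi> s = vcoset (Fb zs s) (ev zs c)"
        by (elim IntE imageE) simp
      have cT: "c \<in> TC" using c(1) by auto
      \<comment> \<open>The lift \<open>c\<close> may have mixed parity although its value is
        homogeneous. Its component of the other parity evaluates to zero, so \<open>?c\<close> is a
        lift of the same value.\<close>
      let ?c = "parity_part p c"
      have part: "ev zs (parity_part r c) \<in> sm_part ?M r" for r
        by (rule ev_part[OF parity_part_TP[OF cT]])
      have "ev zs ?c + ev zs (parity_part (\<not> p) c) = ev zs c"
        using parity_part_sum[of c] by (cases p) (simp_all add: add.commute flip: clin_add[OF clin_ev])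
      then have d: "ev zs (parity_part (\<not> p) c) = ev zs c - ev zs ?c" by (simp add: eq_diff_eq add.commute)
      have "ev zs (parity_part (\<not> p) c) \<in> sm_part ?M p"
        unfolding d by (rule cvec.subspace_diff[OF subspace_eval_part c(2) part])
      then have "ev zs (parity_part (\<not> p) c) = 0" using part[of "\<not> p"] by (rule eval_part_disjoint)
      then have e: "ev zs c = ev zs ?c" using d by simp
      have TD: "?c \<in> TD (Suc s)" using c(1) keys_parity_part[of p c] by blast
      have "degree_part s ?c \<in> TP p" using parity_part_TP[OF cT, of p] by (auto simp: keys_degree_part)
      moreover have "Poly_Mapping.keys (degree_part s ?c) \<subseteq> {u. sum_list (map snd u) = s}"
        by (auto simp: keys_degree_part)
      ultimately show "\<exists>b\<in>TP p. Poly_Mapping.keys b \<subseteq> {u. sum_list (map snd u) = s} \<and> \<phi> s = vcoset (Fb zs s) (ev zs b)"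
        unfolding c(3) e vcoset_degree_part[OF TD] by (intro bexI[of _ "degree_part s ?c"] conjI refl)
    qed
  next
    fix \<phi> assume "\<phi> \<in> graded_map zs ` TP p"
    then obtain a where a: "\<phi> = graded_map zs a" "a \<in> TP p" by (rule imageE)
    have "graded_map zs a s \<in> vcoset (Fb zs s) ` (sm_part ?M p \<inter> ev zs ` TD (Suc s))" for s
    proof -
      have "a \<in> TC" using a(2) by auto
      then have m: "ev zs (degree_part s a) \<in> ev zs ` TD (Suc s)" by (intro imageI degree_part_TD)
      have "degree_part s a \<in> TP p" using a(2) by (auto simp: keys_degree_part)
      then have "ev zs (degree_part s a) \<in> sm_part ?M p" by (rule ev_part)
      then show ?thesis unfolding graded_map_def by (rule imageI[OF IntI[OF _ m]])
    qed
    then show "\<phi> \<in> sm_part (graded_tensor zs) p"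
      unfolding a(1) sm_part mem_Collect_eq by (intro conjI allI finite_graded_map)
  qed
  show "(graded_map zs a = graded_map zs b) = (a - b \<in> graded_kernel zs)" if "a \<in> TC" "b \<in> TC" for a b
  proof -
    have "a - b \<in> graded_kernel zs \<longleftrightarrow> (\<forall>s. ev zs (degree_part s (a - b)) \<in> Fb zs s)"
      using cvec.subspace_diff[OF subspace_TC that] by (simp only: graded_kernel_def mem_Collect_eq simp_thms)
    then show ?thesis
      unfolding fun_eq_iff graded_map_def vcoset_eq[OF subspace_Fb]
        clin_diff[OF clin_degree_part] clin_diff[OF clin_ev] by (rule sym)
  qed
qed

section \<open>Comparison of the two modules\<close>

lemma ev_surj:
  assumes "\<And>i j. i < length zs \<Longrightarrow> j < length zs \<Longrightarrow> i \<noteq> j \<Longrightarrow> (zs ! i)\<^sup>2 \<noteq> (zs ! j)\<^sup>2"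
    and "\<And>i. i < length zs \<Longrightarrow> zs ! i \<noteq> 0"
  shows "ev zs ` TC = carrier (eval_tensor zs)"
proof
  show "ev zs ` TC \<subseteq> carrier (eval_tensor zs)" by (rule image_subsetI) (rule ev_carrier)
  have sub: "cvec.subspace (ev zs ` TC)" unfolding ev_span_image by (rule cvec.subspace_span)
  have "bas bs \<in> ev zs ` TC" if "length bs = length zs" for bs
  proof (rule eval_tensor_generated[OF assms sub _ _ that])
    show "lowest_tensor (length zs) \<in> ev zs ` TC" unfolding ev_Nil[symmetric] by (rule imageI) simp
    fix g v assume g: "g \<in> twisted_basis" and "v \<in> ev zs ` TC"
    from this(2) obtain a where a: "v = ev zs a" "a \<in> TC" by (rule imageE)
    show "lin_ext (eval_tensor_act zs g) v \<in> ev zs ` TC"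
      unfolding a(1) ev_letter[symmetric] by (rule imageI[OF letter_TC[OF g a(2)]])
  qed simp_all
  then have "cvec.span (bas ` {bs. length bs = length zs}) \<subseteq> ev zs ` TC"
    by (intro cvec.span_minimal[OF _ sub] image_subsetI) simp
  then show "carrier (eval_tensor zs) \<subseteq> ev zs ` TC"
    by (simp only: keys_subset_eq_span[symmetric]) (simp add: eval_tensor_def)
qed

lemma cyclic_generator_eval_tensor:
  assumes "ev zs ` TC = carrier (eval_tensor zs)"
  shows "cyclic_generator (eval_tensor zs) (lowest_tensor (length zs))"
  unfolding cyclic_generator_def
proof
  show "lowest_tensor (length zs) \<in> carrier (eval_tensor zs)"
    by (simp add: eval_tensor_def lowest_tensor_def)
  have "{u \<in> lists twisted_basis. sum_list (map snd u) \<in> UNIV} = lists twisted_basis" by simp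
  then show "cvec.span (\<Union>r. U_act (eval_tensor zs) (lowest_tensor (length zs)) r) = carrier (eval_tensor zs)"
    unfolding span_Union_U_act using assms by (simp only:)
qed

text \<open>The locale operators act on a whole type, whereas the ideals live in the span of twisted
  words. Words with other letters are sent to 0.\<close>

definition word_restrict :: "tensor \<Rightarrow> tensor" where
  "word_restrict = lin_ext (\<lambda>u. if u \<in> lists twisted_basis then bas u else 0)"

lemma clin_word_restrict: "clin word_restrict"
  unfolding word_restrict_def by (rule clin_lin_ext)

lemma word_restrict_TC: "word_restrict a \<in> TC"
  unfolding word_restrict_def by (rule lin_ext_mem[OF subspace_TC]) auto

lemma word_restrict_eq: "a \<in> TC \<Longrightarrow> word_restrict a = a"
  unfolding word_restrict_def by (rule trans[OF lin_ext_cong lin_ext_bas]) auto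

lemma word_restrict_letter: "g \<in> twisted_basis \<Longrightarrow> word_restrict (letter g a) = letter g (word_restrict a)"
  by (simp add: word_restrict_def letter_def lin_ext_lin_ext) (rule lin_ext_cong, simp)

lemma osp_bracket_twisted:
  assumes "g \<in> twisted_basis" "g' \<in> twisted_basis" "u \<in> Poly_Mapping.keys (osp_bracket (fst g) (fst g'))"
  shows "(u, snd g + snd g') \<in> twisted_basis"
  using osp_odd_bracket[OF assms(3)] assms(1,2) by (auto simp: twisted_basis_def)

text \<open>
  The quotient by the ideal \<open>K\<close> is realised as the image of a linear projection, so that the
  relations hold as equations between operators on a single type.
\<close>

lemma weyl_ideal_dim:
  assumes K: "cvec.subspace K"
    and letter_K: "\<And>g a. g \<in> twisted_basis \<Longrightarrow> a \<in> K \<Longrightarrow> letter g a \<in> K"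
    and defect_K: "\<And>g g' v. g \<in> twisted_basis \<Longrightarrow> g' \<in> twisted_basis \<Longrightarrow> v \<in> TC \<Longrightarrow> letter_defect g g' v \<in> K"
    and weyl: "\<And>i. bas [(osp_f, 2 * i)] \<in> K" "\<And>i. bas [(osp_gm, 2 * i + 1)] \<in> K"
      "\<And>i. bas [(osp_h, 2 * i + 2)] \<in> K" "bas [(osp_h, 0)] - cscale (- of_nat n) (bas []) \<in> K"
      "(letter (osp_e, 0) ^^ (n + 1)) (bas []) \<in> K"
  obtains \<pi> :: "tensor \<Rightarrow> tensor" and B
  where "clin \<pi>" "\<And>a. a \<in> TC \<Longrightarrow> \<pi> a = 0 \<longleftrightarrow> a \<in> K"
    "finite B" "card B \<le> 3 ^ n" "\<And>a. a \<in> TC \<Longrightarrow> \<pi> a \<in> cvec.span B"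
proof -
  \<comment> \<open>This preimage meets \<open>TC\<close> exactly in \<open>TC \<inter> K\<close>,
    and modulo it the bracket relations hold for arbitrary vectors, not only for those in
    \<open>TC\<close>.\<close>
  let ?Y = "{a. word_restrict a \<in> K}"
  have Y: "cvec.subspace ?Y"
    by (rule cvec.subspaceI)
      (simp_all add: clin_zero[OF clin_word_restrict] clin_add[OF clin_word_restrict]
        clin_scale[OF clin_word_restrict] cvec.subspace_0[OF K] cvec.subspace_add[OF K] cvec.subspace_scale[OF K])
  obtain \<pi> :: "tensor \<Rightarrow> tensor"
    where \<pi>: "clin \<pi>" "\<And>v. \<pi> v = 0 \<longleftrightarrow> v \<in> ?Y" "\<And>v. v - \<pi> v \<in> ?Y"
    by (rule quotient_projection[OF Y]) blast
  have \<pi>_K: "\<pi> a = 0 \<longleftrightarrow> a \<in> K" if "a \<in> TC" for a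
    using \<pi>(2)[of a] word_restrict_eq[OF that] by simp
  define L where "L g v = \<pi> (letter g v)" for g v
  have clin_L: "clin (L g)" for g
    unfolding L_def[abs_def] by (intro clin_compose[OF \<pi>(1)] clin_letter)
  have L_\<pi>: "L g (\<pi> v) = L g v" if g: "g \<in> twisted_basis" for g v
  proof -
    have "letter g (v - \<pi> v) \<in> ?Y" using \<pi>(3)[of v] letter_K[OF g] word_restrict_letter[OF g] by simp
    then have "\<pi> (letter g (v - \<pi> v)) = 0" using \<pi>(2) by blast
    then show ?thesis by (simp add: L_def clin_diff[OF clin_letter] clin_diff[OF \<pi>(1)])
  qed
  have rel: "lin_ext (\<lambda>u. L (u, snd g + snd g') v) (osp_bracket (fst g) (fst g'))
      = L g (L g' v) - cscale (koszul (osp_odd (fst g)) (osp_odd (fst g'))) (L g' (L g v))"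
    if g: "g \<in> twisted_basis" "g' \<in> twisted_basis" for g g' v
  proof -
    have "word_restrict (lin_ext (\<lambda>u. letter (u, snd g + snd g') v) (osp_bracket (fst g) (fst g')))
      = lin_ext (\<lambda>u. letter (u, snd g + snd g') (word_restrict v)) (osp_bracket (fst g) (fst g'))"
      unfolding clin_apply_lin_ext[OF clin_word_restrict]
      by (intro lin_ext_cong word_restrict_letter osp_bracket_twisted g)
    then have "word_restrict (letter_defect g g' v) = letter_defect g g' (word_restrict v)"
      unfolding letter_defect_def clin_diff[OF clin_word_restrict] clin_scale[OF clin_word_restrict]
      by (simp only: word_restrict_letter g)
    then have "\<pi> (letter_defect g g' v) = 0"
      using defect_K[OF g word_restrict_TC] \<pi>(2) by simp
    then have "\<pi> (lin_ext (\<lambda>u. letter (u, snd g + snd g') v) (osp_bracket (fst g) (fst g')))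
      = \<pi> (letter g (letter g' v)) - cscale (koszul (osp_odd (fst g)) (osp_odd (fst g'))) (\<pi> (letter g' (letter g v)))"
      by (simp add: letter_defect_def clin_diff[OF \<pi>(1)] clin_scale[OF \<pi>(1)])
    then show ?thesis
      using L_\<pi>[OF g(1)] L_\<pi>[OF g(2)] by (simp add: L_def clin_apply_lin_ext[OF \<pi>(1)])
  qed
  let ?e = "\<lambda>i. L (osp_e, 2 * i)" and ?f = "\<lambda>i. L (osp_f, 2 * i)" and ?h = "\<lambda>i. L (osp_h, 2 * i)"
    and ?g = "\<lambda>i. L (osp_gp, Suc (2 * i))" and ?k = "\<lambda>i. L (osp_gm, Suc (2 * i))"
  have tw: "(osp_e, 2 * i) \<in> twisted_basis" "(osp_f, 2 * i) \<in> twisted_basis" "(osp_h, 2 * i) \<in> twisted_basis"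
    "(osp_gp, Suc (2 * i)) \<in> twisted_basis" "(osp_gm, Suc (2 * i)) \<in> twisted_basis" for i
    by (simp_all add: twisted_basis_def)
  note rels = rel[OF tw(1) tw(1)] rel[OF tw(3) tw(3)] rel[OF tw(3) tw(1)] rel[OF tw(2) tw(1)]
    rel[OF tw(1) tw(4)] rel[OF tw(3) tw(4)] rel[OF tw(2) tw(4)] rel[OF tw(5) tw(4)] rel[OF tw(4) tw(4)]
    rel[OF tw(5) tw(1)]
  have L_nil: "L g (\<pi> (bas [])) = \<pi> (bas [g])" if "g \<in> twisted_basis" for g
    using L_\<pi>[OF that] by (simp add: L_def letter_def)
  have L_nil_0: "L g (\<pi> (bas [])) = 0" if "g \<in> twisted_basis" "bas [g] \<in> K" for g
    using \<pi>_K[of "bas [g]"] that by (simp add: L_nil)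
  have pow: "(L (osp_e, 0) ^^ m) (\<pi> v) = \<pi> ((letter (osp_e, 0) ^^ m) v)" for m v
  proof (induction m)
    case (Suc m)
    then show ?case using L_\<pi>[OF tw(1)[of 0]] by (simp add: L_def)
  qed simp
  have lpow: "(letter (osp_e, 0) ^^ m) (bas []) \<in> TC" for m
  proof (induction m)
    case (Suc m)
    then show ?case using letter_TC[OF tw(1)[of 0]] by simp
  qed simp
  interpret osp_current ?e ?f ?h ?g ?k n "\<pi> (bas [])"
  proof (intro osp_current.intro sl2_current.intro osp_current_axioms.intro clin_L)
    show "?e i (?e j v) = ?e j (?e i v)" for i j v using rels(1)[of i j v] by (simp add: koszul_def)
    show "?h i (?h j v) = ?h j (?h i v)" for i j v using rels(2)[of i j v] by (simp add: koszul_def)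
    show "?h i (?e j v) = ?e j (?h i v) + cscale 2 (?e (i + j) v)" for i j v
      using rels(3)[of i j v] by (simp add: koszul_def algebra_simps)
    show "?f i (?e j v) = ?e j (?f i v) - ?h (i + j) v" for i j v
      using rels(4)[of i j v] by (simp add: koszul_def algebra_simps lin_ext_uminus)
    show "?e i (?g j v) = ?g j (?e i v)" for i j v using rels(5)[of i j v] by (simp add: koszul_def)
    show "?h i (?g j v) = ?g j (?h i v) + ?g (i + j) v" for i j v
      using rels(6)[of i j v] by (simp add: koszul_def algebra_simps)
    show "?f i (?g j v) = ?g j (?f i v) - ?k (i + j) v" for i j v
      using rels(7)[of i j v] by (simp add: koszul_def algebra_simps lin_ext_uminus)
    show "?k i (?g j v) = ?h (Suc (i + j)) v - ?g j (?k i v)" for i j v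
      using rels(8)[of i j v] by (simp add: koszul_def algebra_simps)
    show "?g i (?g j v) = cscale 2 (?e (Suc (i + j)) v) - ?g j (?g i v)" for i j v
      using rels(9)[of i j v] by (simp add: koszul_def algebra_simps)
    show "?k i (?e j v) = ?e j (?k i v) + ?g (i + j) v" for i j v
      using rels(10)[of i j v] by (simp add: koszul_def algebra_simps)
    show "?f i (\<pi> (bas [])) = 0" for i by (rule L_nil_0[OF tw(2) weyl(1)])
    show "?k i (\<pi> (bas [])) = 0" for i using weyl(2)[of i] by (intro L_nil_0[OF tw(5)]) simp
    show "?h (Suc i) (\<pi> (bas [])) = 0" for i using weyl(3)[of i] by (intro L_nil_0[OF tw(3)]) simp
    have "bas [(osp_h, 0)] \<in> TC" "bas [] \<in> TC" by (auto simp: twisted_basis_def)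
    then have "bas [(osp_h, 0)] - cscale (- of_nat n) (bas []) \<in> TC"
      by (intro cvec.subspace_diff[OF subspace_TC] cvec.subspace_scale[OF subspace_TC])
    from \<pi>_K[OF this] weyl(4) have "\<pi> (bas [(osp_h, 0)]) = \<pi> (cscale (- of_nat n) (bas []))"
      unfolding clin_diff[OF \<pi>(1)] by (simp only: right_minus_eq)
    then have "\<pi> (bas [(osp_h, 0)]) = cscale (- of_nat n) (\<pi> (bas []))"
      unfolding clin_scale[OF \<pi>(1)] .
    then show "?h 0 (\<pi> (bas [])) = cscale (- of_nat n) (\<pi> (bas []))"
      using L_nil[OF tw(3)[of 0]] by (simp only: mult_0_right)
    show "(?e 0 ^^ Suc n) (\<pi> (bas [])) = 0"
      using \<pi>_K[OF lpow[of "n + 1"]] weyl(5) by (simp only: mult_0_right pow Suc_eq_plus1)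
  qed
  obtain B Z where BZ: "finite B" "card B \<le> 3 ^ n" "Z \<subseteq> cvec.span B" "cvec.subspace Z" "\<pi> (bas []) \<in> Z"
    "\<And>i v. v \<in> Z \<Longrightarrow> ?e i v \<in> Z" "\<And>i v. v \<in> Z \<Longrightarrow> ?f i v \<in> Z" "\<And>i v. v \<in> Z \<Longrightarrow> ?h i v \<in> Z"
    "\<And>i v. v \<in> Z \<Longrightarrow> ?g i v \<in> Z" "\<And>i v. v \<in> Z \<Longrightarrow> ?k i v \<in> Z"
    by (rule osp_dim_bound) blast
  have L_Z: "L (y, k) v \<in> Z" if "(y, k) \<in> twisted_basis" "v \<in> Z" for y k v
    using that BZ(6-10)[OF that(2), of "k div 2"]
    by (cases y) (auto simp: twisted_basis_def elim!: oddE evenE)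
  have "\<pi> (bas u) \<in> Z" if "u \<in> lists twisted_basis" for u
    using that
  proof (induction u)
    case (Cons g u)
    have "\<pi> (bas (g # u)) = L g (\<pi> (bas u))"
      using L_\<pi>[OF Cons.hyps(1)] by (simp add: L_def letter_def)
    then show ?case using L_Z[of "fst g" "snd g"] Cons by simp
  qed (rule BZ(5))
  then have "\<pi> a \<in> Z" if "a \<in> TC" for a
    using that clin_apply_lin_ext[OF \<pi>(1), of bas a] lin_ext_mem[OF BZ(4), of a "\<lambda>u. \<pi> (bas u)"]
    by (auto simp: lin_ext_bas)
  then show thesis using that[OF \<pi>(1) \<pi>_K BZ(1,2)] BZ(3) by blast
qed

section \<open>The dimension count\<close>

lemma span_inter_independent:
  assumes "cvec.independent (A \<union> B)" "A \<inter> B = {}" "x \<in> cvec.span A" "x \<in> cvec.span B"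
  shows "x = 0"
proof -
  have rep: "cvec.representation (A \<union> B) x = cvec.representation A x"
    "cvec.representation (A \<union> B) x = cvec.representation B x"
    by (rule cvec.representation_extend[OF assms(1,3) Un_upper1], rule cvec.representation_extend[OF assms(1,4) Un_upper2])
  have 0: "cvec.representation (A \<union> B) x = (\<lambda>b. 0)"
    unfolding fun_eq_iff
    using rep cvec.representation_ne_zero[of A x] cvec.representation_ne_zero[of B x] assms(2) by (metis disjoint_iff)
  have "x \<in> cvec.span (A \<union> B)" using assms(3) cvec.span_mono[of A "A \<union> B"] by auto
  from cvec.sum_nonzero_representation_eq[OF assms(1) this] show ?thesis unfolding 0 by simp
qed

lemma independent_bas: "finite K \<Longrightarrow> cvec.independent (bas ` K)" for K :: "'b set"
proof (rule cvec.independent_if_scalars_zero)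
  assume K: "finite K"
  fix f :: "('b \<Rightarrow>\<^sub>0 complex) \<Rightarrow> complex" and x
  assume 0: "(\<Sum>x\<in>bas ` K. cscale (f x) x) = 0" and "x \<in> bas ` K"
  then obtain b where b: "b \<in> K" "x = bas b" by blast
  have inj: "inj_on (bas :: 'b \<Rightarrow> _) K" by (rule inj_onI) (metis keys_single one_neq_zero singleton_inject)
  have "0 = Poly_Mapping.lookup (\<Sum>c\<in>K. cscale (f (bas c)) (bas c)) b"
    using 0 by (simp add: sum.reindex[OF inj])
  also have "\<dots> = (\<Sum>c\<in>K. if c = b then f (bas b) else 0)"
    by (auto simp: lookup_sum lookup_single when_def intro!: sum.cong)
  also have "\<dots> = f x" using K b by simp
  finally show "f x = 0" by simp
qed simp

lemma card_eval_basis: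
  "finite {bs :: V_basis list. length bs = n}" "card {bs :: V_basis list. length bs = n} = 3 ^ n"
proof -
  have U: "(UNIV :: V_basis set) = {V_m, V_0, V_p}" using V_basis.exhaust by auto
  have "finite (UNIV :: V_basis set)" "card (UNIV :: V_basis set) = 3" by (simp_all add: U)
  then show "finite {bs :: V_basis list. length bs = n}" "card {bs :: V_basis list. length bs = n} = 3 ^ n"
    using finite_lists_length_eq[of "UNIV :: V_basis set" n] card_lists_length_eq[of "UNIV :: V_basis set" n]
    by simp_all
qed

text \<open>
  Words forming a basis modulo the graded kernel are mapped to a spanning set of the tensor
  product, so the graded kernel has codimension at least \<open>3\<^sup>n\<close>.
\<close>

lemma graded_kernel_subset_ideal:
  assumes surj: "ev zs ` TC = carrier (eval_tensor zs)"
    and K: "K \<subseteq> graded_kernel zs" "0 \<in> K" "\<And>c a. cscale c a \<in> K \<Longrightarrow> c \<noteq> 0 \<Longrightarrow> a \<in> K"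
    and \<pi>: "clin \<pi>" "\<And>a. a \<in> TC \<Longrightarrow> \<pi> a = 0 \<longleftrightarrow> a \<in> K"
    and B: "finite B" "card B \<le> 3 ^ length zs" "\<And>a. a \<in> TC \<Longrightarrow> \<pi> a \<in> cvec.span B"
  shows "graded_kernel zs \<subseteq> K"
proof (rule subsetI, rule ccontr)
  let ?J = "graded_kernel zs"
  let ?W = "bas ` lists twisted_basis"
  fix a assume a: "a \<in> ?J" "a \<notin> K"
  obtain B1 where B1: "B1 \<subseteq> ?J" "cvec.independent B1" "?J \<subseteq> cvec.span B1"
    using cvec.maximal_independent_subset by blast
  have span_B1: "cvec.span B1 = ?J"
    using B1 cvec.span_minimal[OF B1(1) subspace_graded_kernel] by blast
  \<comment> \<open>The basis of the graded kernel is completed by single words. These are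
    homogeneous, so the span of \<open>Ws\<close> is closed under taking degree parts.\<close>
  obtain C where C: "B1 \<subseteq> C" "C \<subseteq> B1 \<union> ?W" "cvec.independent C" "B1 \<union> ?W \<subseteq> cvec.span C"
    using cvec.maximal_independent_subset_extend[of B1 "B1 \<union> ?W"] B1(2) by blast
  define Ws where "Ws = C - B1"
  have C_eq: "C = B1 \<union> Ws" and disj: "B1 \<inter> Ws = {}" and Ws: "Ws \<subseteq> ?W" using C(1,2) by (auto simp: Ws_def)
  have meet: "x = 0" if "x \<in> ?J" "x \<in> cvec.span Ws" for x
    using span_inter_independent[of B1 Ws x] C(3) disj that by (simp add: C_eq span_B1)
  have Ws_TC: "cvec.span Ws \<subseteq> TC" by (rule cvec.span_minimal[OF _ subspace_TC]) (use Ws in auto)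
  have deg_Ws: "degree_part s c \<in> cvec.span Ws" if "c \<in> cvec.span Ws" for s c
  proof (rule clin_span_image[OF clin_degree_part that _ cvec.subspace_span])
    fix x assume x: "x \<in> Ws"
    then obtain u where u: "x = bas u" using Ws by blast
    have "degree_part s x = (if s = sum_list (map snd u) then x else 0)"
      unfolding u by (rule degree_part_eq_self) simp
    then show "degree_part s x \<in> cvec.span Ws" using x by (auto intro: cvec.span_base cvec.span_zero)
  qed
  have ev_Ws: "ev zs c \<in> cvec.span (ev zs ` Ws)" if "c \<in> cvec.span Ws" for c
    by (rule clin_span_image[OF clin_ev that _ cvec.subspace_span]) (auto intro: cvec.span_base)
  have Fb_Ws: "Fb zs s \<subseteq> cvec.span (ev zs ` Ws)" for s
  proof (induction s)
    case 0
    show ?case unfolding Fb_def ev_span_image by (rule cvec.span_minimal) auto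
  next
    case (Suc s)
    show ?case
      unfolding Fb_def ev_span_image
    proof (rule cvec.span_minimal[OF _ cvec.subspace_span], rule subsetI)
      fix x assume "x \<in> {ev zs (bas u) | u. u \<in> {u \<in> lists twisted_basis. sum_list (map snd u) < Suc s}}"
      then obtain u where x: "x = ev zs (bas u)" and u: "u \<in> lists twisted_basis" "sum_list (map snd u) < Suc s"
        by blast
      have "ev zs (bas u) \<in> cvec.span (ev zs ` Ws)"
      proof (cases "sum_list (map snd u) < s")
        case True
        then have "ev zs (bas u) \<in> Fb zs s" using u(1) by (intro ev_TD) simp
        then show ?thesis by (rule subsetD[OF Suc])
      next
        case False
        then have s: "sum_list (map snd u) = s" using u(2) by simp
        \<comment> \<open>Split the word as \<open>b + c\<close> and take parts of degree
          \<open>s\<close>. The part of \<open>c\<close> stays in the span of \<open>Ws\<close>; the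
          part of \<open>b\<close> evaluates into \<open>Fb zs s\<close>, which the induction
          hypothesis covers.\<close>
        have "bas u \<in> ?W" using u(1) by (rule imageI)
        then have "bas u \<in> cvec.span (B1 \<union> Ws)" using C(4) unfolding C_eq by blast
        then have "\<exists>b c. bas u = b + c \<and> b \<in> ?J \<and> c \<in> cvec.span Ws"
          unfolding cvec.span_Un span_B1 mem_Collect_eq .
        then obtain b c where bc: "bas u = b + c" "b \<in> ?J" "c \<in> cvec.span Ws"
          by (elim exE conjE)
        have "degree_part s (bas u) = bas u" using degree_part_eq_self[of "bas u" s s] s by simp
        then have "bas u = degree_part s (bas u)" by (rule sym)
        also have "\<dots> = degree_part s b + degree_part s c" unfolding bc(1) by (rule clin_add[OF clin_degree_part])
        finally have "bas u = degree_part s b + degree_part s c" .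
        from arg_cong[OF this, of "ev zs"]
        have "ev zs (bas u) = ev zs (degree_part s b) + ev zs (degree_part s c)"
          unfolding clin_add[OF clin_ev] .
        moreover have "ev zs (degree_part s b) \<in> cvec.span (ev zs ` Ws)"
          by (rule subsetD[OF Suc graded_kernelD(2)[OF bc(2)]])
        moreover have "ev zs (degree_part s c) \<in> cvec.span (ev zs ` Ws)" by (intro ev_Ws deg_Ws bc(3))
        ultimately show ?thesis by (simp only: cvec.span_add)
      qed
      then show "x \<in> cvec.span (ev zs ` Ws)" unfolding x .
    qed
  qed
  have spanning: "carrier (eval_tensor zs) \<subseteq> cvec.span (ev zs ` Ws)"
    unfolding surj[symmetric] ev_span_image
  proof (rule cvec.span_minimal[OF _ cvec.subspace_span], rule subsetI)
    fix x assume "x \<in> {ev zs (bas u) | u. u \<in> lists twisted_basis}"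
    then obtain u where x: "x = ev zs (bas u)" and "u \<in> lists twisted_basis" by blast
    then have "x \<in> Fb zs (Suc (sum_list (map snd u)))" unfolding x by (intro ev_TD) simp
    then show "x \<in> cvec.span (ev zs ` Ws)" by (rule subsetD[OF Fb_Ws])
  qed
  have aTC: "a \<in> TC" by (rule graded_kernelD(1)[OF a(1)])
  have a_Ws: "a \<notin> cvec.span Ws" using meet a K(2) by blast
  have indep: "cvec.independent (insert a Ws)"
    using cvec.independent_insertI[OF a_Ws] cvec.independent_mono[OF C(3)] by (simp add: C_eq)
  \<comment> \<open>A vector killed by \<open>\<pi>\<close> lies in \<open>K\<close>, hence in
    \<open>?J\<close>. Subtracting its multiple of \<open>a\<close> leaves an element of
    \<open>?J\<close> in the span of \<open>Ws\<close>, which is zero; so the vector is a multiple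
    of \<open>a\<close> in \<open>K\<close>, and the multiple is 0.\<close>
  have inj: "inj_on \<pi> (cvec.span (insert a Ws))"
  proof (rule module_hom.inj_on_iff_eq_0[OF clin_hom[OF \<pi>(1)], THEN iffD2], simp, rule ballI, rule impI)
    fix x assume "x \<in> cvec.span (insert a Ws)" and 0: "\<pi> x = 0"
    then obtain r where r: "x - cscale r a \<in> cvec.span Ws" using cvec.span_breakdown_eq by blast
    have "cscale r a + (x - cscale r a) \<in> TC"
      by (rule cvec.subspace_add[OF subspace_TC cvec.subspace_scale[OF subspace_TC aTC] subsetD[OF Ws_TC r]])
    then have xK: "x \<in> K" using \<pi>(2)[of x] 0 by simp
    then have "x - cscale r a \<in> ?J"
      using K(1) a(1) by (intro cvec.subspace_diff[OF subspace_graded_kernel] cvec.subspace_scale[OF subspace_graded_kernel]) auto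
    from meet[OF this r] have x: "x = cscale r a" by simp
    then have "r = 0" using K(3)[of r a] xK a(2) by blast
    then show "x = 0" using x by simp
  qed
  interpret vector_space_pair "cscale :: complex \<Rightarrow> tensor \<Rightarrow> _"
    "cscale :: complex \<Rightarrow> ('a \<Rightarrow>\<^sub>0 complex) \<Rightarrow> _" ..
  have "cvec.independent (\<pi> ` insert a Ws)"
    by (rule linear_independent_injective_image[OF \<pi>(1) indep inj])
  moreover have "\<pi> ` insert a Ws \<subseteq> cvec.span B"
    using B(3) aTC Ws_TC cvec.span_superset[of Ws] by blast
  ultimately have fin: "finite (\<pi> ` insert a Ws)" "card (\<pi> ` insert a Ws) \<le> card B"
    using cvec.independent_span_bound[OF B(1)] by blast+
  have inj': "inj_on \<pi> (insert a Ws)" using inj cvec.span_superset by (rule inj_on_subset)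
  have finW: "finite Ws" using finite_imageD[OF fin(1) inj'] by simp
  have "a \<notin> Ws" using a_Ws cvec.span_base by blast
  \<comment> \<open>The extra vector \<open>a\<close> leaves room for fewer than
    \<open>3 ^ length zs\<close> words, while their values must span the whole tensor
    product.\<close>
  then have "Suc (card Ws) \<le> 3 ^ length zs"
    using fin(2) B(2) finW unfolding card_image[OF inj'] by simp
  moreover have "3 ^ length zs \<le> card Ws"
  proof -
    have inj_bas: "inj (bas :: V_basis list \<Rightarrow> _)" by (rule injI) (metis keys_single one_neq_zero singleton_inject)
    let ?I = "bas ` {bs :: V_basis list. length bs = length zs} :: (V_basis list \<Rightarrow>\<^sub>0 complex) set"
    have "?I \<subseteq> cvec.span (ev zs ` Ws)"
      using spanning by (auto simp: eval_tensor_def)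
    then have "card ?I \<le> card (ev zs ` Ws)"
      using cvec.independent_span_bound[OF finite_imageI[OF finW] independent_bas[OF card_eval_basis(1)]] by blast
    also have "\<dots> \<le> card Ws" by (rule card_image_le[OF finW])
    finally show ?thesis
      by (simp add: card_image[OF inj_on_subset[OF inj_bas subset_UNIV]] card_eval_basis(2))
  qed
  ultimately show False by simp
qed

text \<open>The graded kernel is one of the intersected ideals. Conversely the intersection inherits
  closure under letters, the defects and the relations, so \<open>weyl_ideal_dim\<close> bounds its
  codimension and \<open>graded_kernel_subset_ideal\<close> applies.\<close>

lemma weyl_kernel_eq:
  assumes surj: "ev zs ` TC = carrier (eval_tensor zs)"
  shows "weyl_kernel (length zs) = graded_kernel zs"
proof
  let ?n = "length zs"
  let ?F = "{J. stable_submodule J tensor_algebra \<and>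
     twisted_supermodule (quot_module tensor_algebra J) \<and>
     sl2_integrable (quot_module tensor_algebra J) \<and>
     weyl_relations ?n (quot_module tensor_algebra J) (J +>\<^bsub>tensor_algebra\<^esub> bas [])}"
  let ?K = "weyl_kernel ?n"
  have K: "?K = \<Inter>?F" by (simp only: weyl_kernel_def)
  have "graded_kernel zs \<in> ?F"
    using stable_graded_kernel graded_kernel_admissible[of zs] by blast
  then show sub: "?K \<subseteq> graded_kernel zs" unfolding K by (rule Inter_lower)
  have F: "cvec.subspace J" "\<And>x a. x \<in> twisted_current \<Longrightarrow> a \<in> J \<Longrightarrow> tact x a \<in> J"
    "presentation (\<lambda>a. J +>\<^bsub>tensor_algebra\<^esub> a) J (quot_module tensor_algebra J)"
    "twisted_supermodule (quot_module tensor_algebra J)"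
    "weyl_relations ?n (quot_module tensor_algebra J) (J +>\<^bsub>tensor_algebra\<^esub> bas [])" if "J \<in> ?F" for J
    using that presentation_quot[of J] unfolding mem_Collect_eq stable_submodule_def submodule_tensor_algebra_iff by blast+
  have sub_K: "cvec.subspace ?K" unfolding K by (rule cvec.subspace_Inter) (use F(1) in blast)
  have cur: "cur (fst g) (snd g) \<in> twisted_part (osp_odd (fst g))" if "g \<in> twisted_basis" for g
    using that by (auto simp: twisted_part_def twisted_current_def split: prod.splits)
  have letter_K: "letter g a \<in> ?K" if g: "g \<in> twisted_basis" and a: "a \<in> ?K" for g a
    unfolding K
  proof (rule InterI)
    fix J assume J: "J \<in> ?F"
    have "a \<in> J" using a J unfolding K by blast
    moreover have "cur (fst g) (snd g) \<in> twisted_current" using cur[OF g] by (simp add: twisted_part_def)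
    ultimately have "tact (cur (fst g) (snd g)) a \<in> J" by (intro F(2)[OF J])
    then show "letter g a \<in> J" by (simp add: tact_eq)
  qed
  have defect_K: "letter_defect g g' v \<in> ?K" if g: "g \<in> twisted_basis" "g' \<in> twisted_basis" and v: "v \<in> TC" for g g' v
    unfolding K
  proof (rule InterI)
    fix J assume J: "J \<in> ?F"
    have "bracket_defect (koszul (osp_odd (fst g)) (osp_odd (fst g'))) (cur (fst g) (snd g)) (cur (fst g') (snd g')) v \<in> J"
      by (rule presentation.bracket_defect_mem[OF F(3)[OF J] F(4)[OF J] cur[OF g(1)] cur[OF g(2)] v])
    then show "letter_defect g g' v \<in> J"
      unfolding bracket_defect_eq[OF cur[OF g(1)] cur[OF g(2)]] by simp
  qed
  have weyl_J: "(\<forall>i. bas [(osp_f, 2 * i)] \<in> J) \<and> (\<forall>i. bas [(osp_gm, 2 * i + 1)] \<in> J) \<and>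
     (\<forall>i. bas [(osp_h, 2 * i + 2)] \<in> J) \<and> bas [(osp_h, 0)] - cscale (- of_nat ?n) (bas []) \<in> J \<and>
     (letter (osp_e, 0) ^^ (?n + 1)) (bas []) \<in> J" if J: "J \<in> ?F" for J
    using F(5)[OF J] unfolding presentation.weyl_relations_iff[OF F(3)[OF J]] .
  have weyl: "bas [(osp_f, 2 * i)] \<in> ?K" "bas [(osp_gm, 2 * i + 1)] \<in> ?K" "bas [(osp_h, 2 * i + 2)] \<in> ?K"
    "bas [(osp_h, 0)] - cscale (- of_nat ?n) (bas []) \<in> ?K" "(letter (osp_e, 0) ^^ (?n + 1)) (bas []) \<in> ?K" for i
    unfolding K by (rule InterI, drule weyl_J, elim conjE, (erule spec | assumption))+
  show "graded_kernel zs \<subseteq> ?K"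
  proof (rule weyl_ideal_dim[OF sub_K letter_K defect_K weyl])
    fix \<pi> :: "tensor \<Rightarrow> tensor" and B
    assume \<pi>: "clin \<pi>" "\<And>a. a \<in> TC \<Longrightarrow> \<pi> a = 0 \<longleftrightarrow> a \<in> ?K"
      "finite B" "card B \<le> 3 ^ ?n" "\<And>a. a \<in> TC \<Longrightarrow> \<pi> a \<in> cvec.span B"
    show ?thesis
      by (rule graded_kernel_subset_ideal[OF surj sub cvec.subspace_0[OF sub_K] subspace_unscale[OF sub_K] \<pi>])
  qed
qed

theorem theorem1p9:
  fixes n :: nat and zs :: "complex list"
  assumes "length zs = n"
    and "\<And>i j. i < n \<Longrightarrow> j < n \<Longrightarrow> i \<noteq> j \<Longrightarrow> (zs ! i)\<^sup>2 \<noteq> (zs ! j)\<^sup>2"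
    and "\<And>i. i < n \<Longrightarrow> zs ! i \<noteq> 0"
  shows "cyclic_generator (eval_tensor zs) (lowest_tensor n) \<and>
    isomorphic_supermodules (graded_tensor zs) (twisted_weyl_module n)"
proof -
  have n: "n = length zs" using assms(1) by simp
  have surj: "ev zs ` TC = carrier (eval_tensor zs)"
    by (rule ev_surj) (use assms(2,3) in \<open>simp_all add: n\<close>)
  have weyl: "twisted_weyl_module n = quot_module tensor_algebra (graded_kernel zs)"
    by (simp only: twisted_weyl_module_def n weyl_kernel_eq[OF surj])
  have "twisted_supermodule (graded_tensor zs)"
    by (rule presentation.twisted_supermodule[OF presentation_graded_tensor subspace_graded_kernel])
      (rule graded_kernel_parity bracket_defect_graded_kernel; assumption)+
  then have "isomorphic_supermodules (graded_tensor zs) (twisted_weyl_module n)"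
    unfolding isomorphic_supermodules_def weyl
    using graded_kernel_admissible(1) presentation_iso[OF presentation_graded_tensor presentation_graded_quot]
    by blast
  then show ?thesis using cyclic_generator_eval_tensor[OF surj] n by simp
qed

end
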